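(* Let $b_n$ be a real-valued sequence with $b_n\to\infty$ and $b_n/\sqrt n\to0$, and let $(n^{1/3}/b_n^{2/3})(c_n-1)\to\breve\theta\in\mathbb{R}$ as $n\to\infty$. Then the following holds. 1. The sequence $\breve U^n=(U^n_1/(nb_n)^{2/3},U^n_2/(nb_n)^{2/3},\ldots)$, $n\in\mathbb{N}$, obeys the LDP in $\breve{\mathbb{S}}$ for scale $b_n^2$ with action functional $$\breve I^U_{\breve\theta}(\mathbf{u})=-\frac1{24}\sum_{i=1}^\infty u_i^3+\frac16\Bigl[\Bigl(\sum_{i=1}^\infty u_i-\breve\theta\Bigr)^3\vee0\Bigr]+\frac{\breve\theta^3}{6}$$ if $\sum_{i=1}^\infty u_i<\infty$, and $\breve I^U_{\breve\theta}(\mathbf{u})=\infty$ otherwise, where $\mathbf{u}=(u_1,u_2,\ldots)\in\breve{\mathbb{S}}$. 2. The sequence $\beta^n/(nb_n)^{2/3}$, $n\in\mathbb{N}$, obeys the LDP in $\mathbb{R}_+$ for scale $b_n^2$ with action functional $\breve I^\beta_{\breve\theta}$ given by $\breve I^\beta_{\breve\theta}(0)=(\breve\theta^3\vee0)/6$, $$\breve I^\beta_{\breve\theta}(u)=-\Bigl\lfloor\frac{\breve\theta}{u}\Bigr\rfloor\frac{u^3}{24}-\frac1{24}\Bigl(\Bigl(2\Bigl(\breve\theta-\Bigl\lfloor\frac{\breve\theta}{u}\Bigr\rfloor u\Bigr)\Bigr)\wedge u\Bigr)^3+\frac16\Bigl(\Bigl\lfloor\frac{\breve\theta}{u}\Bigr\rfloor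 u+\Bigl(2\Bigl(\breve\theta-\Bigl\lfloor\frac{\breve\theta}{u}\Bigr\rfloor u\Bigr)\Bigr)\wedge u-\breve\theta\Bigr)^3+\frac{\breve\theta^3}{6}$$ if $u\in(0,\breve\theta^+)$, and $$\breve I^\beta_{\breve\theta}(u)=-\frac{u^3}{24}+\frac{(u-\breve\theta)^3}{6}+\frac{\breve\theta^3}{6}$$ if $u\ge\breve\theta^+$ (for $u=0<\breve\theta$ the value is the one given first).
   Context: $\mathcal{G}(n,c_n/n)$ is the random graph on $n$ vertices in which every two vertices are independently connected by an edge with probability $c_n/n$ ($c_n/n\in[0,1]$ for all large $n$). $(U^n_1,U^n_2,\ldots)$ is the sequence of the sizes (numbers of vertices) of the connected components arranged in descending order and appended with zeros to make it infinite; $\beta^n=U^n_1$ is the size of the largest connected component. $\breve{\mathbb{S}}$ is the subspace of $\mathbb{R}_+^{\mathbb{N}}$ (product topology) of non-increasing sequences, with induced topology. $a\vee b=\max(a,b)$, $a\wedge b=\min(a,b)$, $a^+=\max(a,0)$, $\lfloor\cdot\rfloor$ is the integer part. LDP: a sequence of random elements $X_n$ of a metric space $\Upsilon$ obeys the large deviation principle (LDP) for scale $k_n$, $k_n\to\infty$, with action functional $I:\Upsilon\to[0,\infty]$ if the sets $\{\upsilon:I(\upsilon)\le a\}$ are compact for all $a\in\mathbb{R}_+$, $\limsup_n\frac1{k_n}\log\mathbf{P}(X_n\in F)\le-\inf_{F}I$ for all closed $F\subset\Upsilon$, and $\liminf_n\frac1{k_n}\log\mathbf{P}(X_n\in G)\ge-\inf_{G}I$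 for all open $G\subset\Upsilon$. *)

theory Defs
  imports "HOL-Analysis.Analysis" "HOL-Probability.Probability"
begin

text \<open>
  A graph on the vertex set \<open>{..<n}\<close> is represented by its set of edges, each edge being a
  two-element set of vertices.  In the random graph the edges are independent with probability
  \<open>p\<close> each; \<^const>\<open>bernoulli_pmf\<close> replaces \<open>p\<close> by the nearest point of \<open>[0,1]\<close>, which matters
  only when \<open>p\<close> is not a probability.
\<close>

definition all_edges :: "nat \<Rightarrow> nat set set" where
  "all_edges n = {e. e \<subseteq> {..<n} \<and> card e = 2}"

definition random_graph :: "nat \<Rightarrow> real \<Rightarrow> nat set set pmf" where
  "random_graph n p =
     map_pmf (\<lambda>\<omega>. {e \<in> all_edges n. \<omega> e}) (Pi_pmf (all_edges n) False (\<lambda>_. bernoulli_pmf p))"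

definition connected_components :: "nat \<Rightarrow> nat set set \<Rightarrow> nat set set" where
  "connected_components n E = {..<n} // {(x, y). x < n \<and> y < n \<and> {x, y} \<in> E}\<^sup>*"

definition component_sizes :: "nat \<Rightarrow> nat set set \<Rightarrow> nat list" where
  "component_sizes n E =
     rev (sorted_list_of_multiset (image_mset card (mset_set (connected_components n E))))"

text \<open>Component sizes in descending order, indexed from \<open>0\<close>: \<open>component_size n E 0\<close> is the
  size of the largest component.\<close>

definition component_size :: "nat \<Rightarrow> nat set set \<Rightarrow> nat \<Rightarrow> nat" where
  "component_size n E i =
     (if i < length (component_sizes n E) then component_sizes n E ! i else 0)"

text \<open>Logarithm of a probability with \<open>log 0 = -\<infinity>\<close> (the library's real \<^const>\<open>ln\<close> has
  \<open>ln 0 = 0\<close>).\<close>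

definition log_prob :: "real \<Rightarrow> ereal" where
  "log_prob p = (if p = 0 then -\<infinity> else ereal (ln p))"

text \<open>
  Large deviation principle in the metric space \<open>S\<close>, a subset of the ambient type with the
  induced topology, for random elements \<open>X n\<close> of \<open>S\<close> defined on probability spaces \<open>M n\<close>,
  with scale \<open>k\<close> and action functional \<open>I\<close>, of which only the values on \<open>S\<close> matter.
\<close>

definition obeys_LDP ::
  "'a::metric_space set \<Rightarrow> (nat \<Rightarrow> 'b measure) \<Rightarrow> (nat \<Rightarrow> 'b \<Rightarrow> 'a) \<Rightarrow> (nat \<Rightarrow> real)
     \<Rightarrow> ('a \<Rightarrow> ereal) \<Rightarrow> bool" where
  "obeys_LDP S M X k I \<longleftrightarrow>
     (\<forall>n. prob_space (M n) \<and> X n \<in> M n \<rightarrow>\<^sub>M restrict_space borel S) \<and>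
     filterlim k at_top sequentially \<and>
     (\<forall>x\<in>S. 0 \<le> I x) \<and>
     (\<forall>a::real. a \<ge> 0 \<longrightarrow> compact {x \<in> S. I x \<le> ereal a}) \<and>
     (\<forall>F. closedin (top_of_set S) F \<longrightarrow>
        limsup (\<lambda>n. ereal (1 / k n) * log_prob (measure (M n) {\<omega> \<in> space (M n). X n \<omega> \<in> F}))
          \<le> - (INF x\<in>F. I x)) \<and>
     (\<forall>G. openin (top_of_set S) G \<longrightarrow>
        liminf (\<lambda>n. ereal (1 / k n) * log_prob (measure (M n) {\<omega> \<in> space (M n). X n \<omega> \<in> G}))
          \<ge> - (INF x\<in>G. I x))"

text \<open>The metric on \<^typ>\<open>nat \<Rightarrow> real\<close> is the library's, which induces the product topology.\<close>

definition nonincreasing_seqs :: "(nat \<Rightarrow> real) set" where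
  "nonincreasing_seqs = {u. decseq u \<and> (\<forall>i. 0 \<le> u i)}"

definition I_U :: "real \<Rightarrow> (nat \<Rightarrow> real) \<Rightarrow> ereal" where
  "I_U \<theta> u =
     (if summable u
      then ereal (- (1/24) * (\<Sum>i. u i ^ 3) + (1/6) * max (((\<Sum>i. u i) - \<theta>) ^ 3) 0 + \<theta> ^ 3 / 6)
      else \<infinity>)"

definition I_beta :: "real \<Rightarrow> real \<Rightarrow> ereal" where
  "I_beta \<theta> u =
     (if u = 0 then ereal (max (\<theta> ^ 3) 0 / 6)
      else if 0 < u \<and> u < max \<theta> 0 then
        (let m = real_of_int \<lfloor>\<theta> / u\<rfloor>; v = min (2 * (\<theta> - m * u)) u
         in ereal (- m * (u ^ 3 / 24) - (1/24) * v ^ 3 + (1/6) * (m * u + v - \<theta>) ^ 3 + \<theta> ^ 3 / 6))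
      else ereal (- (u ^ 3 / 24) + (u - \<theta>) ^ 3 / 6 + \<theta> ^ 3 / 6))"

end

theory Submission
  imports Defs
begin

text \<open>
  Write \<open>\<epsilon> = b\<^sub>n\<^sup>2\<^sup>/\<^sup>3 / n\<^sup>1\<^sup>/\<^sup>3\<close>, so that sizes are measured in units of \<open>n \<epsilon>\<close> and the scale is \<open>n \<epsilon>\<^sup>3\<close>.
  Conditionally on one component of size \<open>k\<close>, the rest is a random graph on \<open>n - k\<close> vertices;
  hence the probability of seeing components of sizes near \<open>u\<^sub>1, \<dots>, u\<^sub>m\<close> and only small ones besides
  is, up to constants, a product of expected numbers of components and of one probability that
  all components are small.

  The expected number of components of size \<open>k\<close> among \<open>N\<close> vertices is an explicit function of \<open>N\<close>
  times a factor depending only on \<open>k\<close>, so it can be transferred from one \<open>N\<close> to another.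
  For the \<open>N\<close> whose giant component has size \<open>k\<close> the sum over a window of sizes is of constant
  order: it is bounded because exploring a component survives with probability \<open>O(\<epsilon>)\<close>, and bounded
  below because every other scenario is unlikely.  The transfer then yields the rate
  \<open>u (u - 2 t)\<^sup>2 / 8\<close> at drift \<open>t\<close>, and a component of size \<open>u\<close> lowers the drift by \<open>u\<close>.
  The probability that all components are small decays at rate \<open>t\<^sup>3 / 6\<close> for \<open>t > 0\<close>: revealing the
  components one at a time, \<open>exp\<close> of the rate is a supermartingale.  The rates telescope to \<open>I_U\<close>,
  whose lower semicontinuity and non-negativity follow from the local bounds, and \<open>I_beta\<close> is the
  minimum of \<open>I_U\<close> over the sequences with a given first entry.
\<close>

section \<open>Exploration of the components of a set of vertices\<close>

text \<open>The obstacle is the probability that k given vertices are connected, in other words the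
  enumeration of connected graphs with few excess edges. No asymptotics of it are derived:
  \<open>conn\<close> cancels whenever two values of \<open>expected_comps\<close> with the same k
  are compared. A comparison by Taylor expansion needs k of order n \<epsilon>; larger components
  are excluded by a cruder comparison with a graph on slightly more vertices. The cubes arise by
  integration: at drift s, keeping all components small costs s^2 / 2 per unit of vertices revealed,
  and each unit lowers the drift by one, so the way from drift t down to 0 costs t^3 / 6. A second
  obstacle is the lower bound when the prescribed sizes leave a positive drift. Smallness of all
  other components is then itself a rare event, and no lower bound for its probability is at hand.
  Many further components of one small size are prescribed, enough to use up the drift. They stay
  within the given neighbourhood in the product topology, and what they cost is close to the t^3 / 6
  of the upper bound.\<close>

text \<open>\<open>conn p j k\<close> is the probability that the exploration started from \<open>j\<close> vertices reaches all of
  \<open>k\<close> further ones; \<open>bfs p j r F\<close> is the expectation of \<open>F\<close> at the number of vertices it reaches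
  among \<open>r\<close>.\<close>

function conn :: "real \<Rightarrow> nat \<Rightarrow> nat \<Rightarrow> real" where
  "conn p 0 k = of_bool (k = 0)"
| "conn p (Suc j) k =
    (\<Sum>i\<le>k. real (k choose i) * p ^ i * (1 - p) ^ (k - i) * conn p (j + i) (k - i))"
  by pat_completeness auto
termination by (relation "Wellfounded.measure (\<lambda>(p, j, k). j + k)") auto

definition bfs :: "real \<Rightarrow> nat \<Rightarrow> nat \<Rightarrow> (nat \<Rightarrow> real) \<Rightarrow> real" where
  "bfs p j r F =
    (\<Sum>k\<le>r. real (r choose k) * conn p j k * (1 - p) ^ ((j + k) * (r - k)) * F k)"

lemma conn_nonneg:
  assumes "0 \<le> p" "p \<le> 1"
  shows "0 \<le> conn p j k"
  using assms by (induction p j k rule: conn.induct) (auto intro!: sum_nonneg)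

lemma bfs_0: "bfs p 0 r F = F 0"
proof -
  have "bfs p 0 r F = (\<Sum>k\<le>r. if k = 0 then F 0 else 0)"
    unfolding bfs_def by (intro sum.cong) auto
  then show ?thesis by simp
qed

text \<open>Conditioning on the number i of vertices met by one active vertex. Choosing all k + i
  reached vertices and then the i neighbours among them amounts to choosing the neighbours
  first.\<close>

lemma bfs_Suc:
  "bfs p (Suc j) r F =
    (\<Sum>i\<le>r. real (r choose i) * p ^ i * (1 - p) ^ (r - i) * bfs p (j + i) (r - i) (\<lambda>k. F (k + i)))"
proof -
  define g where "g i k = real (r choose k) * (real (k choose i) * p ^ i * (1 - p) ^ (k - i)
      * conn p (j + i) (k - i)) * (1 - p) ^ ((Suc j + k) * (r - k)) * F k" for i k
  have eq: "real (r choose i) * p ^ i * (1 - p) ^ (r - i) * (real ((r - i) choose k)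
      * conn p (j + i) k * (1 - p) ^ ((j + i + k) * (r - i - k)) * F (k + i)) = g i (k + i)"
    if "i \<le> r" "k \<le> r - i" for i k
  proof -
    have 1: "(r choose (k + i)) * ((k + i) choose i) = (r choose i) * ((r - i) choose k)"
      using choose_mult[of i "k + i" r] that by simp
    \<comment> \<open>Two counts of the absent edges. On the left: from the processed vertex to the
      k reached later, and from all reached vertices to the unreached ones. On the right: from the
      processed vertex to all it does not meet, and from the other reached vertices to the unreached
      ones.\<close>
    have 2: "(k + i - i) + (Suc j + (k + i)) * (r - (k + i)) = (r - i) + (j + i + k) * (r - i - k)"
    proof -
      have "r = k + i + (r - k - i)" using that by simp
      then obtain s where "r = k + i + s" by blast
      then show ?thesis by (simp add: algebra_simps)
    qed
    have "g i (k + i) = real ((r choose (k + i)) * ((k + i) choose i)) * p ^ i * conn p (j + i) k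
        * F (k + i) * ((1 - p) ^ (k + i - i) * (1 - p) ^ ((Suc j + (k + i)) * (r - (k + i))))"
      by (simp add: g_def)
    also have "\<dots> = real ((r choose i) * ((r - i) choose k)) * p ^ i * conn p (j + i) k
        * F (k + i) * ((1 - p) ^ (r - i) * (1 - p) ^ ((j + i + k) * (r - i - k)))"
      by (simp only: 1 power_add [symmetric]) (simp only: 2)
    finally show ?thesis by simp
  qed
  have "(\<Sum>i\<le>r. real (r choose i) * p ^ i * (1 - p) ^ (r - i) * bfs p (j + i) (r - i) (\<lambda>k. F (k + i)))
      = (\<Sum>i\<le>r. \<Sum>k\<le>r - i. g i (k + i))"
    unfolding bfs_def sum_distrib_left by (intro sum.cong refl eq) auto
  also have "\<dots> = (\<Sum>(i, k)\<in>Sigma {..r} (\<lambda>i. {..r - i}). g i (k + i))"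
    by (simp add: sum.Sigma)
  also have "\<dots> = (\<Sum>(k, i)\<in>Sigma {..r} (\<lambda>k. {..k}). g i k)"
    by (rule sum.reindex_bij_witness[of _ "\<lambda>(k, i). (i, k - i)" "\<lambda>(i, k). (k + i, i)"]) auto
  also have "\<dots> = (\<Sum>k\<le>r. \<Sum>i\<le>k. g i k)"
    by (simp add: sum.Sigma)
  also have "\<dots> = bfs p (Suc j) r F"
    by (simp add: bfs_def g_def sum_distrib_left sum_distrib_right mult_ac)
  finally show ?thesis by simp
qed

lemma bfs_cmult: "bfs p j r (\<lambda>k. a * F k) = a * bfs p j r F"
  by (simp add: bfs_def sum_distrib_left mult_ac)

lemma binomial_generating_function:
  "(\<Sum>i\<le>r. real (r choose i) * p ^ i * (1 - p) ^ (r - i) * y ^ i) = (1 - p * (1 - y)) ^ r"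
  using binomial_ring[of "p * y" "1 - p" r] by (simp add: algebra_simps power_mult_distrib)

text \<open>The recursion reduces it to the binomial theorem. This normalisation is what later
  identifies \<open>conn\<close> with a connection probability, with no analysis of searches in
  graphs.\<close>

lemma bfs_total: "bfs p j r (\<lambda>_. 1) = 1"
proof (induction "j + r" arbitrary: j r rule: less_induct)
  case less
  show ?case
  proof (cases j)
    case (Suc j')
    have "bfs p j r (\<lambda>_. 1) = (\<Sum>i\<le>r. real (r choose i) * p ^ i * (1 - p) ^ (r - i))"
      unfolding Suc bfs_Suc by (intro sum.cong refl) (use less Suc in auto)
    then show ?thesis using binomial_generating_function[of r p 1] by simp
  qed (simp add: bfs_0)
qed

text \<open>Processing one active vertex replaces a factor y by a * (1 - p * (1 - y)) ^ r, which is
  at most y while at least R vertices are unreached. So a ^ processed * y ^ active is a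
  supermartingale until more than K vertices are reached. The hypothesis R + K \<le> r + j survives
  a step because K and r + j both drop by one.\<close>

lemma bfs_exponential_bound:
  assumes p: "0 \<le> p" "p \<le> 1" and y: "0 \<le> y" "y \<le> 1" and a: "0 \<le> a" "a * (1 - p * (1 - y)) ^ R \<le> y"
    and "R + K \<le> r + j"
  shows "bfs p j r (\<lambda>k. of_bool (j + k \<le> K) * a ^ (j + k)) \<le> y ^ j"
  using \<open>R + K \<le> r + j\<close>
proof (induction "j + r" arbitrary: j r K rule: less_induct)
  case less
  show ?case
  proof (cases j)
    case 0
    then show ?thesis by (simp add: bfs_0)
  next
    case (Suc j')
    show ?thesis
    proof (cases "j \<le> K")
      case False
      then have "bfs p j r (\<lambda>k. of_bool (j + k \<le> K) * a ^ (j + k)) = 0"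
        by (auto simp: bfs_def)
      then show ?thesis using y by simp
    next
      case True
      then obtain K' where K': "K = Suc K'" using Suc by (cases K) auto
      have s: "0 \<le> 1 - p * (1 - y)" "1 - p * (1 - y) \<le> 1"
        using p y mult_le_one[of p "1 - y"] by auto
      have "bfs p j r (\<lambda>k. of_bool (j + k \<le> K) * a ^ (j + k))
          = (\<Sum>i\<le>r. real (r choose i) * p ^ i * (1 - p) ^ (r - i) *
              (a * bfs p (j' + i) (r - i) (\<lambda>k. of_bool (j' + i + k \<le> K') * a ^ (j' + i + k))))"
        unfolding Suc bfs_Suc bfs_cmult[symmetric] K' by (simp add: ac_simps)
      also have "\<dots> \<le> (\<Sum>i\<le>r. real (r choose i) * p ^ i * (1 - p) ^ (r - i) * (a * y ^ (j' + i)))"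
        by (intro sum_mono mult_left_mono less.hyps) (use less.prems p a Suc K' in auto)
      also have "\<dots> = a * y ^ j' * (\<Sum>i\<le>r. real (r choose i) * p ^ i * (1 - p) ^ (r - i) * y ^ i)"
        by (simp add: sum_distrib_left power_add mult_ac)
      also have "\<dots> = a * y ^ j' * (1 - p * (1 - y)) ^ r"
        by (simp add: binomial_generating_function)
      also have "\<dots> \<le> a * y ^ j' * (1 - p * (1 - y)) ^ R"
        by (intro mult_left_mono power_decreasing) (use less.prems True s a y in auto)
      also have "\<dots> = y ^ j' * (a * (1 - p * (1 - y)) ^ R)" by simp
      also have "\<dots> \<le> y ^ j' * y" using a y by (intro mult_left_mono) auto
      finally show ?thesis by (simp add: Suc mult.commute[of y])
    qed
  qed
qed

text \<open>The quantity \<open>1 - z ^ j * \<rho> ^ t\<close> dominates the expectation of its value after one exploration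
  step, so it bounds the probability that the exploration is alive at time \<open>T\<close>.\<close>

lemma bfs_survival_bound:
  assumes p: "0 \<le> p" "p \<le> 1" and z: "0 \<le> z" "z \<le> 1" and \<rho>: "0 \<le> \<rho>" "\<rho> \<le> 1"
    and z': "z \<le> \<rho> * (1 - p * (1 - z)) ^ n" and "r \<le> n" "t \<le> T"
  shows "(1 - \<rho> ^ T) * bfs p j r (\<lambda>k. of_bool (T \<le> t + j + k)) \<le> 1 - z ^ j * \<rho> ^ t"
  using \<open>r \<le> n\<close> \<open>t \<le> T\<close>
proof (induction "j + r" arbitrary: j r t rule: less_induct)
  case less
  show ?case
  proof (cases "t = T")
    case True
    have "z ^ j * \<rho> ^ T \<le> 1 * \<rho> ^ T" using z \<rho> by (intro mult_right_mono power_le_one) auto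
    with True show ?thesis by (simp add: bfs_total)
  next
    case False
    with less.prems have tT: "Suc t \<le> T" by simp
    show ?thesis
    proof (cases j)
      case 0
      with tT \<rho> show ?thesis by (simp add: bfs_0 power_le_one)
    next
      case (Suc j')
      have s: "0 \<le> 1 - p * (1 - z)" "1 - p * (1 - z) \<le> 1"
        using p z mult_le_one[of p "1 - z"] by auto
      have "(1 - \<rho> ^ T) * bfs p j r (\<lambda>k. of_bool (T \<le> t + j + k))
          = (\<Sum>i\<le>r. real (r choose i) * p ^ i * (1 - p) ^ (r - i) *
              ((1 - \<rho> ^ T) * bfs p (j' + i) (r - i) (\<lambda>k. of_bool (T \<le> Suc t + (j' + i) + k))))"
        unfolding Suc bfs_Suc sum_distrib_left by (simp add: ac_simps)
      also have "\<dots> \<le> (\<Sum>i\<le>r. real (r choose i) * p ^ i * (1 - p) ^ (r - i) *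
              (1 - z ^ (j' + i) * \<rho> ^ Suc t))"
        by (intro sum_mono mult_left_mono less.hyps) (use less.prems p tT Suc in auto)
      also have "\<dots> = (\<Sum>i\<le>r. real (r choose i) * p ^ i * (1 - p) ^ (r - i) * 1 ^ i)
          - z ^ j' * \<rho> ^ Suc t * (\<Sum>i\<le>r. real (r choose i) * p ^ i * (1 - p) ^ (r - i) * z ^ i)"
        by (simp add: sum_distrib_left power_add sum_subtractf algebra_simps)
      also have "\<dots> = 1 - z ^ j' * \<rho> ^ t * (\<rho> * (1 - p * (1 - z)) ^ r)"
        by (simp only: binomial_generating_function) simp
      also have "\<dots> \<le> 1 - z ^ j' * \<rho> ^ t * z"
      proof -
        have "\<rho> * (1 - p * (1 - z)) ^ n \<le> \<rho> * (1 - p * (1 - z)) ^ r"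
          by (intro mult_left_mono power_decreasing) (use less.prems s \<rho> in auto)
        with z' have "z \<le> \<rho> * (1 - p * (1 - z)) ^ r" by simp
        then have "z ^ j' * \<rho> ^ t * z \<le> z ^ j' * \<rho> ^ t * (\<rho> * (1 - p * (1 - z)) ^ r)"
          using z \<rho> by (intro mult_left_mono) auto
        then show ?thesis by simp
      qed
      finally show ?thesis by (simp add: Suc mult_ac)
    qed
  qed
qed

declare conn.simps [simp del]

section \<open>The law of the component sizes\<close>

definition edges :: "nat set \<Rightarrow> nat set set" where
  "edges V = {e. e \<subseteq> V \<and> card e = 2}"

definition adj :: "nat set \<Rightarrow> nat set set \<Rightarrow> (nat \<times> nat) set" where
  "adj V E = {(x, y). x \<in> V \<and> y \<in> V \<and> {x, y} \<in> E}"

definition comps :: "nat set \<Rightarrow> nat set set \<Rightarrow> nat set set" where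
  "comps V E = V // (adj V E)\<^sup>*"

definition sizes :: "nat set set \<Rightarrow> nat multiset" where
  "sizes C = image_mset card (mset_set C)"

definition weight :: "real \<Rightarrow> nat set \<Rightarrow> nat set set \<Rightarrow> real" where
  "weight p V E = p ^ card E * (1 - p) ^ (card (edges V) - card E)"

text \<open>A finite sum over the edge sets on an arbitrary finite set of vertices: after a
  component is removed, the rest is an object of the same kind. As a polynomial in p it makes sense
  for every real p.\<close>

definition comps_expectation :: "real \<Rightarrow> nat set \<Rightarrow> (nat set set \<Rightarrow> real) \<Rightarrow> real" where
  "comps_expectation p V f = (\<Sum>E\<in>Pow (edges V). weight p V E * f (comps V E))"

abbreviation conn_prob :: "real \<Rightarrow> nat set \<Rightarrow> real" where
  "conn_prob p A \<equiv> comps_expectation p A (\<lambda>C. of_bool (C = {A}))"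

section \<open>Components as classes of the reachability relation\<close>

lemma finite_edges [simp]: "finite V \<Longrightarrow> finite (edges V)"
  by (rule finite_subset[of _ "Pow V"]) (auto simp: edges_def)

lemma edges_empty: "edges {} = {}"
  by (auto simp: edges_def)

lemma card_edges: "finite V \<Longrightarrow> card (edges V) = card V choose 2"
  unfolding edges_def by (rule n_subsets)

lemma adj_rtrancl_in:
  assumes "(x, y) \<in> (adj V E)\<^sup>*" "x \<in> V"
  shows "y \<in> V"
  using assms by (induction rule: rtrancl_induct) (auto simp: adj_def)

lemma adj_rtrancl_sym: "(x, y) \<in> (adj V E)\<^sup>* \<Longrightarrow> (y, x) \<in> (adj V E)\<^sup>*"
proof -
  have "sym (adj V E)" by (auto simp: sym_def adj_def insert_commute)
  then show "(x, y) \<in> (adj V E)\<^sup>* \<Longrightarrow> (y, x) \<in> (adj V E)\<^sup>*"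
    using sym_rtrancl symD by metis
qed

lemma comps_member: "A \<in> comps V E \<longleftrightarrow> (\<exists>x\<in>V. A = (adj V E)\<^sup>* `` {x})"
  by (auto simp: comps_def quotient_def)

lemma comps_subset: "A \<in> comps V E \<Longrightarrow> A \<subseteq> V"
  by (auto simp: comps_member adj_rtrancl_in)

lemma comps_nonempty: "A \<in> comps V E \<Longrightarrow> A \<noteq> {}"
  by (auto simp: comps_member)

lemma comps_eq_class:
  assumes "A \<in> comps V E" "x \<in> A"
  shows "A = (adj V E)\<^sup>* `` {x}"
proof -
  obtain a where a: "a \<in> V" "A = (adj V E)\<^sup>* `` {a}" using assms by (auto simp: comps_member)
  with assms have "(a, x) \<in> (adj V E)\<^sup>*" by auto
  then show ?thesis unfolding a(2)
    by (auto intro: rtrancl_trans adj_rtrancl_sym)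
qed

lemma comps_disjoint: "\<lbrakk>A \<in> comps V E; B \<in> comps V E; x \<in> A; x \<in> B\<rbrakk> \<Longrightarrow> A = B"
  using comps_eq_class by metis

lemma comps_cover: "x \<in> V \<Longrightarrow> \<exists>A\<in>comps V E. x \<in> A"
  by (rule bexI[of _ "(adj V E)\<^sup>* `` {x}"]) (auto simp: comps_member)

lemma finite_comps [simp]: "finite V \<Longrightarrow> finite (comps V E)"
  by (rule finite_subset[of _ "Pow V"]) (auto dest: comps_subset)

lemma self_in_comps_iff: "A \<in> comps A E \<longleftrightarrow> comps A E = {A}"
proof
  assume A: "A \<in> comps A E"
  have "B = A" if B: "B \<in> comps A E" for B
  proof -
    obtain x where "x \<in> B" using comps_nonempty[OF B] by blast
    then show ?thesis using comps_subset[OF B] comps_disjoint[OF B A] by auto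
  qed
  with A show "comps A E = {A}" by auto
qed auto

lemma comps_no_cross_edge:
  assumes "A \<in> comps V E" "e \<in> E" "e \<in> edges V"
  shows "e \<in> edges A \<or> e \<in> edges (V - A)"
proof -
  obtain x y where e: "e = {x, y}" "x \<in> V" "y \<in> V"
    using assms(3) by (auto simp: edges_def card_2_iff)
  have xy: "(x, y) \<in> adj V E" "(y, x) \<in> adj V E"
    using e assms(2) by (auto simp: adj_def insert_commute)
  have "x \<in> A \<longleftrightarrow> y \<in> A"
    using comps_eq_class[OF assms(1)] xy by (metis Image_singleton_iff r_into_rtrancl)
  with e assms(3) show ?thesis by (auto simp: edges_def)
qed

lemma rtrancl_Un_disjoint_Image:
  assumes "R \<subseteq> A \<times> A" "S \<subseteq> B \<times> B" "A \<inter> B = {}" "x \<in> A"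
  shows "(R \<union> S)\<^sup>* `` {x} = R\<^sup>* `` {x}"
proof -
  have "(x, y) \<in> R\<^sup>* \<and> y \<in> A" if "(x, y) \<in> (R \<union> S)\<^sup>*" for y
    using that
  proof (induction rule: rtrancl_induct)
    case (step y z)
    with assms have "(y, z) \<in> R" by auto
    with step assms show ?case by (auto intro: rtrancl_into_rtrancl)
  qed (use assms in auto)
  moreover have "R\<^sup>* \<subseteq> (R \<union> S)\<^sup>*" by (simp add: rtrancl_mono)
  ultimately show ?thesis by auto
qed

lemma comps_Un:
  assumes "E1 \<subseteq> edges A" "E2 \<subseteq> edges B" "A \<inter> B = {}"
  shows "comps (A \<union> B) (E1 \<union> E2) = comps A E1 \<union> comps B E2"
proof -
  have eq: "adj (A \<union> B) (E1 \<union> E2) = adj A E1 \<union> adj B E2"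
    using assms by (auto simp: adj_def edges_def)
  have 1: "(adj A E1 \<union> adj B E2)\<^sup>* `` {x} = (adj A E1)\<^sup>* `` {x}" if "x \<in> A" for x
    by (rule rtrancl_Un_disjoint_Image[OF _ _ assms(3) that]) (auto simp: adj_def)
  have 2: "(adj A E1 \<union> adj B E2)\<^sup>* `` {x} = (adj B E2)\<^sup>* `` {x}" if "x \<in> B" for x
  proof -
    have "(adj B E2 \<union> adj A E1)\<^sup>* `` {x} = (adj B E2)\<^sup>* `` {x}"
      by (rule rtrancl_Un_disjoint_Image[OF _ _ _ that]) (use assms in \<open>auto simp: adj_def\<close>)
    then show ?thesis by (simp add: Un_commute)
  qed
  show ?thesis
    by (rule set_eqI) (auto simp: comps_member eq 1 2 bex_Un)
qed

section \<open>Splitting off one component\<close>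

lemma choose_two_add: "(a + b) choose 2 = (a choose 2) + (b choose 2) + a * b"
  by (induction a) (auto simp: numeral_2_eq_2)

text \<open>The card A * card B possible edges between A and B are all absent, which gives the extra
  factor.\<close>

lemma weight_Un:
  assumes "finite A" "finite B" "A \<inter> B = {}" "E1 \<subseteq> edges A" "E2 \<subseteq> edges B"
  shows "weight p (A \<union> B) (E1 \<union> E2) = weight p A E1 * weight p B E2 * (1 - p) ^ (card A * card B)"
proof -
  have "edges A \<inter> edges B = {}" using assms(3)
    by (auto simp: edges_def card_2_iff)
  then have c: "card (E1 \<union> E2) = card E1 + card E2"
    using assms by (intro card_Un_disjoint) (auto intro: finite_subset[OF _ finite_edges])
  have le: "card E1 \<le> card (edges A)" "card E2 \<le> card (edges B)"
    using assms by (auto intro!: card_mono)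
  have "card (edges (A \<union> B)) = card (edges A) + card (edges B) + card A * card B"
    using assms by (simp add: card_edges card_Un_disjoint choose_two_add)
  with le c have "card (edges (A \<union> B)) - card (E1 \<union> E2)
      = (card (edges A) - card E1) + (card (edges B) - card E2) + card A * card B"
    by simp
  with c show ?thesis by (simp add: weight_def power_add)
qed

text \<open>A is a component exactly if the edges inside it connect it and no edge leaves it; the
  edges inside V - A are then unrestricted. Hence E corresponds bijectively to its parts inside A
  and inside V - A, and the weight factorises.\<close>

lemma comps_expectation_split:
  assumes V: "finite V" and A: "A \<subseteq> V" "A \<noteq> {}"
  shows "(\<Sum>E\<in>Pow (edges V). weight p V E * (if A \<in> comps V E then f (comps V E - {A}) else 0))
    = conn_prob p A * (1 - p) ^ (card A * card (V - A)) * comps_expectation p (V - A) f"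
proof -
  define B where "B = V - A"
  have VAB: "V = A \<union> B" "A \<inter> B = {}" and fin: "finite A" "finite B"
    using A V by (auto simp: B_def intro: finite_subset)
  have comps_eq: "comps V (E1 \<union> E2) = comps A E1 \<union> comps B E2"
    if "E1 \<subseteq> edges A" "E2 \<subseteq> edges B" for E1 E2
    unfolding VAB(1) by (rule comps_Un) (use that VAB in auto)
  have notin: "A \<notin> comps B E" for E
    using comps_subset[of A B E] A VAB by auto
  have disj: "edges A \<inter> edges B = {}" using VAB by (auto simp: edges_def card_2_iff)
  have "(\<Sum>E\<in>Pow (edges V). weight p V E * (if A \<in> comps V E then f (comps V E - {A}) else 0))
      = (\<Sum>E\<in>{E \<in> Pow (edges V). A \<in> comps V E}. weight p V E * f (comps V E - {A}))"
    using V by (intro sum.mono_neutral_cong_right) auto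
  also have "\<dots> = (\<Sum>(E1, E2)\<in>{E1 \<in> Pow (edges A). comps A E1 = {A}} \<times> Pow (edges B).
        (1 - p) ^ (card A * card B) * (weight p A E1 * (weight p B E2 * f (comps B E2))))"
  proof (rule sum.reindex_bij_witness[of _ "\<lambda>(E1, E2). E1 \<union> E2" "\<lambda>E. (E \<inter> edges A, E \<inter> edges B)"])
    fix E assume E: "E \<in> {E \<in> Pow (edges V). A \<in> comps V E}"
    have un: "E = (E \<inter> edges A) \<union> (E \<inter> edges B)"
      using comps_no_cross_edge[of A V E] E by (auto simp: B_def)
    then show "(case (E \<inter> edges A, E \<inter> edges B) of (E1, E2) \<Rightarrow> E1 \<union> E2) = E" by simp
    have "comps V E = comps A (E \<inter> edges A) \<union> comps B (E \<inter> edges B)"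
      by (subst un, rule comps_eq) auto
    with E notin have Ain: "A \<in> comps A (E \<inter> edges A)" by auto
    then have cA: "comps A (E \<inter> edges A) = {A}" by (simp add: self_in_comps_iff)
    then show "(E \<inter> edges A, E \<inter> edges B) \<in> {E1 \<in> Pow (edges A). comps A E1 = {A}} \<times> Pow (edges B)"
      by auto
    have "weight p V E = weight p A (E \<inter> edges A) * weight p B (E \<inter> edges B) * (1 - p) ^ (card A * card B)"
      by (subst un, unfold VAB(1), rule weight_Un) (use fin VAB in auto)
    moreover have "comps V E - {A} = comps B (E \<inter> edges B)"
      by (subst un, subst comps_eq) (use cA notin in auto)
    ultimately show "(case (E \<inter> edges A, E \<inter> edges B) of (E1, E2) \<Rightarrow>
        (1 - p) ^ (card A * card B) * (weight p A E1 * (weight p B E2 * f (comps B E2))))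
      = weight p V E * f (comps V E - {A})" by simp
  next
    fix z assume z: "z \<in> {E1 \<in> Pow (edges A). comps A E1 = {A}} \<times> Pow (edges B)"
    then show "(case z of (E1, E2) \<Rightarrow> E1 \<union> E2) \<in> {E \<in> Pow (edges V). A \<in> comps V E}"
      using VAB comps_eq by (auto simp: edges_def)
    show "((case z of (E1, E2) \<Rightarrow> E1 \<union> E2) \<inter> edges A, (case z of (E1, E2) \<Rightarrow> E1 \<union> E2) \<inter> edges B) = z"
      using z disj by auto
  qed
  also have "\<dots> = (1 - p) ^ (card A * card B) *
      (\<Sum>E1\<in>{E1 \<in> Pow (edges A). comps A E1 = {A}}. weight p A E1) * comps_expectation p B f"
    by (simp add: sum.cartesian_product[symmetric] comps_expectation_def sum_product sum_distrib_left mult_ac)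
  also have "(\<Sum>E1\<in>{E1 \<in> Pow (edges A). comps A E1 = {A}}. weight p A E1) = conn_prob p A"
    unfolding comps_expectation_def using fin by (intro sum.mono_neutral_cong_left) auto
  finally show ?thesis by (simp add: B_def mult_ac)
qed

lemma comps_expectation_sum_comps:
  assumes V: "finite V" and S: "S \<subseteq> Pow V - {{}}"
  shows "comps_expectation p V (\<lambda>C. \<Sum>A\<in>C \<inter> S. f A (C - {A}))
    = (\<Sum>A\<in>S. conn_prob p A * (1 - p) ^ (card A * card (V - A)) * comps_expectation p (V - A) (f A))"
proof -
  have finS: "finite S" using V S by (metis finite_Diff finite_Pow_iff finite_subset)
  have "comps_expectation p V (\<lambda>C. \<Sum>A\<in>C \<inter> S. f A (C - {A}))
    = (\<Sum>E\<in>Pow (edges V). \<Sum>A\<in>S. weight p V E * (if A \<in> comps V E then f A (comps V E - {A}) else 0))"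
    unfolding comps_expectation_def sum_distrib_left[symmetric]
    by (intro sum.cong refl arg_cong2[where f = "(*)"] sum.mono_neutral_cong_left finS) auto
  also have "\<dots> = (\<Sum>A\<in>S. \<Sum>E\<in>Pow (edges V). weight p V E * (if A \<in> comps V E then f A (comps V E - {A}) else 0))"
    by (rule sum.swap)
  also have "\<dots> = (\<Sum>A\<in>S. conn_prob p A * (1 - p) ^ (card A * card (V - A)) * comps_expectation p (V - A) (f A))"
    using S by (intro sum.cong refl comps_expectation_split V) auto
  finally show ?thesis .
qed

lemma comps_expectation_cong:
  "(\<And>E. f (comps V E) = g (comps V E)) \<Longrightarrow> comps_expectation p V f = comps_expectation p V g"
  by (simp add: comps_expectation_def)

text \<open>Exactly one component contains v, so any function of the sizes is a sum over the
  components containing v, with a single term; the splitting formula applies to such a sum.\<close>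

lemma comps_expectation_vertex:
  assumes V: "finite V" "v \<in> V"
  shows "comps_expectation p V (\<lambda>C. g (sizes C))
    = (\<Sum>A\<in>{A. A \<subseteq> V \<and> v \<in> A}. conn_prob p A * (1 - p) ^ (card A * card (V - A))
        * comps_expectation p (V - A) (\<lambda>C. g (add_mset (card A) (sizes C))))"
proof -
  let ?S = "{A. A \<subseteq> V \<and> v \<in> A}"
  have "comps_expectation p V (\<lambda>C. g (sizes C))
      = comps_expectation p V (\<lambda>C. \<Sum>A\<in>C \<inter> ?S. g (add_mset (card A) (sizes (C - {A}))))"
  proof (rule comps_expectation_cong)
    fix E
    obtain A where A: "A \<in> comps V E" "v \<in> A" using comps_cover V by blast
    then have "comps V E \<inter> ?S = {A}" by (auto dest: comps_disjoint comps_subset)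
    moreover have "sizes (comps V E) = add_mset (card A) (sizes (comps V E - {A}))"
      using A V unfolding sizes_def by (subst mset_set.remove[of _ A]) auto
    ultimately show "g (sizes (comps V E))
        = (\<Sum>A\<in>comps V E \<inter> ?S. g (add_mset (card A) (sizes (comps V E - {A}))))" by simp
  qed
  also have "\<dots> = (\<Sum>A\<in>?S. conn_prob p A * (1 - p) ^ (card A * card (V - A))
        * comps_expectation p (V - A) (\<lambda>C. g (add_mset (card A) (sizes C))))"
    by (rule comps_expectation_sum_comps[OF V(1)]) auto
  finally show ?thesis .
qed

lemma comps_expectation_total:
  assumes "finite V"
  shows "comps_expectation p V (\<lambda>_. 1) = 1"
proof -
  have "comps_expectation p V (\<lambda>_. 1) = (\<Sum>E\<in>Pow (edges V). (\<Prod>e\<in>E. p) * (\<Prod>e\<in>edges V - E. 1 - p))"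
    unfolding comps_expectation_def weight_def using assms
    by (intro sum.cong refl) (auto simp: card_Diff_subset finite_subset[OF _ finite_edges])
  also have "\<dots> = (\<Prod>e\<in>edges V. p + (1 - p))"
    using assms by (simp only: prod_add finite_edges)
  finally show ?thesis by simp
qed

lemma sum_subsets_card:
  assumes "finite V"
  shows "(\<Sum>A\<in>Pow V. h (card A)) = (\<Sum>k\<le>card V. real (card V choose k) * h k)"
proof -
  have "(\<Sum>A\<in>Pow V. h (card A)) = (\<Sum>k\<le>card V. \<Sum>A\<in>{A \<in> Pow V. card A = k}. h (card A))"
    using assms by (intro sum.group[symmetric]) (auto intro: card_mono)
  also have "\<dots> = (\<Sum>k\<le>card V. real (card V choose k) * h k)"
    using n_subsets[OF assms] by (intro sum.cong refl) auto
  finally show ?thesis .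
qed

lemma sum_subsets_containing_card:
  assumes "finite V" "v \<in> V"
  shows "(\<Sum>A\<in>{A. A \<subseteq> V \<and> v \<in> A}. h (card A))
    = (\<Sum>k\<le>card V - 1. real ((card V - 1) choose k) * h (Suc k))"
proof -
  have "(\<Sum>A\<in>{A. A \<subseteq> V \<and> v \<in> A}. h (card A)) = (\<Sum>A\<in>Pow (V - {v}). h (Suc (card A)))"
    by (rule sum.reindex_bij_witness[of _ "insert v" "\<lambda>A. A - {v}"])
       (use assms in \<open>auto simp: card.remove[symmetric] simp del: card_Diff_insert intro!: arg_cong[where f = h]
          dest: finite_subset\<close>)
  then show ?thesis using assms by (simp add: sum_subsets_card[where h = "\<lambda>k. h (Suc k)"])
qed

text \<open>The component of a vertex v of A is some B containing v, and these probabilities sum to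
  1. This identity determines the term B = A from the smaller sets. By \<open>bfs_total\<close> the
  values of \<open>conn\<close> satisfy the same identity, so the two agree by induction.\<close>

lemma conn_prob_eq:
  assumes "finite A" "A \<noteq> {}"
  shows "conn_prob p A = conn p 1 (card A - 1)"
  using assms
proof (induction "card A" arbitrary: A rule: less_induct)
  case less
  obtain v where v: "v \<in> A" using less.prems by auto
  let ?S = "{B. B \<subseteq> A \<and> v \<in> B}"
  have finS: "finite ?S" using less.prems by simp
  define h where "h B = (1 - p) ^ (card B * card (A - B))" for B
  have "1 = (\<Sum>B\<in>?S. conn_prob p B * h B)"
    using comps_expectation_vertex[OF less.prems(1) v, of p "\<lambda>_. 1"] less.prems
    by (simp add: comps_expectation_total h_def)
  also have "\<dots> = conn_prob p A + (\<Sum>B\<in>?S - {A}. conn_prob p B * h B)"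
    using v finS by (subst sum.remove[of _ A]) (auto simp: h_def)
  also have "(\<Sum>B\<in>?S - {A}. conn_prob p B * h B) = (\<Sum>B\<in>?S - {A}. conn p 1 (card B - 1) * h B)"
    using less.prems by (intro sum.cong refl arg_cong2[where f = "(*)"] less.hyps)
      (auto intro!: psubset_card_mono intro: finite_subset)
  finally have 1: "1 = conn_prob p A + (\<Sum>B\<in>?S - {A}. conn p 1 (card B - 1) * h B)" .
  have "1 = bfs p 1 (card A - 1) (\<lambda>_. 1)" by (simp only: bfs_total)
  also have "\<dots> = (\<Sum>B\<in>?S. conn p 1 (card B - 1) * (1 - p) ^ (card B * (card A - card B)))"
    unfolding bfs_def using sum_subsets_containing_card[OF less.prems(1) v,
        of "\<lambda>k. conn p 1 (k - 1) * (1 - p) ^ (k * (card A - k))"] less.prems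
    by (simp add: mult_ac)
  also have "\<dots> = (\<Sum>B\<in>?S. conn p 1 (card B - 1) * h B)"
    using less.prems by (intro sum.cong refl) (auto simp: h_def card_Diff_subset finite_subset)
  also have "\<dots> = conn p 1 (card A - 1) + (\<Sum>B\<in>?S - {A}. conn p 1 (card B - 1) * h B)"
    using v finS by (subst sum.remove[of _ A]) (auto simp: h_def)
  finally show ?case using 1 by simp
qed

text \<open>Expectation over the multiset of component sizes; the recursion reveals the component of one
  vertex.\<close>

function size_law :: "real \<Rightarrow> nat \<Rightarrow> (nat multiset \<Rightarrow> real) \<Rightarrow> real" where
  "size_law p 0 f = f {#}"
| "size_law p (Suc n) f = (\<Sum>k\<le>n. real (n choose k) * conn p 1 k * (1 - p) ^ (Suc k * (n - k))
      * size_law p (n - k) (\<lambda>X. f (add_mset (Suc k) X)))"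
  by pat_completeness auto
termination by (relation "Wellfounded.measure (\<lambda>(p, n, f). n)") auto

text \<open>Because of the truncated subtraction in k - 1 the value at k = 0 is 1, which has no
  meaning as a number of components; sums over sizes therefore start at 1.\<close>

definition expected_comps :: "real \<Rightarrow> nat \<Rightarrow> nat \<Rightarrow> real" where
  "expected_comps p n k = real (n choose k) * conn p 1 (k - 1) * (1 - p) ^ (k * (n - k))"

lemma comps_expectation_sizes:
  assumes "finite V"
  shows "comps_expectation p V (\<lambda>C. f (sizes C)) = size_law p (card V) f"
  using assms
proof (induction "card V" arbitrary: V f rule: less_induct)
  case less
  show ?case
  proof (cases "V = {}")
    case True
    then show ?thesis
      by (simp add: comps_expectation_def weight_def edges_empty comps_def sizes_def)
  next
    case False
    then obtain v where v: "v \<in> V" by auto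
    obtain n where n: "card V = Suc n" using False less.prems by (cases "card V") auto
    define h where "h k = conn p 1 (k - 1) * (1 - p) ^ (k * (card V - k)) *
        size_law p (card V - k) (\<lambda>X. f (add_mset k X))" for k
    have "comps_expectation p V (\<lambda>C. f (sizes C)) = (\<Sum>A\<in>{A. A \<subseteq> V \<and> v \<in> A}. h (card A))"
      unfolding comps_expectation_vertex[OF less.prems v]
    proof (rule sum.cong[OF refl])
      fix A assume "A \<in> {A. A \<subseteq> V \<and> v \<in> A}"
      then have A: "A \<subseteq> V" "v \<in> A" "A \<noteq> {}" "finite A" using less.prems finite_subset by auto
      have card: "card (V - A) = card V - card A" using A by (simp add: card_Diff_subset)
      have "card (V - A) < card V" using A v less.prems by (intro psubset_card_mono) auto
      with less.hyps[of "V - A" "\<lambda>X. f (add_mset (card A) X)"] less.prems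
      have "comps_expectation p (V - A) (\<lambda>C. f (add_mset (card A) (sizes C)))
          = size_law p (card (V - A)) (\<lambda>X. f (add_mset (card A) X))" by blast
      then show "conn_prob p A * (1 - p) ^ (card A * card (V - A))
          * comps_expectation p (V - A) (\<lambda>C. f (add_mset (card A) (sizes C))) = h (card A)"
        using A conn_prob_eq[of A p] by (simp add: h_def card)
    qed
    also have "\<dots> = (\<Sum>k\<le>n. real (n choose k) * h (Suc k))"
      using sum_subsets_containing_card[OF less.prems v, of h] n by simp
    also have "\<dots> = size_law p (card V) f"
      unfolding n by (simp add: h_def n mult_ac)
    finally show ?thesis .
  qed
qed

text \<open>A formula of Mecke type: given that k vertices form a component, the others carry the
  law for n - k vertices. The summand may depend on the remaining sizes, so the formula can be
  iterated over several prescribed components.\<close>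

lemma size_law_sum_comps:
  "size_law p n (\<lambda>X. \<Sum>x\<in>#X. f x (X - {#x#}))
    = (\<Sum>k\<in>{1..n}. expected_comps p n k * size_law p (n - k) (f k))"
proof -
  let ?V = "{..<n}"
  \<comment> \<open>The factor \<open>of_bool (0 < k)\<close> removes the empty set, which is not a
    component although \<open>conn p 1 (k - 1)\<close> equals 1 there.\<close>
  define h where "h k = of_bool (0 < k) * (conn p 1 (k - 1) * (1 - p) ^ (k * (n - k)) * size_law p (n - k) (f k))" for k
  have "size_law p n (\<lambda>X. \<Sum>x\<in>#X. f x (X - {#x#}))
      = comps_expectation p ?V (\<lambda>C. \<Sum>x\<in>#sizes C. f x (sizes C - {#x#}))"
    using comps_expectation_sizes[of ?V p "\<lambda>X. \<Sum>x\<in>#X. f x (X - {#x#})"] by simp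
  also have "\<dots> = comps_expectation p ?V (\<lambda>C. \<Sum>A\<in>C \<inter> (Pow ?V - {{}}). f (card A) (sizes (C - {A})))"
  proof (rule comps_expectation_cong)
    fix E
    have "comps ?V E \<inter> (Pow ?V - {{}}) = comps ?V E"
      by (auto dest: comps_subset comps_nonempty)
    moreover have "sizes (comps ?V E) - {#card A#} = sizes (comps ?V E - {A})" if "A \<in> comps ?V E" for A
      using that unfolding sizes_def by (subst mset_set.remove[of _ A]) auto
    ultimately show "(\<Sum>x\<in>#sizes (comps ?V E). f x (sizes (comps ?V E) - {#x#}))
        = (\<Sum>A\<in>comps ?V E \<inter> (Pow ?V - {{}}). f (card A) (sizes (comps ?V E - {A})))"
      by (simp add: sizes_def multiset.map_comp o_def sum_unfold_sum_mset[symmetric])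
  qed
  also have "\<dots> = (\<Sum>A\<in>Pow ?V - {{}}. conn_prob p A * (1 - p) ^ (card A * card (?V - A))
      * comps_expectation p (?V - A) (\<lambda>C. f (card A) (sizes C)))"
    by (rule comps_expectation_sum_comps) auto
  also have "\<dots> = (\<Sum>A\<in>Pow ?V - {{}}. h (card A))"
  proof (rule sum.cong[OF refl])
    fix A assume "A \<in> Pow ?V - {{}}"
    then have A: "A \<subseteq> ?V" "A \<noteq> {}" "finite A" using finite_subset[of A ?V] by auto
    have card: "card (?V - A) = n - card A" using A by (simp add: card_Diff_subset)
    show "conn_prob p A * (1 - p) ^ (card A * card (?V - A))
      * comps_expectation p (?V - A) (\<lambda>C. f (card A) (sizes C)) = h (card A)"
      using A by (simp add: h_def card conn_prob_eq comps_expectation_sizes card_gt_0_iff)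
  qed
  also have "\<dots> = (\<Sum>A\<in>Pow ?V. h (card A))"
    by (rule sum.mono_neutral_left) (auto simp: h_def)
  also have "\<dots> = (\<Sum>k\<le>n. real (n choose k) * h k)"
    using sum_subsets_card[of ?V h] by simp
  also have "\<dots> = (\<Sum>k\<in>{1..n}. real (n choose k) * h k)"
    by (rule sum.mono_neutral_right) (auto simp: h_def)
  also have "\<dots> = (\<Sum>k\<in>{1..n}. expected_comps p n k * size_law p (n - k) (f k))"
    by (intro sum.cong refl) (auto simp: h_def expected_comps_def)
  finally show ?thesis .
qed

section \<open>Identification with the random graph of the theorem\<close>

lemma all_edges_eq: "all_edges n = edges {..<n}"
  by (simp add: all_edges_def edges_def)

lemma connected_components_eq: "connected_components n E = comps {..<n} E"
  by (simp add: connected_components_def comps_def adj_def)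

lemma pmf_random_graph:
  assumes "0 \<le> p" "p \<le> 1" "E \<subseteq> edges {..<n}"
  shows "pmf (random_graph n p) E = weight p {..<n} E"
proof -
  let ?F = "edges {..<n}"
  have fin: "finite ?F" "finite E" using assms(3) finite_subset[OF _ finite_edges[of "{..<n}"]] by auto
  have "pmf (random_graph n p) E
      = measure (Pi_pmf ?F False (\<lambda>_. bernoulli_pmf p)) (Pi ?F (\<lambda>e. {e \<in> E}))"
    unfolding random_graph_def pmf_map all_edges_eq
    by (intro arg_cong[where f = "measure_pmf.prob _"]) (use assms(3) in \<open>auto simp: Pi_def\<close>)
  also have "\<dots> = (\<Prod>e\<in>?F. pmf (bernoulli_pmf p) (e \<in> E))"
    using fin by (simp add: measure_Pi_pmf_Pi measure_pmf_single)
  also have "\<dots> = (\<Prod>e\<in>E. pmf (bernoulli_pmf p) (e \<in> E)) * (\<Prod>e\<in>?F - E. pmf (bernoulli_pmf p) (e \<in> E))"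
    using fin assms(3) by (metis prod.subset_diff mult.commute)
  also have "\<dots> = weight p {..<n} E"
    using assms fin by (simp add: weight_def card_Diff_subset)
  finally show ?thesis .
qed

lemma prob_random_graph:
  assumes "0 \<le> p" "p \<le> 1"
  shows "measure_pmf.prob (random_graph n p) {E. P (sizes (connected_components n E))}
    = size_law p n (\<lambda>X. of_bool (P X))"
proof -
  let ?S = "{E. P (sizes (comps {..<n} E))}" and ?F = "edges {..<n}"
  have supp: "set_pmf (random_graph n p) \<subseteq> Pow ?F"
    by (auto simp: random_graph_def all_edges_eq)
  have "measure_pmf.prob (random_graph n p) ?S = measure_pmf.prob (random_graph n p) (?S \<inter> Pow ?F)"
    using supp by (intro measure_prob_cong_0) (auto simp: set_pmf_iff)
  also have "\<dots> = (\<Sum>E\<in>?S \<inter> Pow ?F. pmf (random_graph n p) E)"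
    by (intro measure_measure_pmf_finite) auto
  also have "\<dots> = (\<Sum>E\<in>?S \<inter> Pow ?F. weight p {..<n} E)"
    using assms by (intro sum.cong refl pmf_random_graph) auto
  also have "\<dots> = comps_expectation p {..<n} (\<lambda>C. of_bool (P (sizes C)))"
    unfolding comps_expectation_def by (intro sum.mono_neutral_cong_left) auto
  finally show ?thesis
    using comps_expectation_sizes[of "{..<n}" p "\<lambda>X. of_bool (P X)"]
    by (simp add: connected_components_eq)
qed

section \<open>Non-asymptotic estimates\<close>

lemma size_law_mono:
  assumes "0 \<le> p" "p \<le> 1" "\<And>X. f X \<le> g X"
  shows "size_law p n f \<le> size_law p n g"
  using assms(3)
proof (induction n arbitrary: f g rule: less_induct)
  case (less n)
  show ?case
  proof (cases n)
    case 0
    with less.prems show ?thesis by simp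
  next
    case (Suc m)
    have "size_law p (m - k) (\<lambda>X. f (add_mset (Suc k) X)) \<le> size_law p (m - k) (\<lambda>X. g (add_mset (Suc k) X))" for k
      by (rule less.IH) (use Suc less.prems in auto)
    then show ?thesis unfolding Suc size_law.simps(2)
      using assms(1,2) by (intro sum_mono mult_left_mono mult_nonneg_nonneg conn_nonneg) auto
  qed
qed

lemma size_law_add: "size_law p n (\<lambda>X. f X + g X) = size_law p n f + size_law p n g"
proof (induction n arbitrary: f g rule: less_induct)
  case (less n)
  show ?case
  proof (cases n)
    case (Suc m)
    have "size_law p (m - k) (\<lambda>X. f (add_mset (Suc k) X) + g (add_mset (Suc k) X))
      = size_law p (m - k) (\<lambda>X. f (add_mset (Suc k) X)) + size_law p (m - k) (\<lambda>X. g (add_mset (Suc k) X))" for k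
      by (rule less.IH) (simp add: Suc)
    then show ?thesis
      unfolding Suc size_law.simps(2) by (simp add: distrib_left sum.distrib)
  qed simp
qed

lemma size_law_cmult: "size_law p n (\<lambda>X. a * f X) = a * size_law p n f"
proof (induction n arbitrary: f rule: less_induct)
  case (less n)
  show ?case
  proof (cases n)
    case (Suc m)
    have "size_law p (m - k) (\<lambda>X. a * f (add_mset (Suc k) X))
      = a * size_law p (m - k) (\<lambda>X. f (add_mset (Suc k) X))" for k
      by (rule less.IH) (simp add: Suc)
    then show ?thesis
      unfolding Suc size_law.simps(2) by (simp add: sum_distrib_left mult_ac)
  qed simp
qed

lemma size_law_total: "size_law p n (\<lambda>_. 1) = 1"
proof (induction n rule: less_induct)
  case (less n)
  show ?case
  proof (cases n)
    case (Suc m)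
    have "size_law p (m - k) (\<lambda>_. 1) = 1" for k
      by (rule less.IH) (simp add: Suc)
    then have "size_law p n (\<lambda>_. 1) = bfs p 1 m (\<lambda>_. 1)"
      unfolding Suc size_law.simps(2) bfs_def by simp
    then show ?thesis by (simp only: bfs_total)
  qed simp
qed

lemma size_law_nonneg:
  assumes "0 \<le> p" "p \<le> 1" "\<And>X. 0 \<le> f X"
  shows "0 \<le> size_law p n f"
  using size_law_mono[OF assms(1,2), of "\<lambda>X. 0 * f X" f n] assms(3)
  by (simp only: size_law_cmult) simp

lemma size_law_le_1:
  assumes "0 \<le> p" "p \<le> 1" "\<And>X. f X \<le> 1"
  shows "size_law p n f \<le> 1"
  using size_law_mono[OF assms, of n] by (simp add: size_law_total)

lemma expected_comps_nonneg: "0 \<le> p \<Longrightarrow> p \<le> 1 \<Longrightarrow> 0 \<le> expected_comps p n k"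
  unfolding expected_comps_def by (intro mult_nonneg_nonneg conn_nonneg) auto

text \<open>The error h satisfies 0 \<le> h' \<le> 3 x^2 on [-1/2, \<infinity>), so h increases and
  h - x^3 decreases there; both vanish at 0.\<close>

lemma ln_one_plus_taylor2:
  fixes x :: real
  assumes "\<bar>x\<bar> \<le> 1/2"
  shows "\<bar>ln (1 + x) - (x - x\<^sup>2 / 2)\<bar> \<le> \<bar>x\<bar> ^ 3"
proof -
  define h where "h x = ln (1 + x) - (x - x\<^sup>2 / 2)" for x :: real
  have dh: "(h has_real_derivative x\<^sup>2 / (1 + x)) (at x)" if "-1/2 \<le> x" for x
  proof -
    have "1 / (1 + x) - (1 - x) = x\<^sup>2 / (1 + x)"
      using that by (simp add: field_simps power2_eq_square)
    then show ?thesis unfolding h_def using that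
      by (auto intro!: derivative_eq_intros)
  qed
  have dg: "((\<lambda>x. h x - x ^ 3) has_real_derivative x\<^sup>2 / (1 + x) - 3 * x\<^sup>2) (at x)" if "-1/2 \<le> x" for x
    using dh[OF that] by (auto intro!: derivative_eq_intros)
  have mono: "h a \<le> h b" if "-1/2 \<le> a" "a \<le> b" for a b
  proof (rule DERIV_nonneg_imp_nondecreasing[OF that(2)])
    fix x assume x: "a \<le> x" "x \<le> b"
    then have "0 \<le> x\<^sup>2 / (1 + x)" using that by simp
    then show "\<exists>y. (h has_real_derivative y) (at x) \<and> 0 \<le> y"
      using dh[of x] x that by auto
  qed
  have anti: "h b - b ^ 3 \<le> h a - a ^ 3" if "-1/2 \<le> a" "a \<le> b" for a b
  proof (rule DERIV_nonpos_imp_nonincreasing[OF that(2)])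
    fix x assume x: "a \<le> x" "x \<le> b"
    then have "1 \<le> 3 * (1 + x)" using that by simp
    then have "x\<^sup>2 * 1 \<le> x\<^sup>2 * (3 * (1 + x))" by (intro mult_left_mono) auto
    then have "x\<^sup>2 / (1 + x) - 3 * x\<^sup>2 \<le> 0" using x that by (simp add: divide_le_eq algebra_simps)
    then show "\<exists>y. ((\<lambda>x. h x - x ^ 3) has_real_derivative y) (at x) \<and> y \<le> 0"
      using dg[of x] x that by auto
  qed
  have "h 0 = 0" by (simp add: h_def)
  then have "\<bar>h x\<bar> \<le> \<bar>x\<bar> ^ 3"
    using mono[of 0 x] mono[of x 0] anti[of 0 x] anti[of x 0] assms
    by (cases "0 \<le> x") (auto simp: abs_if)
  then show ?thesis by (simp add: h_def)
qed

text \<open>A revealed component of size m lowers the exponent by at most l * m, where l is the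
  derivative of the exponent in the number of vertices. So it suffices that exp (l * m), restricted
  to m \<le> K, has expectation at most 1. Exploring such a component leaves at least N - K vertices
  unreached, whence the K in \<open>v\<close>.\<close>

lemma small_comps_bound:
  fixes p Y :: real and K N :: nat
  defines "v \<equiv> \<lambda>N::nat. max 0 (p * (real N - real K) - 1)"
  assumes p: "0 < p" "p \<le> 1" and Y: "0 \<le> Y" "Y \<le> 1/2" and "v N \<le> Y"
  shows "size_law p N (\<lambda>X. of_bool (\<forall>x\<in>#X. x \<le> K)) \<le> exp (- ((1 - 2 * Y) * v N ^ 3 / (6 * p)))"
  using \<open>v N \<le> Y\<close>
proof (induction N rule: less_induct)
  case (less N)
  let ?f = "\<lambda>X. of_bool (\<forall>x\<in>#X. x \<le> K) :: real"
  define a where "a N = (1 - 2 * Y) * v N ^ 3 / (6 * p)" for N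
  have v0: "0 \<le> v N" for N by (simp add: v_def)
  show ?case
  proof (cases "v N = 0")
    case True
    then show ?thesis using p by (simp add: size_law_le_1)
  next
    case False
    define y where "y = v N"
    have y: "0 < y" "y \<le> Y" "p * (real N - real K) = 1 + y"
      using False less.prems by (auto simp: y_def v_def max_def split: if_splits)
    have NK: "K < N"
    proof (rule ccontr)
      assume "\<not> K < N"
      then have "p * (real N - real K) \<le> 0" using p by (intro mult_nonneg_nonpos) auto
      with y show False by simp
    qed
    then obtain n where n: "N = Suc n" by (cases N) auto
    \<comment> \<open>With p (N - K) = 1 + y, this z maximises z * exp ((1 + y) * (1 - z)), which
      leaves most room for exp l. The maximum is exp (y - ln (1 + y)), about exp (y^2 / 2); the
      factor 1 - 2 Y in \<open>l\<close> pays for the cubic error.\<close>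
    define z where "z = 1 / (1 + y)"
    define l where "l = (1 - 2 * Y) * y\<^sup>2 / 2"
    have z: "0 \<le> z" "z \<le> 1" "1 - z = y / (1 + y)" using y by (auto simp: z_def field_simps)
    have s: "0 \<le> 1 - p * (1 - z)" using p z mult_le_one[of p "1 - z"] by auto
    have pw: "(1 - p * (1 - z)) ^ (N - K) \<le> exp (- y)"
    proof -
      have "(1 - p * (1 - z)) ^ (N - K) \<le> exp (- p * (1 - z)) ^ (N - K)"
        using s exp_ge_add_one_self[of "- p * (1 - z)"] by (intro power_mono) auto
      also have "\<dots> = exp (- (p * (real N - real K) * (1 - z)))"
        using NK by (simp add: exp_of_nat_mult[symmetric] of_nat_diff algebra_simps)
      also have "\<dots> = exp (- y)" using y by (simp add: z field_simps)
      finally show ?thesis .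
    qed
    have "ln (1 + y) \<le> y - y\<^sup>2 / 2 + y ^ 3"
      using ln_one_plus_taylor2[of y] y Y by (simp add: abs_le_iff)
    moreover have "y ^ 3 \<le> Y * y\<^sup>2" using y by (simp add: power3_eq_cube power2_eq_square mult_right_mono)
    ultimately have "l - y \<le> - ln (1 + y)" by (simp add: l_def field_simps)
    then have "exp (l - y) \<le> exp (- ln (1 + y))" by simp
    also have "\<dots> = z" using y by (simp add: z_def exp_minus divide_inverse)
    finally have "exp (l - y) \<le> z" .
    then have cond: "exp l * (1 - p * (1 - z)) ^ (N - K) \<le> z"
      using mult_left_mono[OF pw, of "exp l"] by (simp add: exp_add[symmetric])
    \<comment> \<open>Convexity of the cube on the nonnegative reals: over Suc k vertices the
      exponent falls by at most its derivative at y times Suc k.\<close>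
    have a_le: "a N - l * real (Suc k) \<le> a (n - k)" if "k \<le> n" for k
    proof -
      define y' where "y' = v (n - k)"
      have y': "0 \<le> y'" "y' \<le> y" "y - y' \<le> p * real (Suc k)"
      proof -
        show "0 \<le> y'" by (simp add: y'_def v0)
        have "p * (real (n - k) - real K) - 1 = y - p * real (Suc k)"
          using that y n by (simp add: of_nat_diff algebra_simps)
        then show "y' \<le> y" "y - y' \<le> p * real (Suc k)" using p y by (auto simp: y'_def v_def)
      qed
      have "y ^ 3 - y' ^ 3 = (y - y') * (y\<^sup>2 + y * y' + y'\<^sup>2)"
        by (simp add: power3_eq_cube power2_eq_square algebra_simps)
      also have "\<dots> \<le> (y - y') * (y\<^sup>2 + y * y + y\<^sup>2)"
        using y y' by (intro mult_left_mono add_mono power_mono) auto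
      also have "\<dots> \<le> (p * real (Suc k)) * (3 * y\<^sup>2)"
        using y y' by (intro mult_mono) (auto simp: power2_eq_square)
      finally have "(1 - 2 * Y) / (6 * p) * (y ^ 3 - y' ^ 3) \<le> (1 - 2 * Y) / (6 * p) * ((p * real (Suc k)) * (3 * y\<^sup>2))"
        using Y p by (intro mult_left_mono) auto
      then show ?thesis using p by (simp add: a_def l_def y_def[symmetric] y'_def[symmetric] field_simps)
    qed
    have "size_law p N ?f = (\<Sum>k\<le>n. real (n choose k) * conn p 1 k * (1 - p) ^ (Suc k * (n - k))
        * (of_bool (Suc k \<le> K) * size_law p (n - k) ?f))"
      unfolding n size_law.simps size_law_cmult[symmetric]
      by (intro sum.cong refl arg_cong2[where f = "(*)"] arg_cong[where f = "size_law p _"]) auto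
    also have "\<dots> \<le> (\<Sum>k\<le>n. real (n choose k) * conn p 1 k * (1 - p) ^ (Suc k * (n - k))
        * (of_bool (Suc k \<le> K) * exp (- a N + l * real (Suc k))))"
    proof (intro sum_mono mult_left_mono mult_nonneg_nonneg conn_nonneg)
      fix k assume "k \<in> {..n}"
      then have k: "k \<le> n" by simp
      have "p * (real (n - k) - real K) \<le> p * (real N - real K)"
        using k p n by (intro mult_left_mono) auto
      then have "v (n - k) \<le> v N" by (auto simp: v_def)
      with less.IH[of "n - k"] less.prems k n have "size_law p (n - k) ?f \<le> exp (- a (n - k))"
        by (simp add: a_def)
      also have "\<dots> \<le> exp (- a N + l * real (Suc k))" using a_le[OF k] by simp
      finally show "size_law p (n - k) ?f \<le> exp (- a N + l * real (Suc k))" .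
    qed (use p in auto)
    also have "\<dots> = exp (- a N) * bfs p 1 n (\<lambda>k. of_bool (1 + k \<le> K) * exp l ^ (1 + k))"
    proof -
      have "exp (- a N + l * real (Suc k)) = exp (- a N) * exp l ^ (1 + k)" for k
        using exp_of_nat_mult[of "Suc k" l] by (simp only: exp_add mult.commute) simp
      then show ?thesis
        unfolding bfs_def sum_distrib_left by (intro sum.cong refl) (simp add: mult_ac)
    qed
    also have "\<dots> \<le> exp (- a N) * z ^ 1"
      using cond p z NK n by (intro mult_left_mono bfs_exponential_bound[where R = "N - K"]) auto
    also have "\<dots> \<le> exp (- a N)" using z by simp
    finally show ?thesis by (simp add: a_def)
  qed
qed

text \<open>Counting vertices, the expected number of components of size k is N / k times the
  probability that the component of a fixed vertex has size k. Since k \<ge> T, the sum is at most N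
  / T times a survival probability of the exploration.\<close>

lemma expected_large_comps_bound:
  assumes p: "0 \<le> p" "p \<le> 1" and z: "0 \<le> z" "z \<le> 1" and \<rho>: "0 \<le> \<rho>" "\<rho> < 1"
    and cond: "z \<le> \<rho> * (1 - p * (1 - z)) ^ N" and T: "0 < T"
  shows "(\<Sum>k\<in>{T..N}. expected_comps p N k) \<le> real N / real T * ((1 - z) / (1 - \<rho> ^ T))"
proof (cases "T \<le> N")
  case True
  then obtain n where n: "N = Suc n" using T by (cases N) auto
  define w where "w k = real (n choose (k - 1)) * conn p 1 (k - 1) * (1 - p) ^ (k * (N - k))" for k
  have w0: "0 \<le> w k" for k
    unfolding w_def using p by (intro mult_nonneg_nonneg conn_nonneg) auto
  have "(\<Sum>k\<in>{T..N}. expected_comps p N k) \<le> (\<Sum>k\<in>{T..N}. real N / real T * w k)"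
  proof (rule sum_mono)
    fix k assume k: "k \<in> {T..N}"
    then obtain k' where k': "k = Suc k'" using T by (cases k) auto
    have "Suc k' * (N choose k) = N * (n choose k')"
      unfolding n k' by (rule Suc_times_binomial)
    then have "real k * real (N choose k) = real N * real (n choose k')"
      unfolding k' by (metis of_nat_mult)
    then have "real (N choose k) = real N / real k * real (n choose k')"
      using k T by (simp add: field_simps)
    then have "expected_comps p N k = real N / real k * w k"
      by (simp add: expected_comps_def w_def k')
    also have "\<dots> \<le> real N / real T * w k"
      using k T w0 by (intro mult_right_mono divide_left_mono) auto
    finally show "expected_comps p N k \<le> real N / real T * w k" .
  qed
  also have "\<dots> = real N / real T * (\<Sum>k\<in>{T..N}. w k)" by (simp add: sum_distrib_left)
  also have "(\<Sum>k\<in>{T..N}. w k) = (\<Sum>k\<in>{T-1..n}. w (Suc k))"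
    using T n by (intro sum.reindex_bij_witness[of _ Suc "\<lambda>k. k - 1"]) auto
  also have "\<dots> = bfs p 1 n (\<lambda>k. of_bool (T \<le> 0 + 1 + k))"
    unfolding bfs_def w_def using T n
    by (intro sum.mono_neutral_cong_left) auto
  finally have eq: "(\<Sum>k\<in>{T..N}. expected_comps p N k) \<le> real N / real T * bfs p 1 n (\<lambda>k. of_bool (T \<le> 0 + 1 + k))" .
  have "bfs p 1 n (\<lambda>k. of_bool (T \<le> 0 + 1 + k)) \<le> (1 - z) / (1 - \<rho> ^ T)"
  proof -
    have "\<rho> ^ T < 1" using \<rho> T by (simp add: power_Suc_less_one power_less_one_iff)
    moreover have "(1 - \<rho> ^ T) * bfs p 1 n (\<lambda>k. of_bool (T \<le> 0 + 1 + k)) \<le> 1 - z ^ 1 * \<rho> ^ 0"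
      using bfs_survival_bound[of p z \<rho> N n 0 T 1] assms n by simp
    ultimately show ?thesis by (simp add: field_simps)
  qed
  then have "real N / real T * bfs p 1 n (\<lambda>k. of_bool (T \<le> 0 + 1 + k))
      \<le> real N / real T * ((1 - z) / (1 - \<rho> ^ T))" by (intro mult_left_mono) auto
  with eq show ?thesis by linarith
next
  case False
  have "\<rho> ^ T \<le> 1" using \<rho> by (simp add: power_le_one)
  with False z show ?thesis by simp
qed

section \<open>Dependence of the expected number of components on the number of vertices\<close>

text \<open>Isolates a factor depending on p and k only, which is never evaluated, from an explicit
  exponential in which N occurs.\<close>

lemma expected_comps_exp:
  assumes p: "0 < p" "p < 1" and k: "k \<le> N"
  shows "expected_comps p N k = conn p 1 (k - 1) / (fact k * p ^ k * (1 - p) ^ (k * k)) *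
    exp ((\<Sum>i<k. ln (p * (real N - real i))) + real k * real N * ln (1 - p))"
proof -
  have "real (N choose k) = (\<Prod>i<k. real N - real i) / fact k"
    by (simp add: binomial_gbinomial gbinomial_prod_rev atLeast0LessThan)
  also have "(\<Prod>i<k. real N - real i) = (\<Prod>i<k. p * (real N - real i)) / p ^ k"
    using p by (simp add: prod.distrib)
  also have "(\<Prod>i<k. p * (real N - real i)) = exp (\<Sum>i<k. ln (p * (real N - real i)))"
    using p k by (simp add: exp_sum)
  finally have 1: "real (N choose k) = exp (\<Sum>i<k. ln (p * (real N - real i))) / p ^ k / fact k" .
  have "(1 - p) ^ (k * (N - k)) * (1 - p) ^ (k * k) = (1 - p) ^ (k * N)"
    using k by (simp add: power_add[symmetric] diff_mult_distrib2)
  also have "\<dots> = exp (real k * real N * ln (1 - p))"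
    using p by (simp add: exp_of_nat_mult flip: of_nat_mult)
  finally have 2: "(1 - p) ^ (k * (N - k)) = exp (real k * real N * ln (1 - p)) / (1 - p) ^ (k * k)"
    using p by (simp add: field_simps)
  show ?thesis unfolding expected_comps_def 1 2 by (simp add: exp_add field_simps)
qed

text \<open>Uses only ln x \<le> x - 1 and 1 / (M - i) \<ge> 1 / M + i / M^2, so it holds for every
  k up to N. The exponent contains a negative term quadratic in k, which wins for large k and makes
  huge components unlikely.\<close>

lemma expected_comps_add_bound:
  assumes p: "0 < p" "p \<le> 1/2" and k: "1 \<le> k" "k \<le> N"
  shows "expected_comps p N k \<le> expected_comps p (N + d) k *
    exp (real k * real d * (p + 2 * p\<^sup>2 - 1 / real (N + d) - (real k - 1) / (2 * (real (N + d))\<^sup>2)))"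
proof -
  define M where "M = real (N + d)"
  have M: "0 < M" using k by (simp add: M_def)
  have ln_q: "- ln (1 - p) \<le> p + 2 * p\<^sup>2"
    using abs_ln_one_plus_x_minus_x_bound[of "-p"] p by (simp add: abs_le_iff)
  have term_le: "ln (p * (real N - real i)) \<le> ln (p * (M - real i)) - real d / M - real d / M\<^sup>2 * real i"
    if i: "i < k" for i
  proof -
    have pos: "0 < real N - real i" "0 < M - real i" using i k by (auto simp: M_def)
    have "ln (p * (real N - real i)) - ln (p * (M - real i)) = ln ((real N - real i) / (M - real i))"
      using p pos by (simp add: ln_div ln_mult)
    also have "\<dots> \<le> (real N - real i) / (M - real i) - 1"
      using pos by (intro ln_le_minus_one) auto
    also have "\<dots> = - (real d / (M - real i))" using pos by (simp add: M_def field_simps)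
    also have "\<dots> \<le> - (real d / M + real d / M\<^sup>2 * real i)"
    proof -
      have "(1 / M + real i / M\<^sup>2) * (M - real i) \<le> 1"
        using M by (simp add: field_simps power2_eq_square)
      then have "1 / M + real i / M\<^sup>2 \<le> 1 / (M - real i)"
        using pos by (simp add: le_divide_eq)
      then have "real d * (1 / M + real i / M\<^sup>2) \<le> real d * (1 / (M - real i))"
        by (intro mult_left_mono) auto
      then show ?thesis by (simp add: algebra_simps)
    qed
    finally show ?thesis by simp
  qed
  have gauss: "(\<Sum>i<k. real i) = real k * (real k - 1) / 2" for k :: nat
    by (induction k) (auto simp: algebra_simps)
  have "(\<Sum>i<k. ln (p * (real N - real i)))
      \<le> (\<Sum>i<k. ln (p * (M - real i)) - real d / M - real d / M\<^sup>2 * real i)"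
    using term_le by (intro sum_mono) auto
  also have "\<dots> = (\<Sum>i<k. ln (p * (M - real i))) - real k * (real d / M)
      - real d / M\<^sup>2 * (real k * (real k - 1) / 2)"
    by (simp only: sum_subtractf sum_distrib_left[symmetric] gauss) simp
  also have "\<dots> = (\<Sum>i<k. ln (p * (M - real i))) - real k * real d * (1 / M + (real k - 1) / (2 * M\<^sup>2))"
    by (simp add: algebra_simps)
  finally have "(\<Sum>i<k. ln (p * (real N - real i))) + real k * real N * ln (1 - p)
      \<le> (\<Sum>i<k. ln (p * (M - real i))) + real k * M * ln (1 - p)
        - real k * real d * (1 / M + (real k - 1) / (2 * M\<^sup>2)) + real k * real d * (- ln (1 - p))"
    by (simp add: M_def algebra_simps)
  also have "\<dots> \<le> (\<Sum>i<k. ln (p * (M - real i))) + real k * M * ln (1 - p)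
        - real k * real d * (1 / M + (real k - 1) / (2 * M\<^sup>2)) + real k * real d * (p + 2 * p\<^sup>2)"
    using ln_q by (intro add_left_mono mult_left_mono) auto
  also have "\<dots> = ((\<Sum>i<k. ln (p * (M - real i))) + real k * M * ln (1 - p))
        + real k * real d * (p + 2 * p\<^sup>2 - 1 / M - (real k - 1) / (2 * M\<^sup>2))"
    by (simp add: algebra_simps)
  finally have *: "exp ((\<Sum>i<k. ln (p * (real N - real i))) + real k * real N * ln (1 - p))
      \<le> exp ((\<Sum>i<k. ln (p * (M - real i))) + real k * M * ln (1 - p))
        * exp (real k * real d * (p + 2 * p\<^sup>2 - 1 / M - (real k - 1) / (2 * M\<^sup>2)))"
    by (simp add: exp_add[symmetric])
  have c: "0 \<le> conn p 1 (k - 1) / (fact k * p ^ k * (1 - p) ^ (k * k))"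
    using p by (intro divide_nonneg_nonneg conn_nonneg mult_nonneg_nonneg) auto
  have e: "expected_comps p N k = conn p 1 (k - 1) / (fact k * p ^ k * (1 - p) ^ (k * k)) *
      exp ((\<Sum>i<k. ln (p * (real N - real i))) + real k * real N * ln (1 - p))"
    "expected_comps p (N + d) k = conn p 1 (k - 1) / (fact k * p ^ k * (1 - p) ^ (k * k)) *
      exp ((\<Sum>i<k. ln (p * (M - real i))) + real k * M * ln (1 - p))"
    using p k unfolding M_def by (intro expected_comps_exp; simp)+
  show ?thesis
    using mult_left_mono[OF * c] unfolding e M_def[symmetric] by (simp only: mult.assoc)
qed

text \<open>With p (N - i) = 1 + x the logarithms are expanded to second order. The first-order part
  k e (t - t0) cancels against the change of k N ln (1 - p), up to 4 A k e p; the second-order part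
  remains, and the last term bounds the cubic remainders.\<close>

lemma expected_comps_transfer:
  fixes p e t t0 A :: real and k N N0 :: nat
  assumes p: "0 < p" "p \<le> 1/2" and e: "0 < e" "e * (A + B) \<le> 1/2"
    and k: "k \<le> N" "k \<le> N0" and N: "p * real N = 1 + e * t" "p * real N0 = 1 + e * t0"
    and t: "\<bar>t\<bar> \<le> A" "\<bar>t0\<bar> \<le> A" and B: "p * real k \<le> B * e"
  shows "expected_comps p N k \<le> expected_comps p N0 k *
    exp (real k * e\<^sup>2 * (t - t0) / 2 * (p * (real k - 1) / e - t - t0)
      + 4 * A * real k * e * p + 2 * real k * (e * (A + B)) ^ 3)"
proof -
  define x where "x t i = e * t - p * real i" for t and i :: nat
  have xb: "\<bar>x t' i\<bar> \<le> e * (A + B)" if "\<bar>t'\<bar> \<le> A" "i < k" for t' i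
  proof -
    have "\<bar>x t' i\<bar> \<le> e * \<bar>t'\<bar> + p * real i"
      using abs_triangle_ineq4[of "e * t'" "p * real i"] e p by (simp add: x_def abs_mult)
    also have "\<dots> \<le> e * A + p * real k" using that e p by (intro add_mono mult_left_mono) auto
    also have "\<dots> \<le> e * (A + B)" using B by (simp add: algebra_simps)
    finally show ?thesis .
  qed
  have lnx: "\<bar>ln (1 + x t' i) - (x t' i - (x t' i)\<^sup>2 / 2)\<bar> \<le> (e * (A + B)) ^ 3" if "\<bar>t'\<bar> \<le> A" "i < k" for t' i
  proof -
    have "\<bar>ln (1 + x t' i) - (x t' i - (x t' i)\<^sup>2 / 2)\<bar> \<le> \<bar>x t' i\<bar> ^ 3"
      using xb[OF that] e by (intro ln_one_plus_taylor2) auto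
    also have "\<dots> \<le> (e * (A + B)) ^ 3" using xb[OF that] by (intro power_mono) auto
    finally show ?thesis .
  qed
  have px: "p * (real N - real i) = 1 + x t i" "p * (real N0 - real i) = 1 + x t0 i" for i
    using N by (auto simp: x_def algebra_simps)
  have sum_id: "(\<Sum>i<k. (x t i - (x t i)\<^sup>2 / 2) - (x t0 i - (x t0 i)\<^sup>2 / 2))
      = real k * e * (t - t0) - e * (t - t0) / 2 * (real k * e * (t + t0) - p * (real k * (real k - 1)))" for k :: nat
    by (induction k) (auto simp: x_def power2_eq_square field_simps)
  have NN: "real N - real N0 = e * (t - t0) / p" using N p by (simp add: field_simps)
  have ln_q: "\<bar>ln (1 - p) + p\<bar> \<le> 2 * p\<^sup>2"
    using abs_ln_one_plus_x_minus_x_bound[of "-p"] p by simp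
  have q_part: "real k * real N * ln (1 - p) \<le> real k * real N0 * ln (1 - p)
      - real k * e * (t - t0) + 4 * A * real k * e * p"
  proof -
    have "real k * real N * ln (1 - p) - real k * real N0 * ln (1 - p) + real k * e * (t - t0)
        = real k * (real N - real N0) * (ln (1 - p) + p)"
    proof -
      have "real k * e * (t - t0) = real k * (real N - real N0) * p" using p by (simp add: NN)
      then show ?thesis by (simp add: algebra_simps)
    qed
    also have "\<dots> \<le> \<bar>real k * (real N - real N0)\<bar> * \<bar>ln (1 - p) + p\<bar>"
      by (simp add: abs_mult[symmetric] abs_ge_self del: abs_mult)
    also have "\<dots> \<le> (real k * (e * (2 * A) / p)) * (2 * p\<^sup>2)"
    proof (intro mult_mono ln_q)
      have "\<bar>t - t0\<bar> \<le> 2 * A" using t by linarith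
      then show "\<bar>real k * (real N - real N0)\<bar> \<le> real k * (e * (2 * A) / p)"
        unfolding NN using e p by (auto simp: abs_mult intro!: mult_left_mono divide_right_mono)
    qed (use e p t in auto)
    also have "\<dots> = 4 * A * real k * e * p" using p by (simp add: power2_eq_square)
    finally show ?thesis by simp
  qed
  have "(\<Sum>i<k. ln (p * (real N - real i))) - (\<Sum>i<k. ln (p * (real N0 - real i)))
      = (\<Sum>i<k. ln (1 + x t i) - ln (1 + x t0 i))" by (simp add: px sum_subtractf)
  also have "\<dots> \<le> (\<Sum>i<k. ((x t i - (x t i)\<^sup>2 / 2) - (x t0 i - (x t0 i)\<^sup>2 / 2)) + 2 * (e * (A + B)) ^ 3)"
  proof (rule sum_mono)
    fix i assume "i \<in> {..<k}"
    then show "ln (1 + x t i) - ln (1 + x t0 i)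
        \<le> ((x t i - (x t i)\<^sup>2 / 2) - (x t0 i - (x t0 i)\<^sup>2 / 2)) + 2 * (e * (A + B)) ^ 3"
      using lnx[OF t(1), of i] lnx[OF t(2), of i] by (simp add: abs_le_iff)
  qed
  also have "\<dots> = real k * e * (t - t0) - e * (t - t0) / 2 * (real k * e * (t + t0) - p * (real k * (real k - 1)))
      + 2 * real k * (e * (A + B)) ^ 3"
    by (simp add: sum.distrib sum_id)
  finally have "(\<Sum>i<k. ln (p * (real N - real i))) + real k * real N * ln (1 - p)
    \<le> (\<Sum>i<k. ln (p * (real N0 - real i))) + real k * real N0 * ln (1 - p)
      + (- e * (t - t0) / 2 * (real k * e * (t + t0) - p * (real k * (real k - 1)))
      + 4 * A * real k * e * p + 2 * real k * (e * (A + B)) ^ 3)"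
    using q_part by simp
  also have "- e * (t - t0) / 2 * (real k * e * (t + t0) - p * (real k * (real k - 1)))
      = real k * e\<^sup>2 * (t - t0) / 2 * (p * (real k - 1) / e - t - t0)"
    using e by (simp add: field_simps power2_eq_square)
  finally have *: "exp ((\<Sum>i<k. ln (p * (real N - real i))) + real k * real N * ln (1 - p))
      \<le> exp ((\<Sum>i<k. ln (p * (real N0 - real i))) + real k * real N0 * ln (1 - p))
        * exp (real k * e\<^sup>2 * (t - t0) / 2 * (p * (real k - 1) / e - t - t0)
          + 4 * A * real k * e * p + 2 * real k * (e * (A + B)) ^ 3)"
    by (simp add: exp_add[symmetric])
  have c: "0 \<le> conn p 1 (k - 1) / (fact k * p ^ k * (1 - p) ^ (k * k))"
    using p by (intro divide_nonneg_nonneg conn_nonneg mult_nonneg_nonneg) auto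
  have ex: "expected_comps p n k = conn p 1 (k - 1) / (fact k * p ^ k * (1 - p) ^ (k * k)) *
      exp ((\<Sum>i<k. ln (p * (real n - real i))) + real k * real n * ln (1 - p))" if "k \<le> n" for n
    using p that by (intro expected_comps_exp; simp)
  show ?thesis
    using mult_left_mono[OF * c] unfolding ex[OF k(1)] ex[OF k(2)] by (simp only: mult.assoc)
qed

section \<open>The near-critical window\<close>

text \<open>Exponential cost of a component of size y at drift t. The formula is forced: comparing
  vertex counts dictates the difference between two drifts (\<open>rate_diff\<close>), and the cost
  vanishes at t = y / 2, where y is the size of the giant component.\<close>

definition rate :: "real \<Rightarrow> real \<Rightarrow> real" where
  "rate t y = y * (y - 2 * t)\<^sup>2 / 8"

lemma rate_nonneg: "0 \<le> y \<Longrightarrow> 0 \<le> rate t y"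
  by (simp add: rate_def)

lemma rate_diff: "rate s y - rate t y = y * (t - s) / 2 * (y - t - s)"
  by (simp add: rate_def power2_eq_square field_simps)

lemma rate_close:
  assumes "0 < \<eta>"
  obtains d where "0 < d" "\<And>s z. \<bar>s - t\<bar> \<le> d \<Longrightarrow> \<bar>z - y\<bar> \<le> d \<Longrightarrow> \<bar>rate s z - rate t y\<bar> < \<eta>"
proof -
  have "isCont (\<lambda>x. rate (fst x) (snd x)) (t, y)"
    unfolding rate_def by (intro continuous_intros) auto
  then obtain d where d: "0 < d" "\<And>x. dist x (t, y) < d \<Longrightarrow> dist (rate (fst x) (snd x)) (rate t y) < \<eta>"
    using assms unfolding continuous_at_eps_delta by (metis fst_conv snd_conv)
  show ?thesis
  proof (rule that[of "d / 3"])
    fix s z assume "\<bar>s - t\<bar> \<le> d / 3" "\<bar>z - y\<bar> \<le> d / 3"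
    then have "dist (s, z) (t, y) < d"
      using sqrt_sum_squares_le_sum_abs[of "dist s t" "dist z y"] d(1)
      by (simp add: dist_Pair_Pair dist_real_def)
    from d(2)[OF this] show "\<bar>rate s z - rate t y\<bar> < \<eta>" by (simp add: dist_real_def)
  qed (use d in auto)
qed

lemma sum_mset_of_bool_nonneg: "0 \<le> (\<Sum>x\<in>#X. of_bool (P x) :: real)"
  by (induction X) auto

text \<open>Divergence of n \<epsilon>^3 means that \<epsilon> is much larger than the width
  n^(-1/3) of the critical window, while it still tends to 0.\<close>

locale near_critical =
  fixes p \<epsilon> :: "nat \<Rightarrow> real" and \<theta> :: real
  assumes eps_pos: "\<forall>\<^sub>F n in sequentially. 0 < \<epsilon> n"
    and eps_tendsto: "\<epsilon> \<longlonglongrightarrow> 0"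
    and scale_at_top: "filterlim (\<lambda>n. real n * \<epsilon> n ^ 3) at_top sequentially"
    and drift: "(\<lambda>n. (real n * p n - 1) / \<epsilon> n) \<longlonglongrightarrow> \<theta>"
begin

definition \<beta> :: "nat \<Rightarrow> real" where "\<beta> n = real n * \<epsilon> n ^ 3"

definition L :: "nat \<Rightarrow> real" where "L n = real n * \<epsilon> n"

text \<open>The drift of the graph on N vertices, tending to \<theta> for N = n. Removing components
  changes N, so the estimates below are uniform over all N whose drift lies in a given
  range.\<close>

definition \<tau> :: "nat \<Rightarrow> nat \<Rightarrow> real" where "\<tau> n N = (p n * real N - 1) / \<epsilon> n"

definition comps_in :: "nat \<Rightarrow> nat \<Rightarrow> real set \<Rightarrow> real" where
  "comps_in n N Y = (\<Sum>k\<in>{k \<in> {1..N}. real k / L n \<in> Y}. expected_comps (p n) N k)"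

definition small_prob :: "nat \<Rightarrow> nat \<Rightarrow> real \<Rightarrow> real" where
  "small_prob n N \<delta> = size_law (p n) N (\<lambda>X. of_bool (\<forall>x\<in>#X. real x < \<delta> * L n))"

lemma beta_ge: "\<forall>\<^sub>F n in sequentially. c \<le> \<beta> n"
  using scale_at_top unfolding \<beta>_def filterlim_at_top by blast

lemma exp_beta_small:
  assumes "0 < c" "0 < \<eta>"
  shows "\<forall>\<^sub>F n in sequentially. exp (- (c * \<beta> n)) \<le> \<eta>"
  using beta_ge[of "- ln \<eta> / c"]
proof eventually_elim
  case (elim n)
  then have "- (c * \<beta> n) \<le> ln \<eta>" using assms by (simp add: field_simps)
  then show ?case using assms by (simp add: ln_ge_iff)
qed

lemma np_tendsto: "(\<lambda>n. real n * p n - 1) \<longlonglongrightarrow> 0"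
proof (rule Lim_transform_eventually)
  show "(\<lambda>n. (real n * p n - 1) / \<epsilon> n * \<epsilon> n) \<longlonglongrightarrow> 0"
    using tendsto_mult[OF drift eps_tendsto] by simp
  show "\<forall>\<^sub>F n in sequentially. (real n * p n - 1) / \<epsilon> n * \<epsilon> n = real n * p n - 1"
    using eps_pos by eventually_elim simp
qed

text \<open>A single parameter r makes every vanishing quantity small and \<open>\<beta>\<close>
  large. The bound p \<le> r \<epsilon> holds since n p is near 1 while n \<epsilon> \<ge> n
  \<epsilon>^3 diverges.\<close>

lemma basic:
  assumes "0 < r"
  shows "\<forall>\<^sub>F n in sequentially. 0 < n \<and> 0 < \<epsilon> n \<and> \<epsilon> n \<le> r \<and> \<bar>real n * p n - 1\<bar> \<le> r \<and> 0 < p n \<and>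
    p n \<le> 1 / 2 \<and> p n \<le> r * \<epsilon> n \<and> 1 / r \<le> \<beta> n \<and> \<beta> n \<le> L n"
proof -
  have "\<forall>\<^sub>F n in sequentially. \<bar>real n * p n - 1\<bar> < min r (1/2)"
    using tendstoD[OF np_tendsto, of "min r (1/2)"] assms by (simp add: dist_real_def)
  moreover have "\<forall>\<^sub>F n in sequentially. \<bar>\<epsilon> n\<bar> < min r 1"
    using tendstoD[OF eps_tendsto, of "min r 1"] assms by (simp add: dist_real_def)
  moreover have "\<forall>\<^sub>F n in sequentially. 4 \<le> n" by (rule eventually_ge_at_top)
  ultimately show ?thesis
    using eps_pos beta_ge[of "2 / r"]
  proof eventually_elim
    case (elim n)
    have np: "1/2 < real n * p n" "real n * p n < 3/2"
      using elim(1) unfolding abs_less_iff min_less_iff_conj by linarith+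
    have p: "0 < p n" using np(1) zero_less_mult_pos[of "real n" "p n"] elim(3) by simp
    have "4 * p n \<le> real n * p n" using elim(3) p by (intro mult_right_mono) auto
    then have ph: "p n \<le> 1/2" using np by simp
    have "\<epsilon> n ^ 3 \<le> \<epsilon> n ^ 1" using elim by (intro power_decreasing) auto
    then have "\<beta> n \<le> L n" unfolding \<beta>_def L_def by (intro mult_left_mono) auto
    moreover have "p n \<le> r * \<epsilon> n"
    proof -
      have "2 / r \<le> real n * \<epsilon> n" using elim(5) \<open>\<beta> n \<le> L n\<close> by (simp add: L_def)
      then have "2 \<le> real n * (r * \<epsilon> n)" using assms by (simp add: field_simps)
      with np have "real n * p n \<le> real n * (r * \<epsilon> n)" by linarith
      then show ?thesis using elim(3) by (simp add: mult_le_cancel_left)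
    qed
    moreover have "1 / r \<le> \<beta> n" using elim(5) divide_right_mono[of 1 2 r] assms by simp
    ultimately show ?case using elim p ph by auto
  qed
qed

lemma L_pos: "\<forall>\<^sub>F n in sequentially. 0 < L n"
  using basic[OF zero_less_one] by eventually_elim (auto simp: L_def)

lemma comps_in_mono:
  assumes "0 \<le> p n" "p n \<le> 1" "\<And>k. 1 \<le> k \<Longrightarrow> k \<le> N \<Longrightarrow> real k / L n \<in> Y \<Longrightarrow> real k / L n \<in> Z"
  shows "comps_in n N Y \<le> comps_in n N Z"
  unfolding comps_in_def using assms by (intro sum_mono2 expected_comps_nonneg) auto

lemma comps_in_Un:
  assumes "0 \<le> p n" "p n \<le> 1"
  shows "comps_in n N (Y \<union> Z) \<le> comps_in n N Y + comps_in n N Z"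
proof -
  have "{k \<in> {1..N}. real k / L n \<in> Y \<union> Z} = {k \<in> {1..N}. real k / L n \<in> Y} \<union> {k \<in> {1..N}. real k / L n \<in> Z}"
    by auto
  moreover have "sum (expected_comps (p n) N) (A \<union> B)
      \<le> sum (expected_comps (p n) N) A + sum (expected_comps (p n) N) B" if "finite A" "finite B" for A B
    using sum.union_inter[OF that, of "expected_comps (p n) N"]
      sum_nonneg[of "A \<inter> B" "expected_comps (p n) N"] expected_comps_nonneg[OF assms] by simp
  ultimately show ?thesis unfolding comps_in_def by simp
qed

lemma comps_in_UN:
  assumes "0 \<le> p n" "p n \<le> 1" "finite F"
  shows "comps_in n N (\<Union>y\<in>F. Y y) \<le> (\<Sum>y\<in>F. comps_in n N (Y y))"
  using assms(3)
proof (induction F rule: finite_induct)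
  case (insert y F)
  then show ?case using comps_in_Un[OF assms(1,2), of N "Y y" "\<Union>y\<in>F. Y y"] by simp
qed (simp add: comps_in_def)

lemma sum_expected_comps_le_comps_in:
  assumes "0 \<le> p n" "p n \<le> 1"
  shows "(\<Sum>k\<in>{k \<in> {1..M}. real k / L n \<in> Y}. expected_comps (p n) N k) \<le> comps_in n N Y"
proof -
  have "(\<Sum>k\<in>{k \<in> {1..M}. real k / L n \<in> Y}. expected_comps (p n) N k)
      = (\<Sum>k\<in>{k \<in> {1..M}. real k / L n \<in> Y} \<inter> {1..N}. expected_comps (p n) N k)"
    by (rule sum.mono_neutral_right) (auto simp: expected_comps_def)
  also have "\<dots> \<le> comps_in n N Y"
    unfolding comps_in_def using assms by (intro sum_mono2 expected_comps_nonneg) auto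
  finally show ?thesis .
qed

text \<open>Markov's inequality: if not all components are small, at least one is counted among the
  large ones.\<close>

lemma small_prob_plus_comps_in:
  assumes "0 \<le> p n" "p n \<le> 1" "0 < L n"
  shows "1 \<le> small_prob n N \<delta> + comps_in n N {\<delta>..}"
proof -
  let ?S = "\<lambda>X. of_bool (\<forall>x\<in>#X. real x < \<delta> * L n) :: real"
  let ?T = "\<lambda>X. \<Sum>x\<in>#X. of_bool (\<delta> \<le> real x / L n) :: real"
  have le: "1 \<le> ?S X + ?T X" for X
  proof (cases "\<forall>x\<in>#X. real x < \<delta> * L n")
    case True
    have "0 \<le> ?T X" by (rule sum_mset_of_bool_nonneg)
    with True show ?thesis by simp
  next
    case False
    then obtain x where x: "x \<in># X" "\<delta> * L n \<le> real x" by auto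
    then obtain X' where X': "X = add_mset x X'" using multi_member_split by metis
    have "0 \<le> ?T X'" by (rule sum_mset_of_bool_nonneg)
    with x assms show ?thesis by (simp add: X' field_simps)
  qed
  have "1 = size_law (p n) N (\<lambda>_. 1)" by (simp only: size_law_total)
  also have "\<dots> \<le> size_law (p n) N (\<lambda>X. ?S X + ?T X)"
    by (rule size_law_mono[OF assms(1,2) le])
  also have "\<dots> = small_prob n N \<delta> + size_law (p n) N ?T"
    by (simp only: size_law_add small_prob_def)
  also have "size_law (p n) N ?T = (\<Sum>k\<in>{1..N}. expected_comps (p n) N k * size_law (p n) (N - k) (\<lambda>_. of_bool (\<delta> \<le> real k / L n) * 1))"
    using size_law_sum_comps[of "p n" N "\<lambda>x _. of_bool (\<delta> \<le> real x / L n)"] by simp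
  also have "\<dots> = (\<Sum>k\<in>{1..N}. expected_comps (p n) N k * of_bool (\<delta> \<le> real k / L n))"
    by (simp only: size_law_cmult size_law_total) simp
  also have "\<dots> = comps_in n N {\<delta>..}"
    unfolding comps_in_def by (intro sum.mono_neutral_cong_right) auto
  finally show ?thesis .
qed

section \<open>Expected numbers of components, uniformly over drifts\<close>

text \<open>The factor N / T, of order 1 / (u \<epsilon>), cancels the survival probability of order
  \<epsilon>.\<close>

lemma expected_comps_bounded:
  assumes u: "0 < u"
  shows "\<exists>C>0. \<forall>\<^sub>F n in sequentially. \<forall>N. \<tau> n N \<le> A \<longrightarrow> comps_in n N {u..} \<le> C"
proof -
  \<comment> \<open>The survival estimate is used at z = 1 - a \<epsilon>. To second order its
    hypothesis asks that 1 + A a plus errors is at most a^2 / 2, and this choice gives a^2 / 2 =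
    \<bar>A\<bar> a + 2 a.\<close>
  define a where "a = 2 * \<bar>A\<bar> + 4"
  define r where "r = min (1 / (4 * a ^ 3)) (min u (1/2))"
  have a: "4 \<le> a" "\<bar>A\<bar> \<le> a" by (auto simp: a_def)
  have r: "0 < r" using a u by (simp add: r_def)
  have "\<forall>\<^sub>F n in sequentially. \<forall>N. \<tau> n N \<le> A \<longrightarrow> comps_in n N {u..} \<le> 8 * a / u"
    using basic[OF r]
  proof eventually_elim
    case (elim n)
    define e where "e = \<epsilon> n"
    define P where "P = p n"
    have e: "0 < e" "e \<le> r" and P: "0 < P" "P \<le> 1/2" "P \<le> r * e" and nP: "\<bar>real n * P - 1\<bar> \<le> r"
      and \<beta>: "1 / r \<le> \<beta> n" and n: "0 < n"
      using elim by (auto simp: e_def P_def)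
    have ra: "r * (4 * a ^ 3) \<le> 1" "r \<le> u" "r \<le> 1/2"
    proof -
      have "r \<le> 1 / (4 * a ^ 3)" "r \<le> u" "r \<le> 1/2" by (auto simp: r_def)
      then show "r * (4 * a ^ 3) \<le> 1" "r \<le> u" "r \<le> 1/2" using a by (auto simp: field_simps)
    qed
    have ea: "e * (4 * a ^ 3) \<le> 1"
    proof -
      have "0 \<le> 4 * a ^ 3" using a by simp
      from mult_right_mono[OF e(2) this] ra show ?thesis by linarith
    qed
    have a3: "16 * (4 * a) \<le> 4 * a ^ 3" "4 * (4 * a\<^sup>2) \<le> 4 * a ^ 3"
      using mult_mono[of 4 a 4 a] a
      by (auto simp: power3_eq_cube power2_eq_square mult_right_mono)
    have ea1: "e * (64 * a) \<le> 1"
    proof -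
      have "e * (64 * a) \<le> e * (4 * a ^ 3)" using a3 e by (intro mult_left_mono) auto
      with ea show ?thesis by linarith
    qed
    have Pe: "P \<le> e"
    proof -
      have "r * e \<le> 1 * e" using ra e by (intro mult_right_mono) auto
      with P show ?thesis by simp
    qed
    have Pa: "P * (16 * a\<^sup>2) \<le> 1"
    proof -
      have "P * (16 * a\<^sup>2) \<le> e * (4 * a ^ 3)" by (rule mult_mono) (use a3 e Pe P in auto)
      with ea show ?thesis by linarith
    qed
    have ae: "a * e \<le> 1/64" using ea1 by (simp add: mult_ac)
    have Aea: "\<bar>A * e\<bar> \<le> 1"
    proof -
      have "\<bar>A * e\<bar> \<le> a * e" using a e by (simp add: abs_mult mult_right_mono)
      then show ?thesis using ae by linarith
    qed
    show ?case
    proof (intro allI impI)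
      fix N assume "\<tau> n N \<le> A"
      then have NP: "P * real N \<le> 1 + A * e" using e by (simp add: \<tau>_def P_def e_def field_simps)
      then have NP2: "P * real N \<le> 2" and Ae0: "0 \<le> 1 + A * e" using Aea by linarith+
      define T where "T = nat \<lceil>u * L n\<rceil>"
      have uL: "0 < u * L n" using u n e by (simp add: L_def e_def)
      have T: "u * L n \<le> real T" "0 < T" using uL by (auto simp: T_def)
      \<comment> \<open>A discount of the same order \<epsilon>^2 as the quadratic terms of the
        survival condition. Over the T steps, at least u n \<epsilon>, it accumulates to at most exp
        (- u \<beta>), hence to at most 1/2.\<close>
      define \<rho> where "\<rho> = exp (- (e\<^sup>2))"
      have cond: "1 - a * e \<le> \<rho> * (1 - P * (1 - (1 - a * e))) ^ N"
      proof -
        define x where "x = a * e"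
        have x: "0 \<le> x" "x \<le> 1/2" using a e ae by (auto simp: x_def)
        have Px: "0 \<le> P * x" "P * x \<le> 1/2" using P x mult_mono[of P 1 x "1/2"] by auto
        have l1: "ln (1 - x) \<le> - x - x\<^sup>2 / 2 + x ^ 3"
          using ln_one_plus_taylor2[of "-x"] x by (simp add: abs_le_iff)
        have l2: "- (P * x) - 2 * (P * x)\<^sup>2 \<le> ln (1 - P * x)"
          using abs_ln_one_plus_x_minus_x_bound[of "- (P * x)"] Px by (simp add: abs_le_iff)
        have "real N * (P * x + 2 * (P * x)\<^sup>2) = (P * real N) * x + 2 * (P * real N) * (P * x\<^sup>2)"
          by (simp add: power2_eq_square algebra_simps)
        also have "\<dots> \<le> (1 + A * e) * x + 2 * 2 * (P * x\<^sup>2)"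
          using NP NP2 Ae0 x P by (intro add_mono mult_mono) auto
        finally have l3: "real N * (P * x + 2 * (P * x)\<^sup>2) \<le> (1 + A * e) * x + 4 * (P * x\<^sup>2)" by simp
        have "1 + A * a + 4 * (P * a\<^sup>2) + e * a ^ 3 \<le> a\<^sup>2 / 2"
        proof -
          have "A * a \<le> \<bar>A\<bar> * a" using a by (intro mult_right_mono) auto
          moreover have "a\<^sup>2 / 2 = \<bar>A\<bar> * a + 2 * a" by (simp add: a_def power2_eq_square algebra_simps)
          moreover have "P * a\<^sup>2 \<le> 1/16" "e * a ^ 3 \<le> 1/4" using Pa ea by simp_all
          ultimately show ?thesis using a by linarith
        qed
        from mult_right_mono[OF this, of "e\<^sup>2"]
        have "e\<^sup>2 + A * e * x + 4 * (P * x\<^sup>2) + x ^ 3 \<le> x\<^sup>2 / 2"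
          by (simp add: x_def power2_eq_square power3_eq_cube algebra_simps)
        then have "ln (1 - x) \<le> - e\<^sup>2 + real N * (- (P * x) - 2 * (P * x)\<^sup>2)"
          using l1 l3 by (simp add: algebra_simps)
        also have "\<dots> \<le> - e\<^sup>2 + real N * ln (1 - P * x)"
          using l2 by (intro add_left_mono mult_left_mono) auto
        finally have *: "ln (1 - x) \<le> - e\<^sup>2 + real N * ln (1 - P * x)" .
        have "1 - x = exp (ln (1 - x))" using x by simp
        also have "\<dots> \<le> exp (- e\<^sup>2 + real N * ln (1 - P * x))" using * by (subst exp_le_cancel_iff)
        also have "\<dots> = \<rho> * (1 - P * x) ^ N" using Px by (simp only: exp_add exp_of_nat_mult \<rho>_def) simp
        finally show ?thesis by (simp add: x_def)
      qed
      have \<rho>: "0 \<le> \<rho>" "\<rho> < 1" using e by (auto simp: \<rho>_def)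
      have "\<rho> ^ T = exp (- (e\<^sup>2 * real T))"
        by (simp add: \<rho>_def exp_of_nat_mult[symmetric] mult.commute)
      also have "\<dots> \<le> exp (- (e\<^sup>2 * (u * L n)))" using T e by (simp add: mult_left_mono)
      also have "e\<^sup>2 * (u * L n) = u * \<beta> n"
        by (simp add: L_def \<beta>_def e_def power2_eq_square power3_eq_cube)
      also have "exp (- (u * \<beta> n)) \<le> exp (- 1)"
      proof -
        have "1 \<le> r * \<beta> n" using \<beta> r by (simp add: field_simps)
        also have "\<dots> \<le> u * \<beta> n"
          using ra e by (intro mult_right_mono) (auto simp: \<beta>_def e_def)
        finally show ?thesis by simp
      qed
      also have "exp (- 1) \<le> (1/2 :: real)"
        using exp_ge_add_one_self[of "1::real"] by (simp add: exp_minus field_simps)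
      finally have \<rho>T: "\<rho> ^ T \<le> 1/2" .
      have "comps_in n N {u..} \<le> (\<Sum>k\<in>{T..N}. expected_comps P N k)"
        unfolding comps_in_def P_def[symmetric]
      proof (intro sum_mono2 expected_comps_nonneg)
        have "0 < L n" using n e by (simp add: L_def e_def)
        then have "T \<le> k" if "u \<le> real k / L n" for k
          using that by (simp add: T_def field_simps ceiling_le_iff)
        then show "{k \<in> {1..N}. real k / L n \<in> {u..}} \<subseteq> {T..N}" by auto
      qed (use P in auto)
      also have "\<dots> \<le> real N / real T * ((1 - (1 - a * e)) / (1 - \<rho> ^ T))"
        using P a e ae by (intro expected_large_comps_bound cond \<rho> T) auto
      also have "\<dots> \<le> (4 * real n / (u * L n)) * (a * e / (1/2))"
      proof (intro mult_mono frac_le)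
        have "real n * P \<ge> 1/2" using nP ra by (simp add: abs_le_iff)
        then have "2 \<le> P * (4 * real n)" by (simp add: mult.commute)
        with NP2 have "P * real N \<le> P * (4 * real n)" by linarith
        then show "real N \<le> 4 * real n" using P by simp
      qed (use \<rho>T T uL a e in auto)
      also have "\<dots> = 8 * a / u" using n e u by (simp add: L_def e_def field_simps)
      finally show "comps_in n N {u..} \<le> 8 * a / u" .
    qed
  qed
  moreover have "0 < 8 * a / u" using a u by simp
  ultimately show ?thesis by blast
qed

text \<open>The Taylor comparison in scaled units. By \<open>rate_diff\<close> the main exponent is
  \<beta> times a difference of rates, and all errors are \<beta> times a multiple of r.\<close>

lemma transfer:
  assumes A: "0 < A" and \<eta>: "0 < \<eta>"
  shows "\<forall>\<^sub>F n in sequentially. \<forall>N N0 k. 1 \<le> k \<longrightarrow> \<bar>\<tau> n N\<bar> \<le> A \<longrightarrow> \<bar>\<tau> n N0\<bar> \<le> A \<longrightarrow> real k / L n \<le> A \<longrightarrow>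
    expected_comps (p n) N k \<le> expected_comps (p n) N0 k *
      exp (\<beta> n * (rate (\<tau> n N0) (real k / L n) - rate (\<tau> n N) (real k / L n) + \<eta>))"
proof -
  \<comment> \<open>The coefficients of the three errors: from replacing p (k - 1) / \<epsilon> by
    y, from ln (1 - p), and from the cubic remainders.\<close>
  define c where "c = A\<^sup>2 * (A + 1) + 8 * A\<^sup>2 + 54 * A ^ 4"
  define r where "r = min (1/2) (min (\<eta> / c) (1 / (6 * A)))"
  have c: "0 < c" using A by (auto simp: c_def intro!: add_pos_pos)
  have r: "0 < r" "r \<le> 1/2" "r * c \<le> \<eta>" "r * (6 * A) \<le> 1"
  proof -
    show "r \<le> 1/2" unfolding r_def by (rule min.cobounded1)
    have "r \<le> \<eta> / c" "r \<le> 1 / (6 * A)" by (auto simp: r_def)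
    then show "r * c \<le> \<eta>" "r * (6 * A) \<le> 1" using A c by (auto simp: field_simps)
  qed (use A \<eta> c in \<open>auto simp: r_def\<close>)
  show ?thesis using basic[OF r(1)]
  proof eventually_elim
    case (elim n)
    define e where "e = \<epsilon> n"
    define P where "P = p n"
    have e: "0 < e" "e \<le> r" and P: "0 < P" "P \<le> 1/2" "P \<le> r * e" and nP: "\<bar>real n * P - 1\<bar> \<le> r"
      and \<beta>: "1 / r \<le> \<beta> n" and n: "0 < n"
      using elim by (auto simp: e_def P_def)
    have L: "0 < L n" using n e by (simp add: L_def e_def)
    have \<beta>0: "0 < \<beta> n" using n e by (simp add: \<beta>_def e_def)
    have eA: "e * (6 * A) \<le> 1" using mult_right_mono[OF e(2), of "6 * A"] A r by linarith
    show ?case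
    proof (intro allI impI)
      fix N N0 k
      assume k1: "1 \<le> k" and tN: "\<bar>\<tau> n N\<bar> \<le> A" "\<bar>\<tau> n N0\<bar> \<le> A" and kA: "real k / L n \<le> A"
      define y where "y = real k / L n"
      define t where "t = \<tau> n N"
      define t0 where "t0 = \<tau> n N0"
      have y: "0 \<le> y" "y \<le> A" "real k = y * L n" using kA L by (auto simp: y_def)
      have pk: "P * real k \<le> 2 * A * e"
      proof -
        have "P * real k = (real n * P) * y * e" by (simp add: y(3) L_def e_def)
        also have "\<dots> \<le> 2 * A * e" using nP r y e P by (intro mult_mono) (auto simp: abs_le_iff)
        finally show ?thesis .
      qed
      have PN: "P * real N = 1 + e * t" "P * real N0 = 1 + e * t0"
        using e by (auto simp: t_def t0_def \<tau>_def P_def e_def)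
      have small: "P * real k \<le> 1/3"
      proof -
        have "2 * A * e \<le> 1/3" using eA by (simp add: mult_ac)
        with pk show ?thesis by linarith
      qed
      have et: "\<bar>e * t'\<bar> \<le> 1/6" if "\<bar>t'\<bar> \<le> A" for t'
      proof -
        have "\<bar>e * t'\<bar> \<le> e * A" using that e by (simp add: abs_mult mult_left_mono)
        moreover have "e * A \<le> 1/6" using eA by simp
        ultimately show ?thesis by linarith
      qed
      have kN: "k \<le> N" "k \<le> N0"
      proof -
        have "P * real k \<le> P * real N" "P * real k \<le> P * real N0"
          using et[OF tN(1)] et[OF tN(2)] small PN unfolding t_def t0_def by linarith+
        then show "k \<le> N" "k \<le> N0" using P by auto
      qed
      have "expected_comps P N k \<le> expected_comps P N0 k *
          exp (real k * e\<^sup>2 * (t - t0) / 2 * (P * (real k - 1) / e - t - t0)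
          + 4 * A * real k * e * P + 2 * real k * (e * (A + 2 * A)) ^ 3)"
        using tN eA by (intro expected_comps_transfer P e kN PN pk) (auto simp: t_def t0_def)
      also have "\<dots> \<le> expected_comps P N0 k * exp (\<beta> n * (rate t0 y - rate t y + \<eta>))"
      proof -
        define D where "D = (real n * P - 1) * y - P / e"
        have Pe: "P / e \<le> r" using P e by (simp add: field_simps)
        have "\<bar>D\<bar> \<le> \<bar>(real n * P - 1) * y\<bar> + \<bar>P / e\<bar>" unfolding D_def by (rule abs_triangle_ineq4)
        also have "\<dots> \<le> r * A + r"
        proof (intro add_mono)
          show "\<bar>(real n * P - 1) * y\<bar> \<le> r * A"
            unfolding abs_mult using nP y by (intro mult_mono) auto
          show "\<bar>P / e\<bar> \<le> r" using Pe P e by simp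
        qed
        finally have D: "\<bar>D\<bar> \<le> r * (A + 1)" by (simp add: algebra_simps)
        have tt: "\<bar>t - t0\<bar> \<le> 2 * A" using tN unfolding t_def t0_def by linarith
        have "real k * e\<^sup>2 * (t - t0) / 2 * (P * (real k - 1) / e - t - t0)
            = \<beta> n * (y * (t - t0) / 2 * (y - t - t0)) + \<beta> n * (y * (t - t0) / 2 * D)"
          using e by (simp add: y(3) L_def \<beta>_def e_def[symmetric] D_def power2_eq_square power3_eq_cube field_simps)
        moreover have "\<beta> n * (y * (t - t0) / 2 * D) \<le> \<beta> n * (A\<^sup>2 * (A + 1) * r)"
        proof (intro mult_left_mono)
          have "y * (t - t0) / 2 * D \<le> \<bar>y * (t - t0) / 2 * D\<bar>" by simp
          also have "\<dots> = y * (\<bar>t - t0\<bar> / 2) * \<bar>D\<bar>" using y by (simp add: abs_mult)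
          also have "\<dots> \<le> A * A * (r * (A + 1))" using y tt D A by (intro mult_mono) auto
          finally show "y * (t - t0) / 2 * D \<le> A\<^sup>2 * (A + 1) * r" by (simp add: power2_eq_square mult_ac)
        qed (use \<beta>0 in simp)
        moreover have "4 * A * real k * e * P \<le> \<beta> n * (8 * A\<^sup>2 * r)"
        proof -
          have "4 * A * real k * e * P = 4 * A * (y * (real n * P)) * e\<^sup>2"
            by (simp add: y(3) L_def e_def power2_eq_square)
          also have "\<dots> \<le> 4 * A * (A * 2) * r\<^sup>2"
            using y nP r A e P by (intro mult_mono power_mono) (auto simp: abs_le_iff)
          also have "\<dots> \<le> 4 * A * (A * 2) * (r * (r * \<beta> n))"
          proof (intro mult_left_mono)
            have "1 \<le> 1 / r" using r by simp
            then have "1 \<le> \<beta> n" using \<beta> by linarith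
            then show "r\<^sup>2 \<le> r * (r * \<beta> n)" using r by (simp add: power2_eq_square)
          qed (use A in auto)
          also have "\<dots> \<le> 4 * A * (A * 2) * (r * (1 * \<beta> n))"
            using A r \<beta>0 by (intro mult_left_mono mult_right_mono) auto
          finally show ?thesis by (simp add: power2_eq_square mult_ac)
        qed
        moreover have "2 * real k * (e * (A + 2 * A)) ^ 3 \<le> \<beta> n * (54 * A ^ 4 * r)"
        proof -
          have "2 * real k * (e * (A + 2 * A)) ^ 3 = \<beta> n * (54 * (A ^ 3 * y * e))"
            by (simp add: y(3) L_def \<beta>_def e_def power3_eq_cube)
          also have "\<dots> \<le> \<beta> n * (54 * (A ^ 3 * A * r))"
            using A y e \<beta>0 by (intro mult_left_mono mult_mono) auto
          finally show ?thesis by (simp add: power4_eq_xxxx power3_eq_cube mult_ac)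
        qed
        moreover have "\<beta> n * (A\<^sup>2 * (A + 1) * r) + \<beta> n * (8 * A\<^sup>2 * r) + \<beta> n * (54 * A ^ 4 * r) \<le> \<beta> n * \<eta>"
          using mult_left_mono[OF r(3), of "\<beta> n"] \<beta>0 by (simp add: c_def algebra_simps)
        ultimately have "real k * e\<^sup>2 * (t - t0) / 2 * (P * (real k - 1) / e - t - t0)
          + 4 * A * real k * e * P + 2 * real k * (e * (A + 2 * A)) ^ 3
          \<le> \<beta> n * (y * (t - t0) / 2 * (y - t - t0)) + \<beta> n * \<eta>"
          by linarith
        also have "\<dots> = \<beta> n * (rate t0 y - rate t y + \<eta>)"
          by (simp add: rate_diff algebra_simps)
        finally show ?thesis
          using P by (intro mult_left_mono expected_comps_nonneg) auto
      qed
      finally show "expected_comps (p n) N k \<le> expected_comps (p n) N0 k *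
        exp (\<beta> n * (rate (\<tau> n N0) (real k / L n) - rate (\<tau> n N) (real k / L n) + \<eta>))"
        by (simp add: P_def t_def t0_def y_def)
    qed
  qed
qed

text \<open>One more vertex raises the drift by p / \<epsilon>, eventually at most r, so rounding to
  an integer N costs no more than that.\<close>

lemma vertex_count_for:
  assumes "0 < r"
  shows "\<forall>\<^sub>F n in sequentially. \<exists>N. \<bar>\<tau> n N - t\<bar> \<le> r"
proof -
  define r' where "r' = min r (1 / (\<bar>t\<bar> + 1))"
  have r': "0 < r'" using assms by (simp add: r'_def)
  show ?thesis using basic[OF r']
  proof eventually_elim
    case (elim n)
    define e where "e = \<epsilon> n"
    define P where "P = p n"
    have e: "0 < e" "e \<le> 1 / (\<bar>t\<bar> + 1)" and P: "0 < P" "P \<le> r' * e"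
      using elim by (auto simp: e_def P_def r'_def)
    have "r' * e \<le> r * e" using e by (intro mult_right_mono) (auto simp: r'_def)
    with P have P: "0 < P" "P \<le> r * e" by auto
    have "e * (\<bar>t\<bar> + 1) \<le> 1" using e(2) by (simp add: pos_le_divide_eq)
    moreover have "e * (\<bar>t\<bar> + 1) = e * \<bar>t\<bar> + e" by (simp add: algebra_simps)
    moreover have "e * (- t) \<le> e * \<bar>t\<bar>" using e(1) by (intro mult_left_mono) auto
    ultimately have "0 \<le> 1 + e * t" using e(1) unfolding mult_minus_right by linarith
    then have x: "0 \<le> (1 + e * t) / P" using P by simp
    define N where "N = nat \<lfloor>(1 + e * t) / P\<rfloor>"
    have "real N = of_int \<lfloor>(1 + e * t) / P\<rfloor>" using x by (simp add: N_def)
    then have N: "real N \<le> (1 + e * t) / P" "(1 + e * t) / P - 1 \<le> real N" by linarith+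
    have "P * real N \<le> 1 + e * t" using N(1) P by (simp add: pos_le_divide_eq mult.commute)
    then have 1: "\<tau> n N \<le> t" using e by (simp add: \<tau>_def P_def e_def field_simps)
    have "1 + e * t - P \<le> P * real N"
      using mult_left_mono[OF N(2), of P] P by (simp add: right_diff_distrib)
    then have "e * (t - r) \<le> P * real N - 1" using P by (simp add: algebra_simps)
    then have "t - r \<le> \<tau> n N" using e by (simp add: \<tau>_def P_def e_def field_simps)
    with 1 show ?case by (intro exI[of _ N]) auto
  qed
qed

text \<open>The Taylor comparison is limited to sizes below a fixed multiple of \<open>L n\<close>.
  Here about \<epsilon> / p vertices are added, raising the drift by about 1; the expected number
  for the larger graph is still bounded, and the quadratic term in k supplies any desired
  exponential rate.\<close>

lemma tail_upper:
  assumes a: "0 < a"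
  shows "\<exists>M>0. \<forall>\<^sub>F n in sequentially. \<forall>N. \<tau> n N \<le> t \<longrightarrow> comps_in n N {M..} \<le> exp (- (a * \<beta> n))"
proof -
  \<comment> \<open>\<open>s\<close> bounds the drift after the addition. With the \<open>M\<close>
    below, e * s + e - M * e / 16 = - 2 * a * e, which gives twice the required rate; the surplus
    absorbs the constant \<open>C\<close>.\<close>
  define s where "s = \<bar>t\<bar> + 2"
  define M where "M = 16 * (s + 1 + 2 * a)"
  define r where "r = 1 / (4 * s)"
  have s: "2 \<le> s" by (simp add: s_def)
  have M: "48 \<le> M" using s a by (simp add: M_def)
  have r: "0 < r" "r \<le> 1/8" "r * s \<le> 1/4" using s by (auto simp: r_def field_simps)
  obtain C where C: "0 < C" "\<forall>\<^sub>F n in sequentially. \<forall>N. \<tau> n N \<le> s \<longrightarrow> comps_in n N {M..} \<le> C"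
    using expected_comps_bounded[of M s] M by auto
  have "\<forall>\<^sub>F n in sequentially. exp (- (a * \<beta> n)) \<le> 1 / C"
    using exp_beta_small[of a "1 / C"] a C by simp
  with basic[OF r(1)] C(2) have "\<forall>\<^sub>F n in sequentially. \<forall>N. \<tau> n N \<le> t \<longrightarrow> comps_in n N {M..} \<le> exp (- (a * \<beta> n))"
  proof eventually_elim
    case (elim n)
    define e where "e = \<epsilon> n"
    define P where "P = p n"
    have e: "0 < e" "e \<le> r" and P: "0 < P" "P \<le> 1/2" "P \<le> r * e" and nP: "\<bar>real n * P - 1\<bar> \<le> r"
      and \<beta>: "1 / r \<le> \<beta> n" "\<beta> n \<le> L n" and n: "0 < n"
      using elim by (auto simp: e_def P_def)
    have L: "0 < L n" using n e by (simp add: L_def e_def)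
    have es: "e * s \<le> 1/4" using mult_right_mono[OF e(2), of s] r s by linarith
    have P8: "8 * P \<le> e"
    proof -
      have "r * e \<le> 1/8 * e" using r e by (intro mult_right_mono) auto
      with P show ?thesis by linarith
    qed
    have \<beta>2: "2 \<le> \<beta> n"
    proof -
      have "2 \<le> 1 / r" using r by (simp add: field_simps)
      with \<beta> show ?thesis by linarith
    qed
    define d where "d = nat \<lceil>e / P\<rceil>"
    have d: "e / P \<le> real d" "real d \<le> e / P + 1"
      using e P by (auto simp: d_def intro: order.trans[OF _ less_imp_le])
    have Pd: "P * real d \<le> e + P" using mult_left_mono[OF d(2), of P] P by (simp add: distrib_left)
    show ?case
    proof (intro allI impI)
      fix N assume tN: "\<tau> n N \<le> t"
      define M0 where "M0 = real (N + d)"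
      have PN: "P * real N \<le> 1 + e * t"
        using tN e by (simp add: \<tau>_def P_def e_def field_simps)
      have "e * t \<le> e * \<bar>t\<bar>" using e by (intro mult_left_mono) auto
      then have PM: "P * M0 \<le> 1 + e * s"
      proof -
        have "P * M0 = P * real N + P * real d" "e * s = e * \<bar>t\<bar> + 2 * e"
          by (auto simp: M0_def s_def distrib_left)
        with \<open>e * t \<le> e * \<bar>t\<bar>\<close> PN Pd P8 P show ?thesis by linarith
      qed
      then have PM2: "P * M0 \<le> 2" using es by linarith
      have "\<tau> n (N + d) \<le> s"
        using PM e by (simp add: \<tau>_def M0_def P_def e_def field_simps)
      with elim(2) have Cb: "comps_in n (N + d) {M..} \<le> C" by blast
      have "0 < e / P" using e P by simp
      with d(1) have "0 < real d" by linarith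
      then have M0: "0 < M0" by (simp add: M0_def)
      have M0n: "M0 \<le> 4 * real n"
      proof -
        have "real n * P \<ge> 1/2" using nP r by (simp add: abs_le_iff)
        then have "2 \<le> P * (4 * real n)" by (simp add: mult.commute)
        with PM2 have "P * M0 \<le> P * (4 * real n)" by linarith
        then show ?thesis using P by simp
      qed
      have term_le: "expected_comps P N k \<le> expected_comps P (N + d) k * exp (- (2 * a * \<beta> n))"
        if k: "1 \<le> k" "k \<le> N" "M \<le> real k / L n" for k
      proof -
        have kM: "M * L n \<le> real k" using k L by (simp add: field_simps)
        have "2 * 1 \<le> L n * M" using \<beta>2 \<beta> M by (intro mult_mono) auto
        then have k2: "2 \<le> real k" using kM by (simp add: mult.commute)
        have b1: "M * e / 16 \<le> (real k - 1) / (2 * M0)"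
        proof -
          have "M * e / 16 = (M * L n / 2) / (2 * (4 * real n))" using n by (simp add: L_def e_def)
          also have "\<dots> \<le> (real k - 1) / (2 * M0)"
            using kM k2 M0 M0n M L by (intro frac_le) auto
          finally show ?thesis .
        qed
        have b2: "P + 2 * P\<^sup>2 - 1 / M0 - (real k - 1) / (2 * M0\<^sup>2)
            = 1 / M0 * ((P * M0 - 1) + 2 * P * (P * M0) - (real k - 1) / (2 * M0))"
          using M0 by (simp add: field_simps power2_eq_square)
        have "2 * P * (P * M0) \<le> 2 * P * 2" using PM2 P by (intro mult_left_mono) auto
        then have "(P * M0 - 1) + 2 * P * (P * M0) - (real k - 1) / (2 * M0) \<le> e * s + e - M * e / 16"
          using PM b1 P8 P by linarith
        also have "\<dots> = - (2 * a * e)" by (simp add: M_def algebra_simps)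
        finally have b3: "(P * M0 - 1) + 2 * P * (P * M0) - (real k - 1) / (2 * M0) \<le> - (2 * a * e)" .
        have b4: "real n * e\<^sup>2 \<le> real k * real d / M0"
        proof -
          have "real n * e\<^sup>2 * 1 \<le> real n * e\<^sup>2 * (M / 2)" using M by (intro mult_left_mono) auto
          then have "real n * e\<^sup>2 \<le> real n * e\<^sup>2 * (M / 2)" by simp
          also have "\<dots> = (M * L n) * (e / P) / (2 / P)"
            using P by (simp add: L_def e_def power2_eq_square)
          also have "\<dots> \<le> real k * real d / M0"
            using kM d M0 PM2 P e M L by (intro frac_le mult_mono) (auto simp: field_simps)
          finally show ?thesis .
        qed
        have "real k * real d * (P + 2 * P\<^sup>2 - 1 / M0 - (real k - 1) / (2 * M0\<^sup>2))
            = real k * real d / M0 * ((P * M0 - 1) + 2 * P * (P * M0) - (real k - 1) / (2 * M0))"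
          unfolding b2 by simp
        also have "\<dots> \<le> real k * real d / M0 * (- (2 * a * e))"
          using b3 M0 by (intro mult_left_mono) auto
        also have "\<dots> \<le> - (2 * a * \<beta> n)"
        proof -
          have "real n * e\<^sup>2 * (2 * a * e) \<le> real k * real d / M0 * (2 * a * e)"
            using b4 a e by (intro mult_right_mono) auto
          then show ?thesis by (simp add: \<beta>_def e_def power2_eq_square power3_eq_cube mult_ac)
        qed
        finally have ex: "exp (real k * real d * (P + 2 * P\<^sup>2 - 1 / M0 - (real k - 1) / (2 * M0\<^sup>2)))
            \<le> exp (- (2 * a * \<beta> n))" by simp
        have "expected_comps P N k \<le> expected_comps P (N + d) k *
          exp (real k * real d * (P + 2 * P\<^sup>2 - 1 / M0 - (real k - 1) / (2 * M0\<^sup>2)))"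
          unfolding M0_def by (rule expected_comps_add_bound[OF P(1,2) k(1,2)])
        also have "\<dots> \<le> expected_comps P (N + d) k * exp (- (2 * a * \<beta> n))"
          using ex P by (intro mult_left_mono expected_comps_nonneg) auto
        finally show ?thesis .
      qed
      have "comps_in n N {M..} \<le> (\<Sum>k\<in>{k \<in> {1..N}. real k / L n \<in> {M..}}.
          expected_comps (p n) (N + d) k * exp (- (2 * a * \<beta> n)))"
        unfolding comps_in_def using term_le by (intro sum_mono) (auto simp: P_def)
      also have "\<dots> = exp (- (2 * a * \<beta> n)) * (\<Sum>k\<in>{k \<in> {1..N}. real k / L n \<in> {M..}}. expected_comps (p n) (N + d) k)"
        by (simp add: sum_distrib_left mult.commute)
      also have "\<dots> \<le> exp (- (2 * a * \<beta> n)) * C"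
        using order.trans[OF sum_expected_comps_le_comps_in Cb] P by (intro mult_left_mono) (auto simp: P_def)
      also have "\<dots> = exp (- (a * \<beta> n)) * (exp (- (a * \<beta> n)) * C)"
        by (simp add: exp_add[symmetric] flip: mult.assoc)
      also have "\<dots> \<le> exp (- (a * \<beta> n)) * 1"
        using elim(3) C(1) by (intro mult_left_mono) (auto simp: field_simps)
      finally show "comps_in n N {M..} \<le> exp (- (a * \<beta> n))" by simp
    qed
  qed
  with M show ?thesis by (intro exI[of _ M]) auto
qed

text \<open>At drift u / 2 the size u has rate 0 and the expected number is bounded, so the transfer
  from there contributes exactly the rate at drift t.\<close>

lemma window_upper:
  assumes u: "0 < u" and \<eta>: "0 < \<eta>"
  shows "\<exists>\<zeta>>0. \<forall>\<^sub>F n in sequentially. \<forall>N. \<bar>\<tau> n N - t\<bar> \<le> \<zeta> \<longrightarrow>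
    comps_in n N (cball u \<zeta>) \<le> exp (\<beta> n * (\<eta> - rate t u))"
proof -
  obtain d1 where d1: "0 < d1" "\<And>s z. \<bar>s - t\<bar> \<le> d1 \<Longrightarrow> \<bar>z - u\<bar> \<le> d1 \<Longrightarrow> \<bar>rate s z - rate t u\<bar> < \<eta> / 4"
    using rate_close[of "\<eta> / 4" t u] \<eta> by auto
  obtain d2 where d2: "0 < d2" "\<And>s z. \<bar>s - u / 2\<bar> \<le> d2 \<Longrightarrow> \<bar>z - u\<bar> \<le> d2 \<Longrightarrow> \<bar>rate s z - rate (u / 2) u\<bar> < \<eta> / 4"
    using rate_close[of "\<eta> / 4" "u / 2" u] \<eta> by auto
  have r0: "rate (u / 2) u = 0" by (simp add: rate_def)
  define \<zeta> where "\<zeta> = min (min d1 d2) (min 1 (u / 2))"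
  have \<zeta>: "0 < \<zeta>" "\<zeta> \<le> d1" "\<zeta> \<le> d2" "\<zeta> \<le> 1" "\<zeta> \<le> u / 2" using d1 d2 u by (auto simp: \<zeta>_def)
  define A where "A = \<bar>t\<bar> + u + 2"
  have A: "0 < A" using u by (simp add: A_def)
  obtain C where C: "0 < C" "\<forall>\<^sub>F n in sequentially. \<forall>N. \<tau> n N \<le> A \<longrightarrow> comps_in n N {u / 2..} \<le> C"
    using expected_comps_bounded[of "u / 2" A] u by auto
  have "\<forall>\<^sub>F n in sequentially. exp (- (\<eta> / 4 * \<beta> n)) \<le> 1 / C"
    using exp_beta_small[of "\<eta> / 4" "1 / C"] \<eta> C by simp
  moreover note C(2)
  moreover have "0 < \<eta> / 4" using \<eta> by simp
  note transfer[OF A this]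
  moreover note vertex_count_for[OF \<zeta>(1), of "u / 2"]
  moreover note basic[OF zero_less_one]
  ultimately have "\<forall>\<^sub>F n in sequentially. \<forall>N. \<bar>\<tau> n N - t\<bar> \<le> \<zeta> \<longrightarrow>
    comps_in n N (cball u \<zeta>) \<le> exp (\<beta> n * (\<eta> - rate t u))"
  proof eventually_elim
    case (elim n)
    obtain N0 where N0: "\<bar>\<tau> n N0 - u / 2\<bar> \<le> \<zeta>" using elim(4) by auto
    have P: "0 \<le> p n" "p n \<le> 1" and \<beta>0: "0 \<le> \<beta> n" using elim(5) by auto
    have A0: "\<bar>\<tau> n N0\<bar> \<le> A" using N0 \<zeta> u unfolding A_def by linarith
    show ?case
    proof (intro allI impI)
      fix N assume tN: "\<bar>\<tau> n N - t\<bar> \<le> \<zeta>"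
      then have AN: "\<bar>\<tau> n N\<bar> \<le> A" using \<zeta> u unfolding A_def by linarith
      \<comment> \<open>Three quarters of \<eta> pay for the two continuity estimates and for the
        transfer; the last quarter absorbs \<open>C\<close>.\<close>
      have term_le: "expected_comps (p n) N k \<le> expected_comps (p n) N0 k * exp (\<beta> n * (3 * \<eta> / 4 - rate t u))"
        if k: "1 \<le> k" "\<bar>real k / L n - u\<bar> \<le> \<zeta>" for k
      proof -
        define y where "y = real k / L n"
        have yA: "real k / L n \<le> A" using k \<zeta> u unfolding A_def by linarith
        have "\<bar>rate (\<tau> n N) y - rate t u\<bar> < \<eta> / 4"
          by (rule d1(2)) (use tN k \<zeta> in \<open>unfold y_def, linarith+\<close>)
        moreover have "\<bar>rate (\<tau> n N0) y - rate (u / 2) u\<bar> < \<eta> / 4"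
          by (rule d2(2)) (use N0 k \<zeta> in \<open>unfold y_def, linarith+\<close>)
        ultimately have "rate (\<tau> n N0) y - rate (\<tau> n N) y + \<eta> / 4 \<le> 3 * \<eta> / 4 - rate t u"
          using r0 by linarith
        then have "exp (\<beta> n * (rate (\<tau> n N0) y - rate (\<tau> n N) y + \<eta> / 4)) \<le> exp (\<beta> n * (3 * \<eta> / 4 - rate t u))"
          using \<beta>0 by (simp add: mult_left_mono)
        moreover have "expected_comps (p n) N k \<le> expected_comps (p n) N0 k *
            exp (\<beta> n * (rate (\<tau> n N0) y - rate (\<tau> n N) y + \<eta> / 4))"
          using elim(3) k(1) AN A0 yA unfolding y_def by blast
        ultimately show ?thesis
          using expected_comps_nonneg[OF P, of N0 k] by (meson mult_left_mono order.trans)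
      qed
      have "comps_in n N (cball u \<zeta>) \<le> (\<Sum>k\<in>{k \<in> {1..N}. real k / L n \<in> cball u \<zeta>}.
          expected_comps (p n) N0 k * exp (\<beta> n * (3 * \<eta> / 4 - rate t u)))"
        unfolding comps_in_def using term_le
        by (intro sum_mono) (auto simp: dist_real_def abs_minus_commute)
      also have "\<dots> = exp (\<beta> n * (3 * \<eta> / 4 - rate t u)) *
          (\<Sum>k\<in>{k \<in> {1..N}. real k / L n \<in> cball u \<zeta>}. expected_comps (p n) N0 k)"
        by (simp add: sum_distrib_left mult.commute)
      also have "\<dots> \<le> exp (\<beta> n * (3 * \<eta> / 4 - rate t u)) * C"
      proof (intro mult_left_mono)
        have "(\<Sum>k\<in>{k \<in> {1..N}. real k / L n \<in> cball u \<zeta>}. expected_comps (p n) N0 k)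
            \<le> comps_in n N0 (cball u \<zeta>)" by (rule sum_expected_comps_le_comps_in[OF P])
        also have "\<dots> \<le> comps_in n N0 {u / 2..}"
          using \<zeta> by (intro comps_in_mono P) (auto simp: dist_real_def)
        also have "\<dots> \<le> C" using elim(2) A0 by auto
        finally show "(\<Sum>k\<in>{k \<in> {1..N}. real k / L n \<in> cball u \<zeta>}. expected_comps (p n) N0 k) \<le> C" .
      qed auto
      also have "\<dots> = exp (\<beta> n * (\<eta> - rate t u)) * (exp (- (\<eta> / 4 * \<beta> n)) * C)"
        by (simp add: mult.assoc[symmetric] exp_add[symmetric]) (simp add: field_simps)
      also have "\<dots> \<le> exp (\<beta> n * (\<eta> - rate t u)) * 1"
        using elim(1) C(1) by (intro mult_left_mono) (auto simp: field_simps)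
      finally show "comps_in n N (cball u \<zeta>) \<le> exp (\<beta> n * (\<eta> - rate t u))" by simp
    qed
  qed
  with \<zeta>(1) show ?thesis by blast
qed

text \<open>Among positive sizes the rate at drift t vanishes only at 2 t. On the bounded part of Y
  it is therefore positive and finitely many windows suffice; \<open>tail_upper\<close> covers the
  unbounded part.\<close>

lemma region_upper:
  assumes Y: "closed Y" "Y \<subseteq> {\<delta>..}" "0 < \<delta>" "2 * t \<notin> Y" and c: "0 < c"
  shows "\<exists>\<zeta>>0. \<forall>\<^sub>F n in sequentially. \<forall>N. \<bar>\<tau> n N - t\<bar> \<le> \<zeta> \<longrightarrow> comps_in n N Y \<le> c"
proof -
  obtain M where M: "0 < M" "\<forall>\<^sub>F n in sequentially. \<forall>N. \<tau> n N \<le> t + 1 \<longrightarrow> comps_in n N {M..} \<le> exp (- (1 * \<beta> n))"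
    using tail_upper[of 1 "t + 1"] by auto
  define K where "K = Y \<inter> {\<delta>..M}"
  have K: "compact K" unfolding K_def using Y(1) by (intro closed_Int_compact) auto
  have rate_pos: "0 < rate t y" if "y \<in> K" for y
    using that Y unfolding K_def rate_def by (intro divide_pos_pos mult_pos_pos) auto
  have "\<forall>y\<in>K. \<exists>\<zeta>. 0 < \<zeta> \<and> (\<forall>\<^sub>F n in sequentially. \<forall>N. \<bar>\<tau> n N - t\<bar> \<le> \<zeta> \<longrightarrow>
    comps_in n N (cball y \<zeta>) \<le> exp (\<beta> n * (rate t y / 2 - rate t y)))"
  proof
    fix y assume y: "y \<in> K"
    then have "0 < y" using Y by (auto simp: K_def)
    moreover have "0 < rate t y / 2" using rate_pos[OF y] by simp
    ultimately show "\<exists>\<zeta>. 0 < \<zeta> \<and> (\<forall>\<^sub>F n in sequentially. \<forall>N. \<bar>\<tau> n N - t\<bar> \<le> \<zeta> \<longrightarrow>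
      comps_in n N (cball y \<zeta>) \<le> exp (\<beta> n * (rate t y / 2 - rate t y)))"
      by (rule window_upper)
  qed
  from bchoice[OF this] obtain z where z: "\<And>y. y \<in> K \<Longrightarrow> 0 < z y"
    "\<And>y. y \<in> K \<Longrightarrow> \<forall>\<^sub>F n in sequentially. \<forall>N. \<bar>\<tau> n N - t\<bar> \<le> z y \<longrightarrow>
      comps_in n N (cball y (z y)) \<le> exp (\<beta> n * (rate t y / 2 - rate t y))" by auto
  have "K \<subseteq> (\<Union>y\<in>K. ball y (z y))"
  proof
    fix y assume "y \<in> K"
    then show "y \<in> (\<Union>y\<in>K. ball y (z y))" using z(1) by (intro UN_I[of y]) auto
  qed
  then obtain F where F: "F \<subseteq> K" "finite F" "K \<subseteq> (\<Union>y\<in>F. ball y (z y))"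
    using compactE_image[OF K, of K "\<lambda>y. ball y (z y)"] open_ball by auto
  define \<zeta> where "\<zeta> = Min (insert 1 (z ` F))"
  have \<zeta>: "0 < \<zeta>" "\<zeta> \<le> 1" "\<And>y. y \<in> F \<Longrightarrow> \<zeta> \<le> z y"
    using F z(1) unfolding \<zeta>_def by (auto simp: Min_gr_iff)
  \<comment> \<open>One share of c for each window of the cover and one for the tail.\<close>
  define m where "m = real (card F) + 1"
  have cm: "0 < c / m" using c by (simp add: m_def)
  have "\<forall>\<^sub>F n in sequentially. \<forall>y\<in>F. (\<forall>N. \<bar>\<tau> n N - t\<bar> \<le> z y \<longrightarrow>
      comps_in n N (cball y (z y)) \<le> exp (\<beta> n * (rate t y / 2 - rate t y)))"
    using F z(2) by (intro eventually_ball_finite) auto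
  moreover have "\<forall>\<^sub>F n in sequentially. \<forall>y\<in>F. exp (- (rate t y / 2 * \<beta> n)) \<le> c / m"
    using F rate_pos cm by (intro eventually_ball_finite ballI exp_beta_small) auto
  moreover have "\<forall>\<^sub>F n in sequentially. exp (- (1 * \<beta> n)) \<le> c / m"
    using cm by (intro exp_beta_small) auto
  moreover note M(2) basic[OF zero_less_one]
  ultimately have "\<forall>\<^sub>F n in sequentially. \<forall>N. \<bar>\<tau> n N - t\<bar> \<le> \<zeta> \<longrightarrow> comps_in n N Y \<le> c"
  proof eventually_elim
    case (elim n)
    have P: "0 \<le> p n" "p n \<le> 1" using elim(5) by auto
    show ?case
    proof (intro allI impI)
      fix N assume tN: "\<bar>\<tau> n N - t\<bar> \<le> \<zeta>"
      have "Y \<subseteq> K \<union> {M..}" using Y(2) by (auto simp: K_def)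
      moreover have "K \<subseteq> (\<Union>y\<in>F. cball y (z y))"
        by (rule order.trans[OF F(3)]) (intro UN_mono ball_subset_cball subset_refl)
      ultimately have "Y \<subseteq> (\<Union>y\<in>F. cball y (z y)) \<union> {M..}" by blast
      then have "comps_in n N Y \<le> comps_in n N ((\<Union>y\<in>F. cball y (z y)) \<union> {M..})"
        by (intro comps_in_mono P) (erule subsetD)
      also have "\<dots> \<le> comps_in n N (\<Union>y\<in>F. cball y (z y)) + comps_in n N {M..}"
        by (rule comps_in_Un[OF P])
      also have "\<dots> \<le> (\<Sum>y\<in>F. comps_in n N (cball y (z y))) + comps_in n N {M..}"
        using comps_in_UN[OF P F(2)] by (intro add_right_mono)
      also have "\<dots> \<le> (\<Sum>y\<in>F. c / m) + c / m"
      proof (intro add_mono sum_mono)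
        fix y assume y: "y \<in> F"
        have "comps_in n N (cball y (z y)) \<le> exp (\<beta> n * (rate t y / 2 - rate t y))"
        proof -
          have "\<bar>\<tau> n N - t\<bar> \<le> z y" using tN \<zeta>(3)[OF y] by linarith
          with elim(1) y show ?thesis by blast
        qed
        also have "\<dots> = exp (- (rate t y / 2 * \<beta> n))" by (simp add: field_simps)
        also have "\<dots> \<le> c / m" using elim(2) y by blast
        finally show "comps_in n N (cball y (z y)) \<le> c / m" .
      next
        have "\<tau> n N \<le> t + 1" using tN \<zeta>(2) by linarith
        then have "comps_in n N {M..} \<le> exp (- (1 * \<beta> n))" using elim(4) by blast
        then show "comps_in n N {M..} \<le> c / m" using elim(3) by linarith
      qed
      also have "\<dots> = m * (c / m)" by (simp only: sum_constant m_def distrib_right mult_1_left)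
      also have "\<dots> = c" by (simp add: m_def)
      finally show "comps_in n N Y \<le> c" .
    qed
  qed
  with \<zeta>(1) show ?thesis by blast
qed

section \<open>All components small, and lower bounds for expected numbers\<close>

text \<open>An instance of \<open>small_comps_bound\<close> with K about \<delta> L: its v is about
  \<epsilon> times the positive part of the drift and 1 / p is about n, so v^3 / (6 p) is close to
  \<beta> times the cube of that positive part over 6.\<close>

lemma small_upper:
  assumes \<eta>: "0 < \<eta>"
  shows "\<exists>\<delta>0>0. \<forall>\<delta>. 0 < \<delta> \<longrightarrow> \<delta> \<le> \<delta>0 \<longrightarrow> (\<forall>\<^sub>F n in sequentially. \<forall>N. \<bar>\<tau> n N - t\<bar> \<le> \<delta>0 \<longrightarrow>
    small_prob n N \<delta> \<le> exp (\<beta> n * (\<eta> - (max t 0) ^ 3 / 6)))"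
proof -
  \<comment> \<open>The shift by 3 d allows d for the distance of the actual drift from t and 2 d
    for the K vertices subtracted in \<open>small_comps_bound\<close>, since p K \<le> 2 \<delta>
    \<epsilon>.\<close>
  have "((\<lambda>d. (max (t - 3 * d) 0) ^ 3 / 6) \<longlongrightarrow> (max (t - 3 * 0) 0) ^ 3 / 6) (at_right 0)"
    by (intro tendsto_intros) auto
  then have "\<forall>\<^sub>F d in at_right 0. (max t 0) ^ 3 / 6 - \<eta> / 2 < (max (t - 3 * d) 0) ^ 3 / 6"
    using \<eta> by (intro order_tendstoD(1)) auto
  then obtain d0 where d0: "0 < d0" "\<And>d. 0 < d \<Longrightarrow> d < d0 \<Longrightarrow> (max t 0) ^ 3 / 6 - \<eta> / 2 < (max (t - 3 * d) 0) ^ 3 / 6"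
    unfolding eventually_at_right_field by auto
  define \<delta>0 where "\<delta>0 = min (d0 / 2) 1"
  have \<delta>0: "0 < \<delta>0" "\<delta>0 \<le> 1" "(max t 0) ^ 3 / 6 - \<eta> / 2 < (max (t - 3 * \<delta>0) 0) ^ 3 / 6"
    using d0 by (auto simp: \<delta>0_def)
  define s where "s = max (t - 3 * \<delta>0) 0"
  define A where "A = \<bar>t\<bar> + 1"
  define r where "r = min (1 / (8 * A)) (\<eta> / (2 * (A * s ^ 3 + s ^ 3 + 1)))"
  have s0: "0 \<le> s" by (simp add: s_def)
  have A: "1 \<le> A" by (simp add: A_def)
  have pos: "0 < A * s ^ 3 + s ^ 3 + 1" using s0 A by (simp add: add_nonneg_pos)
  have r: "0 < r" "r * (8 * A) \<le> 1" "r * (A * s ^ 3 + s ^ 3 + 1) \<le> \<eta> / 2"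
  proof -
    show "0 < r" using A \<eta> pos by (simp add: r_def)
    have "r \<le> 1 / (8 * A)" "r \<le> \<eta> / (2 * (A * s ^ 3 + s ^ 3 + 1))" by (auto simp: r_def)
    then show "r * (8 * A) \<le> 1" "r * (A * s ^ 3 + s ^ 3 + 1) \<le> \<eta> / 2"
      using A pos by (auto simp: field_simps)
  qed
  show ?thesis
  proof (intro exI[of _ \<delta>0] conjI allI impI \<delta>0(1))
    fix \<delta> :: real assume \<delta>: "0 < \<delta>" "\<delta> \<le> \<delta>0"
    show "\<forall>\<^sub>F n in sequentially. \<forall>N. \<bar>\<tau> n N - t\<bar> \<le> \<delta>0 \<longrightarrow>
      small_prob n N \<delta> \<le> exp (\<beta> n * (\<eta> - (max t 0) ^ 3 / 6))"
      using basic[OF r(1)]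
    proof eventually_elim
      case (elim n)
      define e where "e = \<epsilon> n"
      define P where "P = p n"
      have e: "0 < e" "e \<le> r" and P: "0 < P" "P \<le> 1/2" "P \<le> r * e" and nP: "\<bar>real n * P - 1\<bar> \<le> r"
        and n: "0 < n"
        using elim by (auto simp: e_def P_def)
      have L: "0 < L n" and \<beta>0: "0 \<le> \<beta> n" using n e by (auto simp: L_def \<beta>_def e_def)
      have r8: "r \<le> 1/8"
      proof -
        have "r * 8 \<le> r * (8 * A)" using A r by (intro mult_left_mono) auto
        with r(2) show ?thesis by linarith
      qed
      define Y where "Y = e * A"
      have Y: "0 \<le> Y" "Y \<le> r * A" "Y \<le> 1/8"
      proof -
        show "0 \<le> Y" using e A by (simp add: Y_def)
        show "Y \<le> r * A" unfolding Y_def using e A by (intro mult_right_mono) auto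
        then show "Y \<le> 1/8" using r(2) by simp
      qed
      show ?case
      proof (intro allI impI)
        fix N assume tN: "\<bar>\<tau> n N - t\<bar> \<le> \<delta>0"
        define K where "K = nat \<lfloor>\<delta> * L n\<rfloor>"
        define v where "v = max 0 (P * (real N - real K) - 1)"
        have K: "real K \<le> \<delta> * L n" using \<delta> L by (simp add: K_def)
        have PK: "P * real K \<le> e * (2 * \<delta>)"
        proof -
          have "P * real K \<le> P * (\<delta> * L n)" using K P by (intro mult_left_mono) auto
          also have "\<dots> = (real n * P) * \<delta> * e" by (simp add: L_def e_def)
          also have "\<dots> \<le> 2 * \<delta> * e" using nP r8 \<delta> e by (intro mult_right_mono) (auto simp: abs_le_iff)
          finally show ?thesis by (simp add: mult.commute)
        qed
        have PN: "P * real N = 1 + e * \<tau> n N" using e by (simp add: \<tau>_def P_def e_def)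
        have v_le: "v \<le> Y"
        proof -
          have "e * \<tau> n N \<le> e * A" using e tN \<delta>0(2) unfolding A_def by (intro mult_left_mono) auto
          moreover have "0 \<le> P * real K" using P by simp
          ultimately show ?thesis using PN Y(1) by (simp add: v_def Y_def right_diff_distrib)
        qed
        have v_ge: "e * s \<le> v"
        proof (cases "t - 3 * \<delta>0 \<le> 0")
          case True
          then show ?thesis by (simp add: s_def v_def)
        next
          case False
          have "e * (t - \<delta>0) \<le> e * \<tau> n N" using e tN by (intro mult_left_mono) auto
          moreover have "e * (2 * \<delta>) \<le> e * (2 * \<delta>0)" using \<delta> e by (intro mult_left_mono) auto
          moreover have "e * s = e * (t - \<delta>0) - e * (2 * \<delta>0)" using False by (simp add: s_def algebra_simps)
          moreover have "P * (real N - real K) = P * real N - P * real K" by (rule right_diff_distrib)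
          ultimately have "e * s \<le> P * (real N - real K) - 1"
            using PK PN by linarith
          then show ?thesis by (simp add: v_def)
        qed
        have "small_prob n N \<delta> \<le> size_law P N (\<lambda>X. of_bool (\<forall>x\<in>#X. x \<le> K))"
          unfolding small_prob_def P_def[symmetric]
        proof (rule size_law_mono)
          fix X :: "nat multiset"
          have "x \<le> K" if "real x < \<delta> * L n" for x
            using that by (simp add: K_def le_nat_floor)
          then show "of_bool (\<forall>x\<in>#X. real x < \<delta> * L n) \<le> (of_bool (\<forall>x\<in>#X. x \<le> K) :: real)"
            by auto
        qed (use P in auto)
        also have "\<dots> \<le> exp (- ((1 - 2 * Y) * v ^ 3 / (6 * P)))"
          unfolding v_def using P Y v_le by (intro small_comps_bound) (auto simp: v_def)
        also have "\<dots> \<le> exp (\<beta> n * (\<eta> - (max t 0) ^ 3 / 6))"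
        proof -
          have "(1 - 2 * Y) * (1 - r) * (\<beta> n * s ^ 3 / 6) \<le> (1 - 2 * Y) * (v ^ 3 / (6 * P))"
            unfolding mult.assoc
          proof (intro mult_left_mono)
            have "(1 - r) * (real n * P) \<le> (1 - r) * (1 + r)"
              using nP r8 by (intro mult_left_mono) (auto simp: abs_le_iff)
            also have "\<dots> \<le> 1" by (simp add: algebra_simps)
            finally have "(1 - r) * real n \<le> 1 / P" using P by (simp add: field_simps)
            then have "(1 - r) * real n * ((e * s) ^ 3 / 6) \<le> 1 / P * (v ^ 3 / 6)"
              using v_ge e s0 P by (intro mult_mono divide_right_mono power_mono) auto
            then show "(1 - r) * (\<beta> n * s ^ 3 / 6) \<le> v ^ 3 / (6 * P)"
              by (simp add: \<beta>_def e_def power_mult_distrib mult_ac)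
          qed (use Y in auto)
          moreover have "\<beta> n * (s ^ 3 / 6 - \<eta> / 2) \<le> (1 - 2 * Y) * (1 - r) * (\<beta> n * s ^ 3 / 6)"
          proof -
            have "1 - 2 * Y - r \<le> (1 - 2 * Y) * (1 - r)" using Y r by (simp add: algebra_simps)
            then have "(1 - 2 * (r * A) - r) * s ^ 3 \<le> (1 - 2 * Y) * (1 - r) * s ^ 3"
              using Y s0 by (intro mult_right_mono) auto
            moreover have "r * (A * s ^ 3) \<le> r * (A * s ^ 3 + s ^ 3 + 1)" "r * s ^ 3 \<le> r * (A * s ^ 3 + s ^ 3 + 1)"
              using r s0 A by (intro mult_left_mono; simp)+
            moreover have "(1 - 2 * (r * A) - r) * s ^ 3 = s ^ 3 - 2 * (r * (A * s ^ 3)) - r * s ^ 3"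
              by (simp add: algebra_simps)
            ultimately have "s ^ 3 / 6 - \<eta> / 2 \<le> (1 - 2 * Y) * (1 - r) * s ^ 3 / 6"
              using r(3) \<eta> by linarith
            from mult_left_mono[OF this \<beta>0] show ?thesis by (simp add: mult_ac)
          qed
          moreover have "\<beta> n * ((max t 0) ^ 3 / 6 - \<eta>) \<le> \<beta> n * (s ^ 3 / 6 - \<eta> / 2)"
            using \<delta>0(3) \<beta>0 unfolding s_def[symmetric] by (intro mult_left_mono) auto
          ultimately have "\<beta> n * ((max t 0) ^ 3 / 6 - \<eta>) \<le> (1 - 2 * Y) * v ^ 3 / (6 * P)" by simp
          then show ?thesis by (simp add: algebra_simps)
        qed
        finally show "small_prob n N \<delta> \<le> exp (\<beta> n * (\<eta> - (max t 0) ^ 3 / 6))" .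
      qed
    qed
  qed
qed

text \<open>For t \<le> 0 the exceptional size 2 t is not positive, so even components above
  \<delta> are few in expectation, and Markov's inequality applies.\<close>

lemma small_lower:
  assumes "t \<le> 0" "0 < \<delta>"
  shows "\<exists>\<zeta>>0. \<forall>\<^sub>F n in sequentially. \<forall>N. \<bar>\<tau> n N - t\<bar> \<le> \<zeta> \<longrightarrow> 1/2 \<le> small_prob n N \<delta>"
proof -
  obtain \<zeta> where \<zeta>: "0 < \<zeta>" "\<forall>\<^sub>F n in sequentially. \<forall>N. \<bar>\<tau> n N - t\<bar> \<le> \<zeta> \<longrightarrow> comps_in n N {\<delta>..} \<le> 1/2"
    using region_upper[of "{\<delta>..}" \<delta> t "1/2"] assms by auto
  from \<zeta>(2) basic[OF zero_less_one] L_pos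
  have "\<forall>\<^sub>F n in sequentially. \<forall>N. \<bar>\<tau> n N - t\<bar> \<le> \<zeta> \<longrightarrow> 1/2 \<le> small_prob n N \<delta>"
  proof eventually_elim
    case (elim n)
    show ?case
    proof (intro allI impI)
      fix N assume "\<bar>\<tau> n N - t\<bar> \<le> \<zeta>"
      with elim(1) have "comps_in n N {\<delta>..} \<le> 1/2" by blast
      then show "1/2 \<le> small_prob n N \<delta>"
        using small_prob_plus_comps_in[of n N \<delta>] elim by auto
    qed
  qed
  with \<zeta>(1) show ?thesis by blast
qed

text \<open>At drift u / 2 it is unlikely that no component exceeds \<delta>0, and those above
  \<delta>0 but away from u are few in expectation. What is left is an expected number of at least
  1/2 near u, which is transferred to drift t.\<close>

lemma window_lower:
  assumes u: "0 < u" and \<eta>: "0 < \<eta>" and \<kappa>: "0 < \<kappa>"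
  shows "\<exists>\<zeta>>0. \<forall>\<^sub>F n in sequentially. \<forall>N. \<bar>\<tau> n N - t\<bar> \<le> \<zeta> \<longrightarrow>
    exp (- (\<beta> n * (rate t u + \<eta>))) \<le> comps_in n N (cball u \<kappa>)"
proof -
  obtain d where d: "0 < d" "\<And>s z. \<bar>s - t\<bar> \<le> d \<Longrightarrow> \<bar>z - u\<bar> \<le> d \<Longrightarrow> \<bar>rate s z - rate t u\<bar> < \<eta> / 4"
    using rate_close[of "\<eta> / 4" t u] \<eta> by auto
  define k' where "k' = min d (min \<kappa> 1)"
  have k': "0 < k'" "k' \<le> d" "k' \<le> \<kappa>" "k' \<le> 1" using d \<kappa> by (auto simp: k'_def)
  \<comment> \<open>Half of (u / 2)^3 / 6 = u^3 / 48, so that the other half remains as decay rate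
    of the small event.\<close>
  define \<eta>' where "\<eta>' = u ^ 3 / 96"
  have \<eta>': "0 < \<eta>'" using u by (simp add: \<eta>'_def)
  obtain \<delta>0 where \<delta>0: "0 < \<delta>0" "\<And>\<delta>. 0 < \<delta> \<Longrightarrow> \<delta> \<le> \<delta>0 \<Longrightarrow> (\<forall>\<^sub>F n in sequentially. \<forall>N. \<bar>\<tau> n N - u / 2\<bar> \<le> \<delta>0 \<longrightarrow>
    small_prob n N \<delta> \<le> exp (\<beta> n * (\<eta>' - (max (u / 2) 0) ^ 3 / 6)))"
    using small_upper[OF \<eta>', of "u / 2"] by blast
  define Y where "Y = {\<delta>0..} - ball u k'"
  have Y: "closed Y" "Y \<subseteq> {\<delta>0..}" "2 * (u / 2) \<notin> Y"
    using k' by (auto simp: Y_def closed_Diff)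
  obtain \<zeta>1 where \<zeta>1: "0 < \<zeta>1" "\<forall>\<^sub>F n in sequentially. \<forall>N. \<bar>\<tau> n N - u / 2\<bar> \<le> \<zeta>1 \<longrightarrow> comps_in n N Y \<le> 1/4"
    using region_upper[OF Y(1,2) \<delta>0(1) Y(3), of "1/4"] by auto
  define \<zeta> where "\<zeta> = min (min \<delta>0 \<zeta>1) (min d 1)"
  have \<zeta>: "0 < \<zeta>" "\<zeta> \<le> \<delta>0" "\<zeta> \<le> \<zeta>1" "\<zeta> \<le> d" "\<zeta> \<le> 1" using \<delta>0 \<zeta>1 d by (auto simp: \<zeta>_def)
  define A where "A = \<bar>t\<bar> + u + 2"
  have A: "0 < A" using u by (simp add: A_def)
  have \<eta>4: "0 < \<eta> / 4" using \<eta> by simp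
  have "\<forall>\<^sub>F n in sequentially. exp (- (\<eta>' * \<beta> n)) \<le> 1 / 4"
    using \<eta>' by (intro exp_beta_small) auto
  moreover have "\<forall>\<^sub>F n in sequentially. exp (- (\<eta> / 4 * \<beta> n)) \<le> 1 / 2"
    using \<eta>4 by (intro exp_beta_small) auto
  moreover note \<delta>0(2)[OF \<delta>0(1) order.refl] \<zeta>1(2) transfer[OF A \<eta>4] vertex_count_for[OF \<zeta>(1), of "u / 2"]
    basic[OF zero_less_one] L_pos
  ultimately have "\<forall>\<^sub>F n in sequentially. \<forall>N. \<bar>\<tau> n N - t\<bar> \<le> \<zeta> \<longrightarrow>
    exp (- (\<beta> n * (rate t u + \<eta>))) \<le> comps_in n N (cball u \<kappa>)"
  proof eventually_elim
    case (elim n)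
    obtain N0 where N0: "\<bar>\<tau> n N0 - u / 2\<bar> \<le> \<zeta>" using elim(6) by auto
    have P: "0 \<le> p n" "p n \<le> 1" and \<beta>0: "0 \<le> \<beta> n" using elim(7) by auto
    have A0: "\<bar>\<tau> n N0\<bar> \<le> A" using N0 \<zeta> u unfolding A_def by linarith
    have half: "1/2 \<le> comps_in n N0 (cball u k')"
    proof -
      have "small_prob n N0 \<delta>0 \<le> exp (\<beta> n * (\<eta>' - (max (u / 2) 0) ^ 3 / 6))"
        using elim(3) N0 \<zeta>(2) by auto
      also have "\<dots> = exp (- (\<eta>' * \<beta> n))"
        using u by (simp add: \<eta>'_def power_divide max_def)
      finally have "small_prob n N0 \<delta>0 \<le> 1/4" using elim(1) by linarith
      moreover have "comps_in n N0 Y \<le> 1/4" using elim(4) N0 \<zeta>(3) by auto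
      moreover have "comps_in n N0 {\<delta>0..} \<le> comps_in n N0 (Y \<union> cball u k')"
        by (intro comps_in_mono P) (auto simp: Y_def)
      ultimately show ?thesis
        using small_prob_plus_comps_in[OF P elim(8), of N0 \<delta>0] comps_in_Un[OF P, of N0 Y "cball u k'"]
        by linarith
    qed
    show ?case
    proof (intro allI impI)
      fix N assume tN: "\<bar>\<tau> n N - t\<bar> \<le> \<zeta>"
      then have AN: "\<bar>\<tau> n N\<bar> \<le> A" using \<zeta> u unfolding A_def by linarith
      have term_le: "expected_comps (p n) N0 k \<le> expected_comps (p n) N k * exp (\<beta> n * (rate t u + \<eta> / 2))"
        if k: "1 \<le> k" "\<bar>real k / L n - u\<bar> \<le> k'" for k
      proof -
        define y where "y = real k / L n"
        have yA: "real k / L n \<le> A" using k k' u unfolding A_def by linarith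
        have "\<bar>rate (\<tau> n N) y - rate t u\<bar> < \<eta> / 4"
          by (rule d(2)) (use tN k k' \<zeta> in \<open>unfold y_def, linarith+\<close>)
        moreover have "0 \<le> rate (\<tau> n N0) y" using elim(8) by (simp add: y_def rate_nonneg)
        ultimately have "rate (\<tau> n N) y - rate (\<tau> n N0) y + \<eta> / 4 \<le> rate t u + \<eta> / 2" by linarith
        then have "exp (\<beta> n * (rate (\<tau> n N) y - rate (\<tau> n N0) y + \<eta> / 4)) \<le> exp (\<beta> n * (rate t u + \<eta> / 2))"
          using \<beta>0 by (simp add: mult_left_mono)
        moreover have "expected_comps (p n) N0 k \<le> expected_comps (p n) N k *
            exp (\<beta> n * (rate (\<tau> n N) y - rate (\<tau> n N0) y + \<eta> / 4))"
          using elim(5) k(1) AN A0 yA unfolding y_def by blast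
        ultimately show ?thesis
          using expected_comps_nonneg[OF P, of N k] by (meson mult_left_mono order.trans)
      qed
      have "1/2 \<le> (\<Sum>k\<in>{k \<in> {1..N0}. real k / L n \<in> cball u k'}.
          expected_comps (p n) N k * exp (\<beta> n * (rate t u + \<eta> / 2)))"
        using half unfolding comps_in_def
        by (rule order.trans) (intro sum_mono term_le; auto simp: dist_real_def abs_minus_commute)
      also have "\<dots> = exp (\<beta> n * (rate t u + \<eta> / 2)) *
          (\<Sum>k\<in>{k \<in> {1..N0}. real k / L n \<in> cball u k'}. expected_comps (p n) N k)"
        by (simp add: sum_distrib_left mult.commute)
      also have "\<dots> \<le> exp (\<beta> n * (rate t u + \<eta> / 2)) * comps_in n N (cball u k')"
        by (intro mult_left_mono sum_expected_comps_le_comps_in P) auto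
      finally have "exp (- (\<beta> n * (rate t u + \<eta> / 2))) * (1/2) \<le> comps_in n N (cball u k')"
        by (simp add: exp_minus field_simps)
      moreover have "exp (- (\<beta> n * (rate t u + \<eta>))) \<le> exp (- (\<beta> n * (rate t u + \<eta> / 2))) * (1/2)"
      proof -
        have "exp (- (\<beta> n * (rate t u + \<eta>))) = exp (- (\<beta> n * (rate t u + \<eta> / 2))) * exp (- (\<eta> / 2 * \<beta> n))"
          by (simp add: exp_add[symmetric]) (simp add: field_simps)
        moreover have "exp (- (\<beta> n * (rate t u + \<eta> / 2))) * exp (- (\<eta> / 2 * \<beta> n))
            \<le> exp (- (\<beta> n * (rate t u + \<eta> / 2))) * (1/2)"
        proof (rule mult_left_mono)
          have "\<eta> / 4 * \<beta> n \<le> \<eta> / 2 * \<beta> n" using \<eta> \<beta>0 by (intro mult_right_mono) auto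
          then have "exp (- (\<eta> / 2 * \<beta> n)) \<le> exp (- (\<eta> / 4 * \<beta> n))" by simp
          then show "exp (- (\<eta> / 2 * \<beta> n)) \<le> 1/2" using elim(2) by (rule order.trans)
        qed simp
        ultimately show ?thesis by simp
      qed
      moreover have "comps_in n N (cball u k') \<le> comps_in n N (cball u \<kappa>)"
        using k' by (intro comps_in_mono P) (auto intro: order.trans)
      ultimately show "exp (- (\<beta> n * (rate t u + \<eta>))) \<le> comps_in n N (cball u \<kappa>)" by linarith
    qed
  qed
  with \<zeta>(1) show ?thesis by blast
qed

end

section \<open>Components of prescribed sizes\<close>

definition nth_size :: "nat multiset \<Rightarrow> nat \<Rightarrow> nat" where
  "nth_size X i = (let xs = rev (sorted_list_of_multiset X) in if i < length xs then xs ! i else 0)"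

lemma component_size_eq: "component_size n E i = nth_size (sizes (connected_components n E)) i"
  by (simp add: component_size_def component_sizes_def nth_size_def sizes_def Let_def)

text \<open>In a decreasing list the elements with an upward closed property form an initial
  segment.\<close>

lemma sorted_desc_nth_filter:
  fixes xs :: "nat list"
  assumes "sorted_wrt (\<ge>) xs" "\<And>x y. P x \<Longrightarrow> x \<le> y \<Longrightarrow> P y"
  shows "i < length xs \<and> P (xs ! i) \<longleftrightarrow> i < length (filter P xs)"
  using assms(1)
proof (induction xs arbitrary: i)
  case (Cons x xs)
  show ?case
  proof (cases "P x")
    case True
    then show ?thesis using Cons by (cases i) auto
  next
    case False
    with Cons.prems assms(2) have "\<forall>y\<in>set (x # xs). \<not> P y" by auto
    moreover from this have "filter P (x # xs) = []" by (simp only: filter_empty_conv)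
    ultimately show ?thesis by (metis length_0_conv less_nat_zero_code nth_mem)
  qed
qed simp

text \<open>Turns order statistics into counts. The condition on 0 handles the positions beyond the
  last component, where \<open>nth_size\<close> is 0.\<close>

lemma nth_size_iff:
  assumes "\<And>x y. P x \<Longrightarrow> x \<le> y \<Longrightarrow> P y" "\<not> P 0"
  shows "P (nth_size X i) \<longleftrightarrow> i < size (filter_mset P X)"
proof -
  let ?xs = "rev (sorted_list_of_multiset X)"
  have "sorted_wrt (\<ge>) ?xs" by (simp add: sorted_wrt_rev)
  from sorted_desc_nth_filter[where P = P and i = i, OF this assms(1)]
  have "P (nth_size X i) \<longleftrightarrow> i < length (filter P ?xs)"
    using assms(2) by (auto simp: nth_size_def Let_def)
  also have "length (filter P ?xs) = size (filter_mset P X)"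
    by (metis mset_filter mset_rev mset_sorted_list_of_multiset size_mset)
  finally show ?thesis .
qed

lemma nth_size_antimono: "i \<le> j \<Longrightarrow> nth_size X j \<le> nth_size X i"
proof (cases "nth_size X j = 0")
  case False
  assume "i \<le> j"
  have "nth_size X j \<le> nth_size X j \<longleftrightarrow> j < size (filter_mset ((\<le>) (nth_size X j)) X)"
    using False by (intro nth_size_iff) auto
  moreover have "nth_size X j \<le> nth_size X i \<longleftrightarrow> i < size (filter_mset ((\<le>) (nth_size X j)) X)"
    using False by (intro nth_size_iff) auto
  ultimately show ?thesis using \<open>i \<le> j\<close> by auto
qed simp

text \<open>An existential splitting, with no reference to the order of the sizes, so that one
  prescribed component can be peeled off at a time as in \<open>size_law_sum_comps\<close>; R
  restricts what is left at the end.\<close>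

definition matches :: "real \<Rightarrow> real \<Rightarrow> real list \<Rightarrow> (nat multiset \<Rightarrow> bool) \<Rightarrow> nat multiset \<Rightarrow> bool" where
  "matches l \<kappa> us R X \<longleftrightarrow>
    (\<exists>xs Z. X = mset xs + Z \<and> list_all2 (\<lambda>x u. \<bar>real x / l - u\<bar> \<le> \<kappa>) xs us \<and> R Z)"

lemma matches_Nil: "matches l \<kappa> [] R X \<longleftrightarrow> R X"
  by (simp add: matches_def)

lemma matches_Cons:
  "matches l \<kappa> (u # us) R X \<longleftrightarrow> (\<exists>x\<in>#X. \<bar>real x / l - u\<bar> \<le> \<kappa> \<and> matches l \<kappa> us R (X - {#x#}))"
proof
  assume "matches l \<kappa> (u # us) R X"
  then obtain xs Z where xs: "X = mset xs + Z" "list_all2 (\<lambda>x u. \<bar>real x / l - u\<bar> \<le> \<kappa>) xs (u # us)" "R Z"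
    by (auto simp: matches_def)
  then obtain y ys where "xs = y # ys" "\<bar>real y / l - u\<bar> \<le> \<kappa>" "list_all2 (\<lambda>x u. \<bar>real x / l - u\<bar> \<le> \<kappa>) ys us"
    by (auto simp: list_all2_Cons2)
  with xs show "\<exists>x\<in>#X. \<bar>real x / l - u\<bar> \<le> \<kappa> \<and> matches l \<kappa> us R (X - {#x#})"
    by (intro bexI[of _ y]) (auto simp: matches_def)
next
  assume "\<exists>x\<in>#X. \<bar>real x / l - u\<bar> \<le> \<kappa> \<and> matches l \<kappa> us R (X - {#x#})"
  then obtain x xs Z where x: "x \<in># X" "\<bar>real x / l - u\<bar> \<le> \<kappa>" "X - {#x#} = mset xs + Z"
    "list_all2 (\<lambda>x u. \<bar>real x / l - u\<bar> \<le> \<kappa>) xs us" "R Z" by (auto simp: matches_def)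
  then have "X = mset (x # xs) + Z" by (metis add_mset_add_single insert_DiffM mset.simps(2) union_mset_add_mset_left)
  with x show "matches l \<kappa> (u # us) R X" unfolding matches_def by (intro exI[of _ "x # xs"] exI[of _ Z]) auto
qed

lemma matches_mono:
  assumes "matches l \<kappa> us R X" "\<kappa> \<le> \<kappa>'"
  shows "matches l \<kappa>' us R X"
proof -
  obtain xs Z where "X = mset xs + Z" "list_all2 (\<lambda>x u. \<bar>real x / l - u\<bar> \<le> \<kappa>) xs us" "R Z"
    using assms(1) by (auto simp: matches_def)
  moreover from this(2) have "list_all2 (\<lambda>x u. \<bar>real x / l - u\<bar> \<le> \<kappa>') xs us"
    by (rule list_all2_mono) (use assms(2) in auto)
  ultimately show ?thesis by (auto simp: matches_def)
qed

text \<open>Components of size at least c can only lie in the matched part. In the lower bound this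
  limits the number of candidates for one prescribed component.\<close>

lemma matches_size_large:
  assumes "matches l \<kappa> us (\<lambda>Z. \<forall>x\<in>#Z. real x < c) X"
  shows "size (filter_mset (\<lambda>x. c \<le> real x) X) \<le> length us"
proof -
  obtain xs Z where X: "X = mset xs + Z" "list_all2 (\<lambda>x u. \<bar>real x / l - u\<bar> \<le> \<kappa>) xs us" "\<forall>x\<in>#Z. real x < c"
    using assms by (auto simp: matches_def)
  have "filter_mset (\<lambda>x. c \<le> real x) Z = {#}" using X(3) by (auto simp: filter_mset_eq_mempty_iff)
  then have "size (filter_mset (\<lambda>x. c \<le> real x) X) = length (filter (\<lambda>x. c \<le> real x) xs)"
    by (simp add: X(1) flip: mset_filter)
  also have "\<dots> \<le> length us" using list_all2_lengthD[OF X(2)] by (metis length_filter_le)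
  finally show ?thesis .
qed

lemma size_filter_mset_nth: "size (filter_mset P (mset xs)) = card {j. j < length xs \<and> P (xs ! j)}"
  by (simp add: length_filter_conv_card flip: mset_filter)

text \<open>The matching need not respect the order of the sizes, but counting does: at least i + 1
  sizes reach us ! i - \<kappa>, and at most i exceed us ! i + \<kappa>, because the unmatched ones
  are below every prescribed value.\<close>

lemma matches_nth_size:
  assumes m: "matches l \<kappa> us (\<lambda>Z. \<forall>x\<in>#Z. real x < \<delta> * l) X" and l: "0 < l"
    and us: "sorted_wrt (\<ge>) us" "\<And>u. u \<in> set us \<Longrightarrow> \<delta> + \<kappa> \<le> u" and \<delta>: "0 < \<delta>" "0 \<le> \<kappa>"
  shows "i < length us \<Longrightarrow> \<bar>real (nth_size X i) / l - us ! i\<bar> \<le> \<kappa>"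
    and "length us \<le> i \<Longrightarrow> real (nth_size X i) / l < \<delta>"
proof -
  obtain xs Z where X: "X = mset xs + Z" "list_all2 (\<lambda>x u. \<bar>real x / l - u\<bar> \<le> \<kappa>) xs us" "\<forall>x\<in>#Z. real x < \<delta> * l"
    using m by (auto simp: matches_def)
  have len: "length xs = length us" using X(2) by (rule list_all2_lengthD)
  have x: "\<bar>real (xs ! j) / l - us ! j\<bar> \<le> \<kappa>" if "j < length us" for j
    using X(2) that by (simp add: list_all2_conv_all_nth)
  have sorted: "us ! k \<le> us ! j" if "j \<le> k" "k < length us" for j k
    using us(1) that by (cases "j = k") (auto simp: sorted_wrt_iff_nth_less)
  {
    assume i: "i < length us"
    have u: "\<delta> + \<kappa> \<le> us ! i" using us(2) i by simp
    have "(us ! i - \<kappa>) * l \<le> real (nth_size X i)"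
    proof -
      let ?P = "\<lambda>x. (us ! i - \<kappa>) * l \<le> real x"
      have "card {..i} \<le> card {j. j < length xs \<and> ?P (xs ! j)}"
      proof (rule card_mono)
        show "{..i} \<subseteq> {j. j < length xs \<and> ?P (xs ! j)}"
        proof
          fix j assume "j \<in> {..i}"
          then have j: "j \<le> i" "j < length us" using i by auto
          then have "us ! i - \<kappa> \<le> real (xs ! j) / l" using x[OF j(2)] sorted[OF j(1) i] by linarith
          then show "j \<in> {j. j < length xs \<and> ?P (xs ! j)}" using j len l by (simp add: le_divide_eq)
        qed
      qed simp
      then have "i < size (filter_mset ?P X)"
        unfolding X(1) by (simp add: size_filter_mset_nth)
      moreover have "\<not> ?P 0"
      proof -
        have "0 < (us ! i - \<kappa>) * l" using u \<delta> l by (intro mult_pos_pos) auto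
        then show ?thesis by simp
      qed
      ultimately show ?thesis using nth_size_iff[of ?P X i] by auto
    qed
    moreover have "real (nth_size X i) \<le> (us ! i + \<kappa>) * l"
    proof (rule ccontr)
      let ?P = "\<lambda>x. (us ! i + \<kappa>) * l < real x"
      assume "\<not> ?thesis"
      moreover have "\<not> ?P 0"
      proof -
        have "0 \<le> (us ! i + \<kappa>) * l" using u \<delta> l by (intro mult_nonneg_nonneg) auto
        then show ?thesis by simp
      qed
      ultimately have "i < size (filter_mset ?P X)" using nth_size_iff[of ?P X i] by auto
      moreover have "filter_mset ?P Z = {#}"
      proof -
        have "\<delta> * l \<le> (us ! i + \<kappa>) * l" using u \<delta> l by (intro mult_right_mono) auto
        with X(3) show ?thesis by (fastforce simp: filter_mset_eq_mempty_iff)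
      qed
      ultimately have "i < card {j. j < length xs \<and> ?P (xs ! j)}"
        unfolding X(1) by (simp add: size_filter_mset_nth)
      also have "\<dots> \<le> card {..<i}"
      proof (rule card_mono)
        show "{j. j < length xs \<and> ?P (xs ! j)} \<subseteq> {..<i}"
        proof
          fix j assume "j \<in> {j. j < length xs \<and> ?P (xs ! j)}"
          then have j: "j < length us" "us ! i + \<kappa> < real (xs ! j) / l" using len l by (auto simp: less_divide_eq)
          have "\<not> i \<le> j"
          proof
            assume "i \<le> j"
            then have "us ! j \<le> us ! i" using j(1) by (rule sorted)
            with x[OF j(1)] j(2) show False by linarith
          qed
          then show "j \<in> {..<i}" by simp
        qed
      qed simp
      finally show False by simp
    qed
    ultimately show "\<bar>real (nth_size X i) / l - us ! i\<bar> \<le> \<kappa>"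
      using l by (simp add: abs_le_iff field_simps)
  }
  {
    assume i: "length us \<le> i"
    have "\<not> \<delta> * l \<le> real (nth_size X i)"
    proof
      assume "\<delta> * l \<le> real (nth_size X i)"
      moreover have "\<not> \<delta> * l \<le> real 0" using \<delta> l by (simp add: not_le)
      ultimately have "i < size (filter_mset (\<lambda>x. \<delta> * l \<le> real x) X)"
        using nth_size_iff[of "\<lambda>x. \<delta> * l \<le> real x" X i] by auto
      with matches_size_large[OF m] i show False by simp
    qed
    then show "real (nth_size X i) / l < \<delta>" using l by (simp add: field_simps not_le)
  }
qed

text \<open>The m largest components are matched in order; \<kappa> < u i guarantees that they
  exist, as a missing one would have size 0.\<close>

lemma nth_size_matches:
  assumes l: "0 < l" and pos: "\<And>i. i < m \<Longrightarrow> \<kappa> < u i"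
    and close: "\<And>i. i < m \<Longrightarrow> \<bar>real (nth_size X i) / l - u i\<bar> \<le> \<kappa>"
    and R: "\<And>Z. (\<And>x. x \<in># Z \<Longrightarrow> x \<le> nth_size X m) \<Longrightarrow> R Z"
  shows "matches l \<kappa> (map u [0..<m]) R X"
proof -
  let ?xs = "rev (sorted_list_of_multiset X)"
  have sorted: "sorted_wrt (\<ge>) ?xs" by (simp add: sorted_wrt_rev)
  have in_range: "i < length ?xs" if "i < m" for i
  proof (rule ccontr)
    assume "\<not> i < length ?xs"
    then have "nth_size X i = 0" by (simp add: nth_size_def)
    with close[OF that] pos[OF that] show False by simp
  qed
  then have m: "m \<le> length ?xs" by (metis not_less order_refl)
  have nth: "nth_size X i = ?xs ! i" if "i < length ?xs" for i using that by (simp add: nth_size_def Let_def)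
  have "X = mset (take m ?xs) + mset (drop m ?xs)"
    by (metis append_take_drop_id mset_append mset_rev mset_sorted_list_of_multiset)
  moreover have "list_all2 (\<lambda>x u. \<bar>real x / l - u\<bar> \<le> \<kappa>) (take m ?xs) (map u [0..<m])"
    using m close nth by (auto simp: list_all2_conv_all_nth)
  moreover have "R (mset (drop m ?xs))"
  proof (rule R)
    fix x assume "x \<in># mset (drop m ?xs)"
    then obtain j where j: "j < length ?xs - m" "x = ?xs ! (m + j)"
      by (auto simp: in_set_conv_nth)
    then show "x \<le> nth_size X m"
      using nth_size_antimono[of m "m + j" X] nth[of "m + j"] by auto
  qed
  ultimately show ?thesis unfolding matches_def by blast
qed

section \<open>Chains of prescribed components\<close>

fun chain_rate :: "real \<Rightarrow> real list \<Rightarrow> real" where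
  "chain_rate t [] = 0"
| "chain_rate t (u # us) = rate t u + chain_rate (t - u) us"

text \<open>\<open>rate t u\<close> equals (t^3 - (t - u)^3) / 6 - u^3 / 24, so the sum telescopes
  and does not depend on the order of the sizes.\<close>

lemma chain_rate_eq:
  "chain_rate t us = (t ^ 3 - (t - sum_list us) ^ 3) / 6 - (\<Sum>u\<leftarrow>us. u ^ 3) / 24"
proof (induction us arbitrary: t)
  case (Cons u us)
  show ?case unfolding chain_rate.simps Cons.IH
    by (simp add: rate_def power2_eq_square power3_eq_cube field_simps)
qed simp

context near_critical
begin

text \<open>Of the 4 \<zeta>, one is the initial error of the drift, two come from the size because
  n p \<le> 2, and one from replacing n p by 1.\<close>

lemma tau_shift:
  assumes "0 < \<epsilon> n" "0 < L n" "k \<le> N" "\<bar>real n * p n - 1\<bar> \<le> 1" "\<bar>real n * p n - 1\<bar> * \<bar>u\<bar> \<le> \<zeta>"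
    "\<bar>real k / L n - u\<bar> \<le> \<zeta>" "\<bar>\<tau> n N - t\<bar> \<le> \<zeta>"
  shows "\<bar>\<tau> n (N - k) - (t - u)\<bar> \<le> 4 * \<zeta>"
proof -
  define y where "y = real k / L n"
  define c where "c = real n * p n"
  have n: "0 < real n" using assms(1,2) by (simp add: L_def zero_less_mult_iff)
  have "\<tau> n (N - k) = \<tau> n N - c * y"
    using assms(1,3) n by (simp add: \<tau>_def y_def c_def L_def of_nat_diff field_simps)
  then have "\<tau> n (N - k) - (t - u) = (\<tau> n N - t) - c * (y - u) - (c - 1) * u"
    by (simp add: algebra_simps)
  moreover have "\<bar>c * (y - u)\<bar> \<le> 2 * \<zeta>"
    unfolding abs_mult using assms(4,6) by (intro mult_mono) (auto simp: c_def y_def)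
  moreover have "\<bar>(c - 1) * u\<bar> \<le> \<zeta>" using assms(5) by (simp add: c_def abs_mult)
  ultimately show ?thesis using assms(7) by linarith
qed

lemma size_law_matches_Cons:
  "size_law (p n) N (\<lambda>X. \<Sum>x\<in>#X. of_bool (\<bar>real x / L n - u\<bar> \<le> \<kappa>) * of_bool (matches (L n) \<kappa> us R (X - {#x#})))
    = (\<Sum>k\<in>{k \<in> {1..N}. real k / L n \<in> cball u \<kappa>}. expected_comps (p n) N k *
        size_law (p n) (N - k) (\<lambda>X. of_bool (matches (L n) \<kappa> us R X)))"
proof -
  have "size_law (p n) N (\<lambda>X. \<Sum>x\<in>#X. of_bool (\<bar>real x / L n - u\<bar> \<le> \<kappa>) * of_bool (matches (L n) \<kappa> us R (X - {#x#})))
    = (\<Sum>k\<in>{1..N}. expected_comps (p n) N k *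
        size_law (p n) (N - k) (\<lambda>X. of_bool (\<bar>real k / L n - u\<bar> \<le> \<kappa>) * of_bool (matches (L n) \<kappa> us R X)))"
    by (rule size_law_sum_comps)
  also have "\<dots> = (\<Sum>k\<in>{k \<in> {1..N}. real k / L n \<in> cball u \<kappa>}. expected_comps (p n) N k *
        size_law (p n) (N - k) (\<lambda>X. of_bool (matches (L n) \<kappa> us R X)))"
    unfolding size_law_cmult
    by (intro sum.mono_neutral_cong_right) (auto simp: dist_real_def abs_minus_commute)
  finally show ?thesis .
qed

text \<open>A union bound: the indicator of a match is at most a sum over the candidates for the
  first component, and its expectation is a product of an expected number and of the remaining
  problem at drift t - u. The property R stays general: it will be smallness of the rest, or no
  condition at all.\<close>

lemma chain_upper:
  assumes "\<And>\<eta>. 0 < \<eta> \<Longrightarrow> \<exists>\<zeta>>0. \<forall>\<^sub>F n in sequentially. \<forall>N. \<bar>\<tau> n N - (t - sum_list us)\<bar> \<le> \<zeta> \<longrightarrow>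
      size_law (p n) N (\<lambda>X. of_bool (R n X)) \<le> exp (\<beta> n * (\<eta> - \<rho>))"
    and "\<And>u. u \<in> set us \<Longrightarrow> 0 < u" and "0 < \<eta>"
  shows "\<exists>\<zeta>>0. \<forall>\<^sub>F n in sequentially. \<forall>N. \<bar>\<tau> n N - t\<bar> \<le> \<zeta> \<longrightarrow>
      size_law (p n) N (\<lambda>X. of_bool (matches (L n) \<zeta> us (R n) X)) \<le> exp (\<beta> n * (\<eta> - (chain_rate t us + \<rho>)))"
  using assms
proof (induction us arbitrary: t \<eta>)
  case Nil
  then show ?case by (simp add: matches_Nil)
next
  case (Cons u us)
  have u: "0 < u" and \<eta>2: "0 < \<eta> / 2" using Cons.prems by auto
  obtain \<zeta>1 where \<zeta>1: "0 < \<zeta>1" "\<forall>\<^sub>F n in sequentially. \<forall>N. \<bar>\<tau> n N - (t - u)\<bar> \<le> \<zeta>1 \<longrightarrow>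
      size_law (p n) N (\<lambda>X. of_bool (matches (L n) \<zeta>1 us (R n) X)) \<le> exp (\<beta> n * (\<eta> / 2 - (chain_rate (t - u) us + \<rho>)))"
    using Cons.IH[of "t - u" "\<eta> / 2"] Cons.prems \<eta>2 by (auto simp: algebra_simps)
  obtain \<zeta>2 where \<zeta>2: "0 < \<zeta>2" "\<forall>\<^sub>F n in sequentially. \<forall>N. \<bar>\<tau> n N - t\<bar> \<le> \<zeta>2 \<longrightarrow>
      comps_in n N (cball u \<zeta>2) \<le> exp (\<beta> n * (\<eta> / 2 - rate t u))"
    using window_upper[OF u \<eta>2] by blast
  define \<zeta> where "\<zeta> = min (\<zeta>1 / 4) \<zeta>2"
  have \<zeta>: "0 < \<zeta>" "4 * \<zeta> \<le> \<zeta>1" "\<zeta> \<le> \<zeta>1" "\<zeta> \<le> \<zeta>2" using \<zeta>1 \<zeta>2 by (auto simp: \<zeta>_def)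
  define r where "r = min 1 (\<zeta> / u)"
  have r: "0 < r" "r \<le> 1" "r * u \<le> \<zeta>" using \<zeta> u by (auto simp: r_def min_def field_simps)
  from \<zeta>1(2) \<zeta>2(2) basic[OF r(1)] L_pos
  have "\<forall>\<^sub>F n in sequentially. \<forall>N. \<bar>\<tau> n N - t\<bar> \<le> \<zeta> \<longrightarrow>
      size_law (p n) N (\<lambda>X. of_bool (matches (L n) \<zeta> (u # us) (R n) X)) \<le> exp (\<beta> n * (\<eta> - (chain_rate t (u # us) + \<rho>)))"
  proof eventually_elim
    case (elim n)
    have P: "0 \<le> p n" "p n \<le> 1" using elim(3) by auto
    show ?case
    proof (intro allI impI)
      fix N assume tN: "\<bar>\<tau> n N - t\<bar> \<le> \<zeta>"
      let ?c = "exp (\<beta> n * (\<eta> / 2 - (chain_rate (t - u) us + \<rho>)))"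
      have sub: "size_law (p n) (N - k) (\<lambda>X. of_bool (matches (L n) \<zeta> us (R n) X)) \<le> ?c"
        if k: "k \<le> N" "real k / L n \<in> cball u \<zeta>" for k
      proof -
        have "\<bar>real n * p n - 1\<bar> * \<bar>u\<bar> \<le> r * \<bar>u\<bar>" using elim(3) by (intro mult_right_mono) auto
        then have nu: "\<bar>real n * p n - 1\<bar> * \<bar>u\<bar> \<le> \<zeta>" using r(3) unfolding abs_of_pos[OF u(1)] by linarith
        have "\<bar>\<tau> n (N - k) - (t - u)\<bar> \<le> 4 * \<zeta>"
          using elim(3,4) k tN r u by (intro tau_shift nu) (auto simp: dist_real_def abs_minus_commute)
        with \<zeta> have "\<bar>\<tau> n (N - k) - (t - u)\<bar> \<le> \<zeta>1" by linarith
        with elim(1) have "size_law (p n) (N - k) (\<lambda>X. of_bool (matches (L n) \<zeta>1 us (R n) X)) \<le> ?c" by blast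
        moreover have "size_law (p n) (N - k) (\<lambda>X. of_bool (matches (L n) \<zeta> us (R n) X))
            \<le> size_law (p n) (N - k) (\<lambda>X. of_bool (matches (L n) \<zeta>1 us (R n) X))"
          using matches_mono[OF _ \<zeta>(3)] by (intro size_law_mono P) auto
        ultimately show ?thesis by linarith
      qed
      have "size_law (p n) N (\<lambda>X. of_bool (matches (L n) \<zeta> (u # us) (R n) X))
          \<le> size_law (p n) N (\<lambda>X. \<Sum>x\<in>#X. of_bool (\<bar>real x / L n - u\<bar> \<le> \<zeta>) * of_bool (matches (L n) \<zeta> us (R n) (X - {#x#})))"
      proof (intro size_law_mono P)
        fix X
        have nonneg: "0 \<le> (\<Sum>x\<in>#Z. of_bool (Q x) * of_bool (S x) :: real)" for Z Q S
          by (induction Z) auto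
        show "of_bool (matches (L n) \<zeta> (u # us) (R n) X)
          \<le> (\<Sum>x\<in>#X. of_bool (\<bar>real x / L n - u\<bar> \<le> \<zeta>) * of_bool (matches (L n) \<zeta> us (R n) (X - {#x#})) :: real)"
        proof (cases "matches (L n) \<zeta> (u # us) (R n) X")
          case True
          then obtain x where x: "x \<in># X" "\<bar>real x / L n - u\<bar> \<le> \<zeta>" "matches (L n) \<zeta> us (R n) (X - {#x#})"
            by (auto simp: matches_Cons)
          from x(1) obtain X' where X': "X = add_mset x X'" using multi_member_split by metis
          show ?thesis unfolding X' using True x nonneg by (simp add: X')
        next
          case False
          then show ?thesis using nonneg by simp
        qed
      qed
      also have "\<dots> = (\<Sum>k\<in>{k \<in> {1..N}. real k / L n \<in> cball u \<zeta>}. expected_comps (p n) N k *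
          size_law (p n) (N - k) (\<lambda>X. of_bool (matches (L n) \<zeta> us (R n) X)))"
        by (rule size_law_matches_Cons)
      also have "\<dots> \<le> (\<Sum>k\<in>{k \<in> {1..N}. real k / L n \<in> cball u \<zeta>}. expected_comps (p n) N k * ?c)"
        using sub by (intro sum_mono mult_left_mono expected_comps_nonneg P) auto
      also have "\<dots> = comps_in n N (cball u \<zeta>) * ?c"
        by (simp add: comps_in_def sum_distrib_right)
      also have "\<dots> \<le> comps_in n N (cball u \<zeta>2) * ?c"
        using \<zeta>(4) by (intro mult_right_mono comps_in_mono P) auto
      also have "\<dots> \<le> exp (\<beta> n * (\<eta> / 2 - rate t u)) * ?c"
        using elim(2) tN \<zeta>(4) by (intro mult_right_mono) auto
      also have "\<dots> = exp (\<beta> n * (\<eta> - (chain_rate t (u # us) + \<rho>)))"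
        by (simp add: exp_add[symmetric] distrib_left[symmetric])
      finally show "size_law (p n) N (\<lambda>X. of_bool (matches (L n) \<zeta> (u # us) (R n) X))
          \<le> exp (\<beta> n * (\<eta> - (chain_rate t (u # us) + \<rho>)))" .
    qed
  qed
  with \<zeta>(1) show ?case by blast
qed

text \<open>The same sum overcounts a match at most m times, since every candidate exceeds \<delta>
  L and a matching multiset has at most m such components. A third of \<eta> absorbs the factor 1 /
  m.\<close>

lemma chain_lower:
  assumes "\<exists>\<zeta>>0. \<forall>\<^sub>F n in sequentially. \<forall>N. \<bar>\<tau> n N - (t - sum_list us)\<bar> \<le> \<zeta> \<longrightarrow> 1/2 \<le> small_prob n N \<delta>"
    and "\<And>u. u \<in> set us \<Longrightarrow> \<delta> + \<kappa> \<le> u" and "0 < \<eta>" "0 < \<kappa>" "0 < \<delta>"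
  shows "\<exists>\<zeta>>0. \<forall>\<^sub>F n in sequentially. \<forall>N. \<bar>\<tau> n N - t\<bar> \<le> \<zeta> \<longrightarrow>
      exp (- (\<beta> n * (chain_rate t us + \<eta>)))
        \<le> size_law (p n) N (\<lambda>X. of_bool (matches (L n) \<kappa> us (\<lambda>Z. \<forall>x\<in>#Z. real x < \<delta> * L n) X))"
  using assms
proof (induction us arbitrary: t \<eta>)
  case Nil
  have "\<forall>\<^sub>F n in sequentially. exp (- (\<eta> * \<beta> n)) \<le> 1/2"
    using Nil by (intro exp_beta_small) auto
  moreover obtain \<zeta> where \<zeta>: "0 < \<zeta>" "\<forall>\<^sub>F n in sequentially. \<forall>N. \<bar>\<tau> n N - t\<bar> \<le> \<zeta> \<longrightarrow> 1/2 \<le> small_prob n N \<delta>"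
    using Nil.prems(1) by auto
  note \<zeta>(2)
  ultimately have "\<forall>\<^sub>F n in sequentially. \<forall>N. \<bar>\<tau> n N - t\<bar> \<le> \<zeta> \<longrightarrow> exp (- (\<beta> n * \<eta>)) \<le> small_prob n N \<delta>"
  proof eventually_elim
    case (elim n)
    show ?case
    proof (intro allI impI)
      fix N assume "\<bar>\<tau> n N - t\<bar> \<le> \<zeta>"
      then have "1/2 \<le> small_prob n N \<delta>" using elim(2) by blast
      with elim(1) show "exp (- (\<beta> n * \<eta>)) \<le> small_prob n N \<delta>" by (simp add: mult.commute)
    qed
  qed
  with \<zeta>(1) show ?case unfolding matches_Nil small_prob_def by (intro exI[of _ \<zeta>]) simp
next
  case (Cons u us)
  let ?R = "\<lambda>n Z. \<forall>x\<in>#Z. real x < \<delta> * L n"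
  define m where "m = real (length (u # us))"
  have m: "0 < m" by (simp add: m_def)
  have "\<delta> + \<kappa> \<le> u" using Cons.prems(2)[of u] by simp
  then have u: "0 < u" "\<delta> + \<kappa> \<le> u" and \<eta>3: "0 < \<eta> / 3" using Cons.prems(3-5) by auto
  obtain \<zeta>1 where \<zeta>1: "0 < \<zeta>1" "\<forall>\<^sub>F n in sequentially. \<forall>N. \<bar>\<tau> n N - (t - u)\<bar> \<le> \<zeta>1 \<longrightarrow>
      exp (- (\<beta> n * (chain_rate (t - u) us + \<eta> / 3)))
        \<le> size_law (p n) N (\<lambda>X. of_bool (matches (L n) \<kappa> us (?R n) X))"
    using Cons.IH[of "t - u" "\<eta> / 3"] Cons.prems \<eta>3 by (auto simp: algebra_simps)
  \<comment> \<open>The first component is fixed more precisely than \<kappa> demands, so that the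
    drift left for the others lies in the range \<zeta>1 of the induction hypothesis.\<close>
  define \<kappa>' where "\<kappa>' = min \<kappa> (\<zeta>1 / 4)"
  have \<kappa>': "0 < \<kappa>'" "\<kappa>' \<le> \<kappa>" "4 * \<kappa>' \<le> \<zeta>1" using \<zeta>1 Cons.prems by (auto simp: \<kappa>'_def)
  obtain \<zeta>2 where \<zeta>2: "0 < \<zeta>2" "\<forall>\<^sub>F n in sequentially. \<forall>N. \<bar>\<tau> n N - t\<bar> \<le> \<zeta>2 \<longrightarrow>
      exp (- (\<beta> n * (rate t u + \<eta> / 3))) \<le> comps_in n N (cball u \<kappa>')"
    using window_lower[OF u(1) \<eta>3 \<kappa>'(1)] by blast
  define \<zeta> where "\<zeta> = min \<kappa>' \<zeta>2"
  have \<zeta>: "0 < \<zeta>" "\<zeta> \<le> \<kappa>'" "\<zeta> \<le> \<zeta>2" using \<kappa>' \<zeta>2 by (auto simp: \<zeta>_def)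
  define r where "r = min 1 (\<kappa>' / u)"
  have r: "0 < r" "r \<le> 1" "r * u \<le> \<kappa>'" using \<kappa>' u by (auto simp: r_def min_def field_simps)
  have "\<forall>\<^sub>F n in sequentially. exp (- (\<eta> / 3 * \<beta> n)) \<le> 1 / m"
    using \<eta>3 m by (intro exp_beta_small) auto
  with \<zeta>1(2) \<zeta>2(2) basic[OF r(1)] L_pos
  have "\<forall>\<^sub>F n in sequentially. \<forall>N. \<bar>\<tau> n N - t\<bar> \<le> \<zeta> \<longrightarrow>
      exp (- (\<beta> n * (chain_rate t (u # us) + \<eta>)))
        \<le> size_law (p n) N (\<lambda>X. of_bool (matches (L n) \<kappa> (u # us) (?R n) X))"
  proof eventually_elim
    case (elim n)
    have P: "0 \<le> p n" "p n \<le> 1" using elim(3) by auto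
    show ?case
    proof (intro allI impI)
      fix N assume tN: "\<bar>\<tau> n N - t\<bar> \<le> \<zeta>"
      let ?c = "exp (- (\<beta> n * (chain_rate (t - u) us + \<eta> / 3)))"
      let ?S = "\<lambda>k. size_law (p n) (N - k) (\<lambda>X. of_bool (matches (L n) \<kappa> us (?R n) X))"
      let ?T = "\<lambda>X. \<Sum>x\<in>#X. of_bool (\<bar>real x / L n - u\<bar> \<le> \<kappa>) * of_bool (matches (L n) \<kappa> us (?R n) (X - {#x#})) :: real"
      have sub: "?c \<le> ?S k" if k: "k \<le> N" "real k / L n \<in> cball u \<kappa>'" for k
      proof -
        have "\<bar>real n * p n - 1\<bar> * \<bar>u\<bar> \<le> r * \<bar>u\<bar>" using elim(3) by (intro mult_right_mono) auto
        then have nu: "\<bar>real n * p n - 1\<bar> * \<bar>u\<bar> \<le> \<kappa>'" using r(3) unfolding abs_of_pos[OF u(1)] by linarith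
        have "\<bar>\<tau> n (N - k) - (t - u)\<bar> \<le> 4 * \<kappa>'"
          using elim(3,4) k tN r u \<zeta> by (intro tau_shift nu) (auto simp: dist_real_def abs_minus_commute)
        with \<kappa>' have "\<bar>\<tau> n (N - k) - (t - u)\<bar> \<le> \<zeta>1" by linarith
        with elim(1) show ?thesis by blast
      qed
      have S0: "0 \<le> ?S k" for k by (intro size_law_nonneg P) auto
      have "exp (- (\<beta> n * (rate t u + \<eta> / 3))) * ?c \<le> comps_in n N (cball u \<kappa>') * ?c"
        using elim(2) tN \<zeta>(3) by (intro mult_right_mono) auto
      also have "\<dots> \<le> (\<Sum>k\<in>{k \<in> {1..N}. real k / L n \<in> cball u \<kappa>'}. expected_comps (p n) N k * ?S k)"
        unfolding comps_in_def sum_distrib_right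
        using sub by (intro sum_mono mult_left_mono expected_comps_nonneg P) auto
      also have "\<dots> \<le> (\<Sum>k\<in>{k \<in> {1..N}. real k / L n \<in> cball u \<kappa>}. expected_comps (p n) N k * ?S k)"
        using \<kappa>'(2) S0 by (intro sum_mono2 mult_nonneg_nonneg expected_comps_nonneg P) auto
      also have "\<dots> = size_law (p n) N ?T"
        by (rule size_law_matches_Cons[symmetric])
      also have "\<dots> \<le> size_law (p n) N (\<lambda>X. m * of_bool (matches (L n) \<kappa> (u # us) (?R n) X))"
      proof (intro size_law_mono P)
        fix X
        show "?T X \<le> m * of_bool (matches (L n) \<kappa> (u # us) (?R n) X)"
        proof (cases "matches (L n) \<kappa> (u # us) (?R n) X")
          case True
          have large: "\<delta> * L n \<le> real x" if "\<bar>real x / L n - u\<bar> \<le> \<kappa>" for x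
          proof -
            have "\<delta> \<le> real x / L n" using that u by linarith
            with elim(4) show ?thesis by (simp add: le_divide_eq)
          qed
          have "(\<Sum>x\<in>#Z. of_bool (\<bar>real x / L n - u\<bar> \<le> \<kappa>) * of_bool (Q x) :: real)
              \<le> real (size (filter_mset (\<lambda>x. \<delta> * L n \<le> real x) Z))" for Z Q
            by (induction Z) (auto dest: large)
          then have "?T X \<le> real (size (filter_mset (\<lambda>x. \<delta> * L n \<le> real x) X))" .
          also have "\<dots> \<le> m" using matches_size_large[OF True] by (simp add: m_def)
          finally show ?thesis using True by simp
        next
          case False
          then have "of_bool (\<bar>real x / L n - u\<bar> \<le> \<kappa>) * of_bool (matches (L n) \<kappa> us (?R n) (X - {#x#})) = (0::real)"
            if "x \<in># X" for x using that by (auto simp: matches_Cons)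
          then have "?T X = (\<Sum>x\<in>#X. 0)" by (intro arg_cong[where f = sum_mset] image_mset_cong)
          with False show ?thesis by simp
        qed
      qed
      also have "\<dots> = m * size_law (p n) N (\<lambda>X. of_bool (matches (L n) \<kappa> (u # us) (?R n) X))"
        by (rule size_law_cmult)
      finally have "1 / m * (exp (- (\<beta> n * (rate t u + \<eta> / 3))) * ?c)
          \<le> size_law (p n) N (\<lambda>X. of_bool (matches (L n) \<kappa> (u # us) (?R n) X))"
        using m by (simp add: field_simps)
      moreover have "exp (- (\<beta> n * (chain_rate t (u # us) + \<eta>)))
          = exp (- (\<eta> / 3 * \<beta> n)) * (exp (- (\<beta> n * (rate t u + \<eta> / 3))) * ?c)"
        by (simp add: exp_add[symmetric]) (simp add: algebra_simps)
      moreover have "exp (- (\<eta> / 3 * \<beta> n)) * (exp (- (\<beta> n * (rate t u + \<eta> / 3))) * ?c)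
          \<le> 1 / m * (exp (- (\<beta> n * (rate t u + \<eta> / 3))) * ?c)"
        using elim(5) by (intro mult_right_mono) auto
      ultimately show "exp (- (\<beta> n * (chain_rate t (u # us) + \<eta>)))
        \<le> size_law (p n) N (\<lambda>X. of_bool (matches (L n) \<kappa> (u # us) (?R n) X))" by linarith
    qed
  qed
  with \<zeta>(1) show ?case by blast
qed

end

section \<open>Local large deviation bounds\<close>

definition scaled_sizes :: "real \<Rightarrow> nat multiset \<Rightarrow> nat \<Rightarrow> real" where
  "scaled_sizes l X i = real (nth_size X i) / l"

lemma sum_list_map_upt: "(\<Sum>i\<leftarrow>[0..<m]. f i) = (\<Sum>i<m. f i :: real)"
  by (induction m) auto

lemma open_Collect_coordinate_less: "open {v :: nat \<Rightarrow> real. v i < c}"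
  by (intro open_Collect_less continuous_intros continuous_on_product_coordinates)

lemma open_Collect_coordinate_close: "open {v :: nat \<Rightarrow> real. \<bar>v i - c\<bar> < d}"
  by (intro open_Collect_less continuous_intros continuous_on_product_coordinates)

text \<open>A basic open set of the product topology restricts finitely many coordinates only, all
  below some m.\<close>

lemma open_coordinate_neighbourhood:
  fixes u :: "nat \<Rightarrow> real"
  assumes "open V" "u \<in> V"
  obtains m \<kappa> where "0 < \<kappa>" "\<And>v. (\<And>i. i < m \<Longrightarrow> \<bar>v i - u i\<bar> < \<kappa>) \<Longrightarrow> v \<in> V"
proof -
  have "openin (product_topology (\<lambda>_. euclidean) UNIV) V" using assms(1) by (simp add: open_fun_def)
  from product_topology_open_contains_basis[OF this assms(2)] obtain X where
    X: "u \<in> (\<Pi>\<^sub>E i\<in>UNIV. X i)" "\<And>i. open (X i)" "finite {i. X i \<noteq> UNIV}" "(\<Pi>\<^sub>E i\<in>UNIV. X i) \<subseteq> V"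
    by auto
  obtain m where m: "\<And>i. X i \<noteq> UNIV \<Longrightarrow> i < m"
    using finite_nat_set_iff_bounded[of "{i. X i \<noteq> UNIV}"] X(3) by auto
  have "\<exists>e>0. \<forall>y. \<bar>y - u i\<bar> < e \<longrightarrow> y \<in> X i" for i
    using X(1,2) unfolding open_dist dist_real_def by auto
  then obtain e where e: "\<And>i. 0 < e i" "\<And>i y. \<bar>y - u i\<bar> < e i \<Longrightarrow> y \<in> X i" by metis
  define \<kappa> where "\<kappa> = Min (insert 1 (e ` {..<m}))"
  have \<kappa>: "0 < \<kappa>" "\<And>i. i < m \<Longrightarrow> \<kappa> \<le> e i" using e(1) by (auto simp: \<kappa>_def)
  show ?thesis
  proof (rule that[OF \<kappa>(1)])
    fix v :: "nat \<Rightarrow> real" assume v: "\<And>i. i < m \<Longrightarrow> \<bar>v i - u i\<bar> < \<kappa>"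
    have "v i \<in> X i" for i
    proof (cases "i < m")
      case True
      then show ?thesis using v \<kappa>(2) e(2) by (meson less_le_trans)
    next
      case False
      then show ?thesis using m[of i] by auto
    qed
    then show "v \<in> V" using X(4) by auto
  qed
qed

lemma nonincreasing_seqs_zero:
  assumes "u \<in> nonincreasing_seqs" "u m = 0" "m \<le> i"
  shows "u i = 0"
proof -
  have "u i \<le> u m" using assms decseqD[of u m i] by (simp add: nonincreasing_seqs_def)
  moreover have "0 \<le> u i" using assms(1) by (simp add: nonincreasing_seqs_def)
  ultimately show ?thesis using assms(2) by simp
qed

lemma summable_cubes:
  assumes u: "u \<in> nonincreasing_seqs" and "summable u"
  shows "summable (\<lambda>i. u i ^ 3)"
proof (rule summable_comparison_test')
  show "summable (\<lambda>i. (u 0)\<^sup>2 * u i)" using assms by (intro summable_mult)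
  fix i :: nat
  have "0 \<le> u i" "u i \<le> u 0" using u by (auto simp: nonincreasing_seqs_def decseq_def)
  then show "norm (u i ^ 3) \<le> (u 0)\<^sup>2 * u i"
    by (auto simp: power3_eq_cube power2_eq_square intro!: mult_mono mult_right_mono)
qed

text \<open>The chain bounds need positive entries. If some entry is 0, the prefix before the first
  such entry is exact; otherwise a long prefix is accurate by convergence.\<close>

lemma positive_prefix:
  assumes u: "u \<in> nonincreasing_seqs" "summable u" and e: "0 < e"
  obtains m where "\<And>i. i < m \<Longrightarrow> 0 < u i" "u m < e" "\<bar>(\<Sum>i<m. u i) - suminf u\<bar> < e"
    "\<bar>(\<Sum>i<m. u i ^ 3) - (\<Sum>i. u i ^ 3)\<bar> < e"
proof (cases "\<exists>i. u i = 0")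
  case True
  define m where "m = (LEAST i. u i = 0)"
  have m: "u m = 0" unfolding m_def using True by (rule LeastI_ex)
  have pos: "0 < u i" if "i < m" for i
    using not_less_Least[of i "\<lambda>i. u i = 0"] that u(1) unfolding m_def nonincreasing_seqs_def
    by (auto simp: less_le)
  have "suminf u = (\<Sum>i<m. u i)" "(\<Sum>i. u i ^ 3) = (\<Sum>i<m. u i ^ 3)"
  proof -
    have "u i = 0" if "i \<notin> {..<m}" for i
      using nonincreasing_seqs_zero[OF u(1) m, of i] that by simp
    then show "suminf u = (\<Sum>i<m. u i)" "(\<Sum>i. u i ^ 3) = (\<Sum>i<m. u i ^ 3)"
      by (intro suminf_finite; simp)+
  qed
  with pos m e show ?thesis by (intro that[of m]) auto
next
  case False
  then have pos: "0 < u i" for i using u(1) by (auto simp: nonincreasing_seqs_def less_le)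
  have "(\<lambda>m. \<Sum>i<m. u i) \<longlonglongrightarrow> suminf u" "(\<lambda>m. \<Sum>i<m. u i ^ 3) \<longlonglongrightarrow> (\<Sum>i. u i ^ 3)"
    using u summable_cubes by (auto intro: summable_LIMSEQ)
  then have "\<forall>\<^sub>F m in sequentially. \<bar>(\<Sum>i<m. u i) - suminf u\<bar> < e"
    "\<forall>\<^sub>F m in sequentially. \<bar>(\<Sum>i<m. u i ^ 3) - (\<Sum>i. u i ^ 3)\<bar> < e"
    using e unfolding tendsto_iff dist_real_def by auto
  moreover have "\<forall>\<^sub>F m in sequentially. u m < e"
    using order_tendstoD(2)[OF summable_LIMSEQ_zero[OF u(2)] e] .
  ultimately have "\<forall>\<^sub>F m in sequentially. u m < e \<and> \<bar>(\<Sum>i<m. u i) - suminf u\<bar> < e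
      \<and> \<bar>(\<Sum>i<m. u i ^ 3) - (\<Sum>i. u i ^ 3)\<bar> < e"
    by eventually_elim auto
  then obtain m where "u m < e \<and> \<bar>(\<Sum>i<m. u i) - suminf u\<bar> < e \<and> \<bar>(\<Sum>i<m. u i ^ 3) - (\<Sum>i. u i ^ 3)\<bar> < e"
    using eventually_happens'[OF sequentially_bot] by blast
  with pos show ?thesis by (intro that[of m]) auto
qed

lemma cube_superadditive: "0 \<le> a \<Longrightarrow> 0 \<le> r \<Longrightarrow> a ^ 3 + r ^ 3 \<le> (a + r :: real) ^ 3"
proof -
  assume "0 \<le> a" "0 \<le> r"
  moreover have "(a + r) ^ 3 = a ^ 3 + r ^ 3 + 3 * a * r * (a + r)" by (simp add: power3_eq_cube algebra_simps)
  ultimately show ?thesis by simp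
qed

lemma cube_mono: "(x::real) \<le> y \<Longrightarrow> x ^ 3 \<le> y ^ 3"
  by (simp add: power_mono_odd)

lemma max_cube: "max (x ^ 3) 0 = (max x (0::real)) ^ 3"
  by (cases "0 \<le> x") (auto simp: max_def power_less_zero_eq not_le zero_le_power_eq)

context near_critical
begin

lemma tau_self_close:
  assumes "0 < \<zeta>"
  shows "\<forall>\<^sub>F n in sequentially. \<bar>\<tau> n n - \<theta>\<bar> \<le> \<zeta>"
proof -
  have "(\<lambda>n. \<tau> n n) \<longlonglongrightarrow> \<theta>" using drift by (simp add: \<tau>_def mult.commute)
  then show ?thesis using assms unfolding tendsto_iff dist_real_def
    by (auto elim!: allE[of _ \<zeta>] eventually_mono)
qed

lemma scaled_sizes_tight: "\<exists>M. \<forall>\<^sub>F n in sequentially.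
    size_law (p n) n (\<lambda>X. of_bool (M \<le> scaled_sizes (L n) X 0)) \<le> exp (- (a * \<beta> n))"
proof -
  define a' where "a' = max a 1"
  have a': "0 < a'" "a \<le> a'" by (auto simp: a'_def)
  obtain M where M: "0 < M" "\<forall>\<^sub>F n in sequentially. \<forall>N. \<tau> n N \<le> \<theta> + 1 \<longrightarrow> comps_in n N {M..} \<le> exp (- (a' * \<beta> n))"
    using tail_upper[OF a'(1)] by blast
  have "\<forall>\<^sub>F n in sequentially.
    size_law (p n) n (\<lambda>X. of_bool (M \<le> scaled_sizes (L n) X 0)) \<le> exp (- (a * \<beta> n))"
    using M(2) tau_self_close[OF zero_less_one] basic[OF zero_less_one] L_pos
  proof eventually_elim
    case (elim n)
    have P: "0 \<le> p n" "p n \<le> 1" using elim by auto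
    have "size_law (p n) n (\<lambda>X. of_bool (M \<le> scaled_sizes (L n) X 0))
        \<le> size_law (p n) n (\<lambda>X. 1 - of_bool (\<forall>x\<in>#X. real x < M * L n))"
    proof (intro size_law_mono P)
      fix X
      have "\<exists>x\<in>#X. M * L n \<le> real x" if "M \<le> scaled_sizes (L n) X 0"
      proof -
        have "M * L n \<le> real (nth_size X 0)" using that elim(4) by (simp add: scaled_sizes_def le_divide_eq)
        moreover have "\<not> M * L n \<le> real 0" using M(1) elim(4) by (simp add: not_le)
        ultimately have "0 < size (filter_mset (\<lambda>x. M * L n \<le> real x) X)"
          using nth_size_iff[of "\<lambda>x. M * L n \<le> real x" X 0] by auto
        then show ?thesis by (auto simp: nonempty_has_size[symmetric])
      qed
      then show "of_bool (M \<le> scaled_sizes (L n) X 0) \<le> 1 - (of_bool (\<forall>x\<in>#X. real x < M * L n) :: real)"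
        by (auto simp: not_less[symmetric])
    qed
    also have "\<dots> = 1 - small_prob n n M"
      using size_law_add[of "p n" n "\<lambda>_. 1" "\<lambda>X. (- 1) * of_bool (\<forall>x\<in>#X. real x < M * L n)"]
      unfolding size_law_cmult by (simp add: size_law_total small_prob_def)
    also have "\<dots> \<le> comps_in n n {M..}"
      using small_prob_plus_comps_in[OF P elim(4), of n M] by linarith
    also have "\<dots> \<le> exp (- (a' * \<beta> n))"
    proof -
      have "\<tau> n n \<le> \<theta> + 1" using elim(2) by linarith
      with elim(1) show ?thesis by blast
    qed
    also have "\<dots> \<le> exp (- (a * \<beta> n))" using a' elim(3) by (simp add: mult_right_mono)
    finally show ?case .
  qed
  then show ?thesis by blast
qed

text \<open>The part common to the summable and the other case. Nearness of the first m coordinates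
  yields a match of the prefix; the neighbourhood \<open>W\<close> yields the property
  \<open>R\<close> of all further components, whose decay rate \<rho> is added to the chain
  rate.\<close>

lemma local_upper_prefix:
  fixes u :: "nat \<Rightarrow> real"
  assumes pos: "\<And>i. i < m \<Longrightarrow> 0 < u i" and W: "open W" "u \<in> W"
    and R: "\<And>n X Z. 0 < L n \<Longrightarrow> scaled_sizes (L n) X \<in> W \<Longrightarrow> (\<And>x. x \<in># Z \<Longrightarrow> x \<le> nth_size X m) \<Longrightarrow> R n Z"
    and decay: "\<And>\<eta>. 0 < \<eta> \<Longrightarrow> \<exists>\<zeta>>0. \<forall>\<^sub>F n in sequentially. \<forall>N. \<bar>\<tau> n N - (\<theta> - (\<Sum>i<m. u i))\<bar> \<le> \<zeta> \<longrightarrow>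
      size_law (p n) N (\<lambda>X. of_bool (R n X)) \<le> exp (\<beta> n * (\<eta> - \<rho>))"
    and a: "a < chain_rate \<theta> (map u [0..<m]) + \<rho>"
  shows "\<exists>V. open V \<and> u \<in> V \<and> (\<forall>\<^sub>F n in sequentially.
    size_law (p n) n (\<lambda>X. of_bool (scaled_sizes (L n) X \<in> V)) \<le> exp (- (a * \<beta> n)))"
proof -
  let ?us = "map u [0..<m]"
  define \<eta> where "\<eta> = chain_rate \<theta> ?us + \<rho> - a"
  have \<eta>: "0 < \<eta>" using a by (simp add: \<eta>_def)
  obtain \<zeta> where \<zeta>: "0 < \<zeta>" "\<forall>\<^sub>F n in sequentially. \<forall>N. \<bar>\<tau> n N - \<theta>\<bar> \<le> \<zeta> \<longrightarrow>
      size_law (p n) N (\<lambda>X. of_bool (matches (L n) \<zeta> ?us (R n) X)) \<le> exp (\<beta> n * (\<eta> - (chain_rate \<theta> ?us + \<rho>)))"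
  proof -
    have us_pos: "0 < x" if "x \<in> set ?us" for x using that pos by auto
    have "\<exists>\<zeta>>0. \<forall>\<^sub>F n in sequentially. \<forall>N. \<bar>\<tau> n N - \<theta>\<bar> \<le> \<zeta> \<longrightarrow>
      size_law (p n) N (\<lambda>X. of_bool (matches (L n) \<zeta> ?us (R n) X)) \<le> exp (\<beta> n * (\<eta> - (chain_rate \<theta> ?us + \<rho>)))"
      by (rule chain_upper[OF _ us_pos \<eta>]) (unfold sum_list_map_upt, rule decay)
    then show thesis using that by blast
  qed
  \<comment> \<open>At most half of each prescribed entry, so that a nearby value is positive and
    belongs to an actual component.\<close>
  define \<kappa> where "\<kappa> = Min (insert \<zeta> ((\<lambda>i. u i / 2) ` {..<m}))"
  have \<kappa>: "0 < \<kappa>" "\<kappa> \<le> \<zeta>" "\<And>i. i < m \<Longrightarrow> \<kappa> < u i"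
  proof -
    show "0 < \<kappa>" "\<kappa> \<le> \<zeta>" using pos \<zeta> by (auto simp: \<kappa>_def)
    fix i assume i: "i < m"
    then have "\<kappa> \<le> u i / 2" unfolding \<kappa>_def by (intro Min_le) auto
    then show "\<kappa> < u i" using pos[OF i] by linarith
  qed
  define V where "V = W \<inter> (\<Inter>i\<in>{..<m}. {v. \<bar>v i - u i\<bar> < \<kappa>})"
  have "open V" unfolding V_def
    by (intro open_Int W open_INT ballI open_Collect_coordinate_close finite_lessThan)
  moreover have "u \<in> V" using W \<kappa> by (simp add: V_def)
  moreover have "\<forall>\<^sub>F n in sequentially.
    size_law (p n) n (\<lambda>X. of_bool (scaled_sizes (L n) X \<in> V)) \<le> exp (- (a * \<beta> n))"
    using \<zeta>(2) tau_self_close[OF \<zeta>(1)] basic[OF zero_less_one] L_pos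
  proof eventually_elim
    case (elim n)
    have P: "0 \<le> p n" "p n \<le> 1" using elim by auto
    have "size_law (p n) n (\<lambda>X. of_bool (scaled_sizes (L n) X \<in> V))
        \<le> size_law (p n) n (\<lambda>X. of_bool (matches (L n) \<zeta> ?us (R n) X))"
    proof (intro size_law_mono P)
      fix X
      have "matches (L n) \<zeta> ?us (R n) X" if X: "scaled_sizes (L n) X \<in> V"
      proof (rule matches_mono[OF _ \<kappa>(2)], rule nth_size_matches)
        show "0 < L n" by (rule elim)
        show "\<kappa> < u i" if "i < m" for i by (rule \<kappa>(3)[OF that])
        show "\<bar>real (nth_size X i) / L n - u i\<bar> \<le> \<kappa>" if "i < m" for i
          using X that by (auto simp: V_def scaled_sizes_def less_imp_le)
        show "R n Z" if "\<And>x. x \<in># Z \<Longrightarrow> x \<le> nth_size X m" for Z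
          using R[OF elim(4), of X Z] X that by (auto simp: V_def)
      qed
      then show "of_bool (scaled_sizes (L n) X \<in> V) \<le> (of_bool (matches (L n) \<zeta> ?us (R n) X) :: real)"
        by auto
    qed
    also have "\<dots> \<le> exp (\<beta> n * (\<eta> - (chain_rate \<theta> ?us + \<rho>)))"
      using elim(1,2) by blast
    also have "\<dots> = exp (- (a * \<beta> n))" by (simp add: \<eta>_def mult.commute)
    finally show ?case .
  qed
  ultimately show ?thesis by blast
qed

text \<open>The prefix alone is expensive enough, without a condition on the rest. By
  superadditivity of the cube its chain rate is at least that of one component of size s, its sum,
  which is s (s - 2 \<theta>)^2 / 8 and unbounded in s.\<close>

lemma local_upper_not_summable:
  assumes u: "u \<in> nonincreasing_seqs" "\<not> summable u"
  shows "\<exists>V. open V \<and> u \<in> V \<and> (\<forall>\<^sub>F n in sequentially.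
    size_law (p n) n (\<lambda>X. of_bool (scaled_sizes (L n) X \<in> V)) \<le> exp (- (a * \<beta> n)))"
proof -
  have u0: "0 \<le> u i" for i using u by (simp add: nonincreasing_seqs_def)
  have pos: "0 < u i" for i
  proof (rule ccontr)
    assume "\<not> 0 < u i"
    then have "u i = 0" using u0[of i] by simp
    then have "u j = 0" if "j \<notin> {..<i}" for j using nonincreasing_seqs_zero[OF u(1)] that by auto
    then have "summable u" by (intro summable_finite[of "{..<i}"]) auto
    with u show False by simp
  qed
  \<comment> \<open>Ensures a < s and s / 8 - \<theta> / 2 \<ge> 1 for s \<ge> S, so that s^2 (s / 8
    - \<theta> / 2) already exceeds a.\<close>
  define S where "S = 4 * \<bar>\<theta>\<bar> + 9 + \<bar>a\<bar>"
  have S: "a < (\<theta> ^ 3 - (\<theta> - s) ^ 3) / 6 - s ^ 3 / 24" if "S \<le> s" for s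
  proof -
    have s: "1 \<le> s" "a < s" "1 \<le> s / 8 - \<theta> / 2" using that unfolding S_def by linarith+
    have "a < s * 1" using s by simp
    also have "s * 1 \<le> s * (s * (s / 8 - \<theta> / 2))"
      using s mult_mono[of 1 s 1 "s / 8 - \<theta> / 2"] by (intro mult_left_mono) auto
    also have "\<dots> \<le> s * (s * (s / 8 - \<theta> / 2)) + \<theta>\<^sup>2 * s / 2" using s by simp
    also have "\<dots> = (\<theta> ^ 3 - (\<theta> - s) ^ 3) / 6 - s ^ 3 / 24"
      by (simp add: power2_eq_square power3_eq_cube field_simps)
    finally show ?thesis .
  qed
  have "\<exists>m. S < (\<Sum>i<m. u i)"
  proof (rule ccontr)
    assume "\<not> ?thesis"
    then have "summable u" using u0 by (intro summableI_nonneg_bounded[of u S]) (auto simp: not_less)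
    with u show False by simp
  qed
  then obtain m where m: "S < (\<Sum>i<m. u i)" by blast
  have cubes: "(\<Sum>i<m. u i ^ 3) \<le> (\<Sum>i<m. u i) ^ 3" for m
  proof (induction m)
    case (Suc m)
    have "0 \<le> (\<Sum>i<m. u i)" using u0 by (intro sum_nonneg) auto
    from cube_superadditive[OF this u0[of m]] Suc show ?case by simp
  qed simp
  have "a < chain_rate \<theta> (map u [0..<m]) + 0"
    using S[OF less_imp_le[OF m]] cubes[of m] by (simp add: chain_rate_eq sum_list_map_upt o_def)
  moreover have "\<exists>\<zeta>>0. \<forall>\<^sub>F n in sequentially. \<forall>N. \<bar>\<tau> n N - (\<theta> - (\<Sum>i<m. u i))\<bar> \<le> \<zeta> \<longrightarrow>
      size_law (p n) N (\<lambda>X. of_bool True) \<le> exp (\<beta> n * (\<eta> - 0))" if "0 < \<eta>" for \<eta>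
  proof (intro exI[of _ 1] conjI zero_less_one)
    show "\<forall>\<^sub>F n in sequentially. \<forall>N. \<bar>\<tau> n N - (\<theta> - (\<Sum>i<m. u i))\<bar> \<le> 1 \<longrightarrow>
      size_law (p n) N (\<lambda>X. of_bool True) \<le> exp (\<beta> n * (\<eta> - 0))"
      using beta_ge[of 0] by eventually_elim (use that in \<open>simp add: size_law_total\<close>)
  qed
  ultimately show ?thesis
    by (intro local_upper_prefix[of m u UNIV "\<lambda>_ _. True" 0 a]) (use pos in auto)
qed

text \<open>A long prefix contributes nearly the chain rate of the whole sequence. Near u all later
  coordinates are below \<delta>0, and smallness of the remaining components at drift close to
  \<theta> - s contributes the rest of the action.\<close>

lemma local_upper_summable:
  assumes u: "u \<in> nonincreasing_seqs" "summable u" and a: "ereal a < I_U \<theta> u"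
  shows "\<exists>V. open V \<and> u \<in> V \<and> (\<forall>\<^sub>F n in sequentially.
    size_law (p n) n (\<lambda>X. of_bool (scaled_sizes (L n) X \<in> V)) \<le> exp (- (a * \<beta> n)))"
proof -
  define s where "s = suminf u"
  define C where "C = (\<Sum>i. u i ^ 3)"
  define I where "I = (\<theta> ^ 3 - (\<theta> - s) ^ 3) / 6 - C / 24 + (max (\<theta> - s) 0) ^ 3 / 6"
  \<comment> \<open>The positive part of x^3 is x^3 plus the cube of the negative part of x. This
    rewrites \<open>I_U\<close> as a chain rate plus the cost of small components at the drift left
    over.\<close>
  have "max ((s - \<theta>) ^ 3) 0 = - ((\<theta> - s) ^ 3) + (max (\<theta> - s) 0) ^ 3"
  proof -
    have "(s - \<theta>) ^ 3 = - ((\<theta> - s) ^ 3)" by (simp add: power3_eq_cube algebra_simps)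
    then show ?thesis unfolding max_cube[symmetric] by (simp add: max_def)
  qed
  then have "I_U \<theta> u = ereal I"
    using u(2) unfolding I_U_def I_def s_def[symmetric] C_def[symmetric] by (simp add: field_simps)
  then have aI: "a < I" using a by simp
  \<comment> \<open>A quarter of the gap leaves room for the errors in the sum, in the cubes and in
    the bound for small components.\<close>
  define g where "g = (I - a) / 4"
  have g: "0 < g" using aI by (simp add: g_def)
  obtain \<delta>0 where \<delta>0: "0 < \<delta>0" "\<And>\<delta>. 0 < \<delta> \<Longrightarrow> \<delta> \<le> \<delta>0 \<Longrightarrow> (\<forall>\<^sub>F n in sequentially. \<forall>N. \<bar>\<tau> n N - (\<theta> - s)\<bar> \<le> \<delta>0 \<longrightarrow>
    small_prob n N \<delta> \<le> exp (\<beta> n * (g - (max (\<theta> - s) 0) ^ 3 / 6)))"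
    using small_upper[OF g, of "\<theta> - s"] by blast
  have "isCont (\<lambda>x. (\<theta> ^ 3 - (\<theta> - x) ^ 3) / 6) s" by (intro continuous_intros) auto
  then obtain d where d: "0 < d" "\<And>x. \<bar>x - s\<bar> < d \<Longrightarrow> \<bar>(\<theta> ^ 3 - (\<theta> - x) ^ 3) / 6 - (\<theta> ^ 3 - (\<theta> - s) ^ 3) / 6\<bar> < g"
    using g unfolding continuous_at_eps_delta dist_real_def by metis
  define e where "e = min (min d (\<delta>0 / 2)) g"
  have e: "0 < e" "e \<le> d" "e \<le> \<delta>0 / 2" "e \<le> g" using d \<delta>0 g by (auto simp: e_def)
  obtain m where m: "\<And>i. i < m \<Longrightarrow> 0 < u i" "u m < e" "\<bar>(\<Sum>i<m. u i) - s\<bar> < e" "\<bar>(\<Sum>i<m. u i ^ 3) - C\<bar> < e"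
    using positive_prefix[OF u e(1)] unfolding s_def C_def by blast
  define \<rho> where "\<rho> = (max (\<theta> - s) 0) ^ 3 / 6 - g"
  have chain: "a < chain_rate \<theta> (map u [0..<m]) + \<rho>"
  proof -
    have "\<bar>(\<theta> ^ 3 - (\<theta> - (\<Sum>i<m. u i)) ^ 3) / 6 - (\<theta> ^ 3 - (\<theta> - s) ^ 3) / 6\<bar> < g"
      using m(3) e(2) by (intro d(2)) linarith
    moreover have "chain_rate \<theta> (map u [0..<m])
        = (\<theta> ^ 3 - (\<theta> - (\<Sum>i<m. u i)) ^ 3) / 6 - (\<Sum>i<m. u i ^ 3) / 24"
      by (simp add: chain_rate_eq sum_list_map_upt o_def)
    moreover have "4 * g = I - a" by (simp add: g_def)
    ultimately show ?thesis using m(4) e(4) g unfolding \<rho>_def I_def by linarith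
  qed
  let ?W = "{v :: nat \<Rightarrow> real. v m < \<delta>0}"
  let ?R = "\<lambda>n Z. \<forall>x\<in>#Z. real x < \<delta>0 * L n"
  have decay: "\<exists>\<zeta>>0. \<forall>\<^sub>F n in sequentially. \<forall>N. \<bar>\<tau> n N - (\<theta> - (\<Sum>i<m. u i))\<bar> \<le> \<zeta> \<longrightarrow>
      size_law (p n) N (\<lambda>X. of_bool (?R n X)) \<le> exp (\<beta> n * (\<eta> - \<rho>))" if \<eta>: "0 < \<eta>" for \<eta>
  \<comment> \<open>The other half of the range \<delta>0 covers the difference between the prefix
    sum and s.\<close>
  proof (intro exI[of _ "\<delta>0 / 2"] conjI)
    show "\<forall>\<^sub>F n in sequentially. \<forall>N. \<bar>\<tau> n N - (\<theta> - (\<Sum>i<m. u i))\<bar> \<le> \<delta>0 / 2 \<longrightarrow>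
      size_law (p n) N (\<lambda>X. of_bool (?R n X)) \<le> exp (\<beta> n * (\<eta> - \<rho>))"
      using \<delta>0(2)[OF \<delta>0(1) order.refl] beta_ge[of 0]
    proof eventually_elim
      case (elim n)
      show ?case
      proof (intro allI impI)
        fix N assume "\<bar>\<tau> n N - (\<theta> - (\<Sum>i<m. u i))\<bar> \<le> \<delta>0 / 2"
        then have "\<bar>\<tau> n N - (\<theta> - s)\<bar> \<le> \<delta>0" using m(3) e(3) by linarith
        with elim(1) have "small_prob n N \<delta>0 \<le> exp (\<beta> n * (g - (max (\<theta> - s) 0) ^ 3 / 6))" by blast
        also have "\<dots> \<le> exp (\<beta> n * (\<eta> - \<rho>))"
          using elim(2) \<eta> by (simp add: \<rho>_def mult_left_mono)
        finally show "size_law (p n) N (\<lambda>X. of_bool (?R n X)) \<le> exp (\<beta> n * (\<eta> - \<rho>))"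
          by (simp add: small_prob_def)
      qed
    qed
  qed (use \<delta>0 in simp)
  show ?thesis
  proof (rule local_upper_prefix[of m u ?W ?R \<rho> a])
    show "open ?W" by (rule open_Collect_coordinate_less)
    show "u \<in> ?W" using m(2) e(3) \<delta>0(1) by simp
    fix n X Z
    assume L: "0 < L n" and X: "scaled_sizes (L n) X \<in> ?W" and Z: "\<And>x. x \<in># Z \<Longrightarrow> x \<le> nth_size X m"
    have "real (nth_size X m) < \<delta>0 * L n" using X L by (simp add: scaled_sizes_def field_simps)
    with Z show "?R n Z" by (meson le_less_trans of_nat_mono)
  qed (use m decay chain in auto)
qed

text \<open>The prefix is padded by r components of size d until the total S reaches \<theta>; then
  the remaining drift is not positive and the rest is small with probability at least 1/2. If
  padding occurs, S exceeds \<theta> by at most d, and the cubes of the padding only lower the chain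
  rate.\<close>

lemma local_lower:
  assumes u: "u \<in> nonincreasing_seqs" and a: "I_U \<theta> u < ereal a" and V: "open V" "u \<in> V"
  shows "\<forall>\<^sub>F n in sequentially. exp (- (a * \<beta> n)) \<le> size_law (p n) n (\<lambda>X. of_bool (scaled_sizes (L n) X \<in> V))"
proof -
  have sm: "summable u" using a by (auto simp: I_U_def split: if_splits)
  define s where "s = suminf u"
  define C where "C = (\<Sum>i. u i ^ 3)"
  define g where "g = a - (\<theta> ^ 3 / 6 + max ((s - \<theta>) ^ 3) 0 / 6 - C / 24)"
  have g: "0 < g"
    using a sm unfolding I_U_def s_def[symmetric] C_def[symmetric] g_def by simp
  obtain k \<kappa> where \<kappa>: "0 < \<kappa>" "\<And>v. (\<And>i. i < k \<Longrightarrow> \<bar>v i - u i\<bar> < \<kappa>) \<Longrightarrow> v \<in> V"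
    using open_coordinate_neighbourhood[OF V] by metis
  define e where "e = min (\<kappa> / 2) g"
  have e: "0 < e" "e \<le> \<kappa> / 2" "e \<le> g" using \<kappa> g by (auto simp: e_def)
  obtain m where m: "\<And>i. i < m \<Longrightarrow> 0 < u i" "u m < e" "\<bar>(\<Sum>i<m. u i) - s\<bar> < e" "\<bar>(\<Sum>i<m. u i ^ 3) - C\<bar> < e"
    using positive_prefix[OF u sm e(1)] unfolding s_def C_def by blast
  define sm' where "sm' = (\<Sum>i<m. u i)"
  have dec: "u j \<le> u i" if "i \<le> j" for i j using u that by (auto simp: nonincreasing_seqs_def decseq_def)
  have u0: "0 \<le> u i" for i using u by (auto simp: nonincreasing_seqs_def)
  have sm'_le: "sm' \<le> s" unfolding sm'_def s_def using u0 sm by (intro sum_le_suminf) auto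
  \<comment> \<open>Bounded by the last prefix entry, to keep the padded list decreasing; by
    \<kappa> / 4, to keep the padding inside the neighbourhood; by 1 and g, to get d^3 \<le>
    g.\<close>
  define d where "d = min (min 1 g) (min (\<kappa> / 4) (if m = 0 then 1 else u (m - 1)))"
  have d: "0 < d" "d \<le> 1" "d \<le> g" "d \<le> \<kappa> / 4" "\<And>i. i < m \<Longrightarrow> d \<le> u i"
  proof -
    show "0 < d" using m(1)[of "m - 1"] \<kappa> g by (auto simp: d_def)
    show "d \<le> 1" "d \<le> g" "d \<le> \<kappa> / 4" by (auto simp: d_def)
    fix i assume i: "i < m"
    then have "u (m - 1) \<le> u i" by (intro dec) auto
    moreover have "d \<le> u (m - 1)" using i by (auto simp: d_def)
    ultimately show "d \<le> u i" by simp
  qed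
  \<comment> \<open>The conversion \<open>nat\<close> yields 0, hence no padding, if the prefix sum
    is already at least \<theta>.\<close>
  define r where "r = nat \<lceil>(\<theta> - sm') / d\<rceil>"
  define us where "us = map u [0..<m] @ replicate r d"
  define S where "S = sum_list us"
  have S: "S = sm' + real r * d"
    by (simp add: S_def us_def sum_list_map_upt sm'_def sum_list_replicate)
  have r: "(\<theta> - sm') / d \<le> real r" "r = 0 \<or> real r < (\<theta> - sm') / d + 1"
    unfolding r_def by linarith+
  have S_ge: "\<theta> \<le> S" using r(1) d(1) by (simp add: S field_simps)
  have S_le: "S - \<theta> \<le> d \<or> r = 0" using r(2) d(1) by (auto simp: S field_simps)
  have cube_le: "(S - \<theta>) ^ 3 \<le> max ((s - \<theta>) ^ 3) 0 + g"
    using S_le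
  proof
    assume "S - \<theta> \<le> d"
    then have "(S - \<theta>) ^ 3 \<le> d ^ 3" by (rule cube_mono)
    also have "\<dots> \<le> d ^ 1" using d by (intro power_decreasing) auto
    finally show ?thesis using d(3) by simp
  next
    assume "r = 0"
    then have "S - \<theta> \<le> s - \<theta>" using sm'_le by (simp add: S)
    then have "(S - \<theta>) ^ 3 \<le> (s - \<theta>) ^ 3" by (rule cube_mono)
    then show ?thesis using g by simp
  qed
  have cubes: "C - g \<le> (\<Sum>x\<leftarrow>us. x ^ 3)"
  proof -
    have "(\<Sum>x\<leftarrow>us. x ^ 3) = (\<Sum>i<m. u i ^ 3) + real r * d ^ 3"
      by (simp add: us_def sum_list_map_upt sum_list_replicate o_def)
    moreover have "0 \<le> real r * d ^ 3" using d by simp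
    ultimately show ?thesis using m(4) e(3) by linarith
  qed
  have chain: "chain_rate \<theta> us < a"
  proof -
    have "chain_rate \<theta> us = (\<theta> ^ 3 + (S - \<theta>) ^ 3) / 6 - (\<Sum>x\<leftarrow>us. x ^ 3) / 24"
      unfolding chain_rate_eq S_def[symmetric] by (simp add: power3_eq_cube algebra_simps)
    then show ?thesis using cube_le cubes g unfolding g_def by (simp add: field_simps)
  qed
  have us_ge: "d \<le> x" if "x \<in> set us" for x using that d(5) by (auto simp: us_def)
  have us_sorted: "sorted_wrt (\<ge>) us"
  proof -
    have "sorted_wrt (\<ge>) (map u [0..<m])" "sorted_wrt (\<ge>) (replicate r d)"
      using dec by (auto simp: sorted_wrt_iff_nth_less)
    then show ?thesis using d(5) by (auto simp: us_def sorted_wrt_append)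
  qed
  define \<eta> where "\<eta> = a - chain_rate \<theta> us"
  have d2: "0 < d / 2" using d by simp
  have "\<exists>\<zeta>>0. \<forall>\<^sub>F n in sequentially. \<forall>N. \<bar>\<tau> n N - (\<theta> - sum_list us)\<bar> \<le> \<zeta> \<longrightarrow> 1/2 \<le> small_prob n N (d / 2)"
    using S_ge d2 unfolding S_def by (intro small_lower) auto
  then obtain \<zeta> where \<zeta>: "0 < \<zeta>" "\<forall>\<^sub>F n in sequentially. \<forall>N. \<bar>\<tau> n N - \<theta>\<bar> \<le> \<zeta> \<longrightarrow>
      exp (- (\<beta> n * (chain_rate \<theta> us + \<eta>)))
        \<le> size_law (p n) N (\<lambda>X. of_bool (matches (L n) (d / 2) us (\<lambda>Z. \<forall>x\<in>#Z. real x < d / 2 * L n) X))"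
    using chain_lower[of \<theta> us "d / 2" "d / 2" \<eta>] us_ge d2 chain by (auto simp: \<eta>_def)
  from \<zeta>(2) tau_self_close[OF \<zeta>(1)] basic[OF zero_less_one] L_pos
  show ?thesis
  proof eventually_elim
    case (elim n)
    have P: "0 \<le> p n" "p n \<le> 1" using elim by auto
    have "exp (- (a * \<beta> n)) = exp (- (\<beta> n * (chain_rate \<theta> us + \<eta>)))"
      by (simp add: \<eta>_def mult.commute)
    also have "\<dots> \<le> size_law (p n) n (\<lambda>X. of_bool (matches (L n) (d / 2) us (\<lambda>Z. \<forall>x\<in>#Z. real x < d / 2 * L n) X))"
      using elim(1,2) by blast
    also have "\<dots> \<le> size_law (p n) n (\<lambda>X. of_bool (scaled_sizes (L n) X \<in> V))"
    proof (intro size_law_mono P)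
      fix X
      have "scaled_sizes (L n) X \<in> V" if mt: "matches (L n) (d / 2) us (\<lambda>Z. \<forall>x\<in>#Z. real x < d / 2 * L n) X"
      proof (rule \<kappa>(2))
        fix i
        let ?w = "scaled_sizes (L n) X i"
        have w0: "0 \<le> ?w" using elim(4) by (simp add: scaled_sizes_def)
        have us2: "d / 2 + d / 2 \<le> x" if "x \<in> set us" for x using us_ge[OF that] by simp
        \<comment> \<open>Tolerance and threshold are both d / 2, so every prescribed size, being at
          least d, is separated from the unmatched components.\<close>
        note near = matches_nth_size[OF mt elim(4) us_sorted us2 d2 less_imp_le[OF d2], of i]
        show "\<bar>?w - u i\<bar> < \<kappa>"
        proof (cases "i < m")
          case True
          then have "us ! i = u i" "i < length us" by (auto simp: us_def nth_append)
          then have "\<bar>?w - u i\<bar> \<le> d / 2" using near(1) by (simp add: scaled_sizes_def)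
          with d \<kappa>(1) show ?thesis by linarith
        next
          case False
          then have ui: "u i < \<kappa> / 2" using dec[of m i] m(2) e(2) by auto
          have "?w \<le> 2 * d"
          proof (cases "i < length us")
            case True
            then have "us ! i = d" using False by (auto simp: us_def nth_append)
            then have "\<bar>?w - d\<bar> \<le> d / 2" using near(1) True by (simp add: scaled_sizes_def)
            with d show ?thesis by linarith
          next
            case False
            then have "?w < d / 2" using near(2) by (simp add: scaled_sizes_def)
            with d show ?thesis by linarith
          qed
          then show ?thesis using ui u0[of i] w0 d \<kappa>(1) by linarith
        qed
      qed
      then show "of_bool (matches (L n) (d / 2) us (\<lambda>Z. \<forall>x\<in>#Z. real x < d / 2 * L n) X)
          \<le> (of_bool (scaled_sizes (L n) X \<in> V) :: real)" by auto
    qed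
    finally show ?case .
  qed
qed

end

section \<open>Large deviation principles from local bounds\<close>

lemma log_prob_le:
  assumes "0 \<le> q" "q \<le> exp (- (a * k))" "0 < k"
  shows "ereal (1 / k) * log_prob q \<le> ereal (- a)"
proof (cases "q = 0")
  case False
  with assms have "ln q \<le> ln (exp (- (a * k)))" by (subst ln_le_cancel_iff) auto
  then have "ln q \<le> - (a * k)" by simp
  then show ?thesis using False assms(3) by (simp add: log_prob_def field_simps)
qed (use assms(3) in \<open>simp add: log_prob_def\<close>)

lemma log_prob_ge:
  assumes "exp (- (a * k)) \<le> q" "0 < k"
  shows "ereal (- a) \<le> ereal (1 / k) * log_prob q"
proof -
  have q: "0 < q" using assms(1) by (rule less_le_trans[OF exp_gt_zero])
  then have "- (a * k) \<le> ln q" using assms by (simp add: ln_ge_iff)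
  then show ?thesis using q assms(2) by (simp add: log_prob_def field_simps)
qed

text \<open>Exponential tightness and bounds near single points. Nothing is assumed about I itself;
  its properties as an action functional are extracted from the bounds.\<close>

locale large_deviation_bounds =
  fixes S :: "'a::metric_space set" and M :: "nat \<Rightarrow> 'b measure" and X :: "nat \<Rightarrow> 'b \<Rightarrow> 'a"
    and k :: "nat \<Rightarrow> real" and I :: "'a \<Rightarrow> ereal"
  assumes prob: "\<And>n. prob_space (M n)"
    and measurable: "\<And>n. X n \<in> M n \<rightarrow>\<^sub>M restrict_space borel S"
    and scale: "filterlim k at_top sequentially"
    and tight: "\<And>a. \<exists>K. compact K \<and> K \<subseteq> S \<and>
      (\<forall>\<^sub>F n in sequentially. measure (M n) {\<omega> \<in> space (M n). X n \<omega> \<in> - K} \<le> exp (- (a * k n)))"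
    and local_upper: "\<And>x a. x \<in> S \<Longrightarrow> ereal a < I x \<Longrightarrow> \<exists>V. open V \<and> x \<in> V \<and>
      (\<forall>\<^sub>F n in sequentially. measure (M n) {\<omega> \<in> space (M n). X n \<omega> \<in> V} \<le> exp (- (a * k n)))"
    and local_lower: "\<And>x a V. x \<in> S \<Longrightarrow> I x < ereal a \<Longrightarrow> open V \<Longrightarrow> x \<in> V \<Longrightarrow>
      \<forall>\<^sub>F n in sequentially. exp (- (a * k n)) \<le> measure (M n) {\<omega> \<in> space (M n). X n \<omega> \<in> V}"
begin

abbreviation P :: "nat \<Rightarrow> 'a set \<Rightarrow> real" where
  "P n A \<equiv> measure (M n) {\<omega> \<in> space (M n). X n \<omega> \<in> A}"

lemma X_in: "\<omega> \<in> space (M n) \<Longrightarrow> X n \<omega> \<in> S"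
  using measurable_space[OF measurable[of n], of \<omega>] by (simp add: space_restrict_space)

lemma event_measurable:
  assumes "A \<in> sets borel"
  shows "{\<omega> \<in> space (M n). X n \<omega> \<in> A} \<in> sets (M n)"
proof -
  have "X n -` (A \<inter> S) \<inter> space (M n) \<in> sets (M n)"
  proof (rule measurable_sets[OF measurable])
    show "A \<inter> S \<in> sets (restrict_space borel S)"
      using assms by (auto simp: sets_restrict_space)
  qed
  also have "X n -` (A \<inter> S) \<inter> space (M n) = {\<omega> \<in> space (M n). X n \<omega> \<in> A}"
    using X_in by auto
  finally show ?thesis .
qed

lemma P_mono:
  assumes "A \<inter> S \<subseteq> B" "B \<in> sets borel"
  shows "P n A \<le> P n B"
proof -
  interpret prob_space "M n" by (rule prob)
  show ?thesis using assms X_in by (intro finite_measure_mono event_measurable) auto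
qed

lemma P_le_1: "P n A \<le> 1"
  using prob_space.prob_le_1[OF prob] by blast

lemma scale_pos: "\<forall>\<^sub>F n in sequentially. c < k n"
  using scale by (simp add: filterlim_at_top_dense)

text \<open>Upper and lower bound concern the same probability, so an upper exponent valid on an
  open set cannot exceed I at any of its points.\<close>

lemma local_bounds_consistent:
  assumes "x \<in> S" "I x < ereal a" "open V" "x \<in> V"
    and "\<forall>\<^sub>F n in sequentially. P n V \<le> exp (- (c * k n))"
  shows "c < a"
proof (rule ccontr)
  assume "\<not> c < a"
  obtain a' where a': "I x < ereal a'" "a' < a" using ereal_dense2[OF assms(2)] by auto
  have "\<forall>\<^sub>F n in sequentially. False"
    using local_lower[OF assms(1) a'(1) assms(3,4)] assms(5) scale_pos[of 0]
  proof eventually_elim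
    case (elim n)
    then have "exp (- (a' * k n)) \<le> exp (- (c * k n))" by linarith
    then have "c * k n \<le> a' * k n" by simp
    with elim(3) a'(2) \<open>\<not> c < a\<close> show False by simp
  qed
  then show False by simp
qed

lemma rate_nonnegative:
  assumes "x \<in> S"
  shows "0 \<le> I x"
proof (rule ccontr)
  assume "\<not> ?thesis"
  then have "I x < ereal 0" by (simp add: zero_ereal_def)
  from local_bounds_consistent[OF assms this, of UNIV 0] show False
    using P_le_1[of _ UNIV] by simp
qed

text \<open>Compared with the tightness bound, a point of S outside K has I at least a + 1. A point
  of K with I above a has a neighbourhood with upper exponent c > a, which cannot meet the sublevel
  set; hence the latter is closed in K.\<close>

lemma compact_sublevel: "compact {x \<in> S. I x \<le> ereal a}" (is "compact ?A")
proof -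
  obtain K where K: "compact K" "K \<subseteq> S" "\<forall>\<^sub>F n in sequentially. P n (- K) \<le> exp (- ((a + 1) * k n))"
    using tight[of "a + 1"] by blast
  have AK: "?A \<subseteq> K"
  proof
    fix x assume x: "x \<in> ?A"
    show "x \<in> K"
    proof (rule ccontr)
      assume "x \<notin> K"
      moreover have "I x < ereal (a + 1/2)" using x by (auto intro: le_less_trans)
      moreover have "open (- K)" using K(1) by (simp add: compact_imp_closed open_Compl)
      ultimately have "a + 1 < a + 1/2" using x K(3) by (intro local_bounds_consistent[of x]) auto
      then show False by simp
    qed
  qed
  define U where "U = \<Union>{V. open V \<and> V \<inter> ?A = {}}"
  have "x \<in> U" if x: "x \<in> K" "x \<notin> ?A" for x
  proof -
    have "ereal a < I x" "x \<in> S" using x K(2) by auto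
    then obtain c where c: "ereal a < ereal c" "ereal c < I x" using ereal_dense2 by blast
    obtain V where V: "open V" "x \<in> V" "\<forall>\<^sub>F n in sequentially. P n V \<le> exp (- (c * k n))"
      using local_upper[OF \<open>x \<in> S\<close> c(2)] by blast
    have "V \<inter> ?A = {}"
    proof (rule ccontr)
      assume "V \<inter> ?A \<noteq> {}"
      then obtain y where y: "y \<in> V" "y \<in> S" "I y \<le> ereal a" by auto
      then have "I y < ereal c" using c(1) by (auto intro: le_less_trans)
      from local_bounds_consistent[OF y(2) this V(1) y(1) V(3)] show False by simp
    qed
    with V show ?thesis by (auto simp: U_def)
  qed
  then have "?A = K - U" using AK by (auto simp: U_def)
  moreover have "open U" by (auto simp: U_def)
  ultimately show ?thesis using K(1) by (simp add: compact_diff)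
qed

text \<open>Finitely many local neighbourhoods cover the compact part of F and tightness bounds the
  rest; the number of terms is absorbed by the gap between a and c.\<close>

lemma closed_upper_bound:
  assumes F: "closedin (top_of_set S) F" and a: "ereal a < (INF x\<in>F. I x)"
  shows "\<forall>\<^sub>F n in sequentially. P n F \<le> exp (- (a * k n))"
proof -
  obtain c where c: "a < c" "ereal c < (INF x\<in>F. I x)" using ereal_dense2[OF a] by auto
  obtain K where K: "compact K" "K \<subseteq> S" "\<forall>\<^sub>F n in sequentially. P n (- K) \<le> exp (- (c * k n))"
    using tight[of c] by blast
  obtain T where T: "closed T" "F = S \<inter> T" using F by (auto simp: closedin_closed)
  have FK: "compact (F \<inter> K)"
  proof -
    have "F \<inter> K = K \<inter> T" using T(2) K(2) by auto
    then show ?thesis using compact_Int_closed[OF K(1) T(1)] by simp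
  qed
  have "\<forall>x\<in>F \<inter> K. \<exists>V. open V \<and> x \<in> V \<and> (\<forall>\<^sub>F n in sequentially. P n V \<le> exp (- (c * k n)))"
  proof
    fix x assume x: "x \<in> F \<inter> K"
    then have "ereal c < I x" using c(2) by (auto intro: less_le_trans INF_lower)
    with x T show "\<exists>V. open V \<and> x \<in> V \<and> (\<forall>\<^sub>F n in sequentially. P n V \<le> exp (- (c * k n)))"
      by (intro local_upper) auto
  qed
  from bchoice[OF this] obtain V where V: "\<And>x. x \<in> F \<inter> K \<Longrightarrow> open (V x)" "\<And>x. x \<in> F \<inter> K \<Longrightarrow> x \<in> V x"
    "\<And>x. x \<in> F \<inter> K \<Longrightarrow> \<forall>\<^sub>F n in sequentially. P n (V x) \<le> exp (- (c * k n))" by auto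
  have "F \<inter> K \<subseteq> (\<Union>x\<in>F \<inter> K. V x)" using V(2) by auto
  then obtain D where D: "D \<subseteq> F \<inter> K" "finite D" "F \<inter> K \<subseteq> (\<Union>x\<in>D. V x)"
    using compactE_image[OF FK, of "F \<inter> K" V] V(1) by auto
  have V_borel: "V x \<in> sets borel" if "x \<in> D" for x
    using that D(1) V(1) by (intro borel_open) auto
  define m where "m = real (card D) + 1"
  have m: "1 \<le> m" by (simp add: m_def)
  have "\<forall>\<^sub>F n in sequentially. \<forall>x\<in>D. P n (V x) \<le> exp (- (c * k n))"
    using D V(3) by (intro eventually_ball_finite) auto
  with K(3) scale_pos[of "ln m / (c - a)"] show ?thesis
  proof eventually_elim
    case (elim n)
    have meas: "(\<Union>x\<in>D. V x) \<in> sets borel" "- K \<in> sets borel"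
      using D V(1) K(1) by (auto intro!: borel_open open_UN simp: compact_imp_closed open_Compl)
    have "P n F \<le> P n ((\<Union>x\<in>D. V x) \<union> - K)"
      using D(3) meas by (intro P_mono) auto
    also have "{\<omega> \<in> space (M n). X n \<omega> \<in> (\<Union>x\<in>D. V x) \<union> - K}
        = (\<Union>x\<in>D. {\<omega> \<in> space (M n). X n \<omega> \<in> V x}) \<union> {\<omega> \<in> space (M n). X n \<omega> \<in> - K}" by auto
    also have "measure (M n) \<dots> \<le> measure (M n) (\<Union>x\<in>D. {\<omega> \<in> space (M n). X n \<omega> \<in> V x}) + P n (- K)"
      using D(2) V_borel meas by (intro measure_Un_le sets.finite_UN event_measurable) auto
    also have "measure (M n) (\<Union>x\<in>D. {\<omega> \<in> space (M n). X n \<omega> \<in> V x}) \<le> (\<Sum>x\<in>D. P n (V x))"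
      using D(2) V_borel by (intro measure_UNION_le event_measurable) auto
    also have "(\<Sum>x\<in>D. P n (V x)) \<le> (\<Sum>x\<in>D. exp (- (c * k n)))"
      using elim(3) by (intro sum_mono) auto
    finally have "P n F \<le> m * exp (- (c * k n))" using elim(1) by (simp add: m_def algebra_simps)
    also have "\<dots> \<le> exp ((c - a) * k n) * exp (- (c * k n))"
    proof (intro mult_right_mono)
      have "ln m \<le> (c - a) * k n" using elim(2) c(1) by (simp add: field_simps)
      then have "exp (ln m) \<le> exp ((c - a) * k n)" by simp
      then show "m \<le> exp ((c - a) * k n)" using m by simp
    qed auto
    also have "\<dots> = exp (- (a * k n))" by (simp add: exp_add[symmetric] algebra_simps)
    finally show ?case .
  qed
qed

lemma open_lower_bound:
  assumes G: "openin (top_of_set S) G" and a: "(INF x\<in>G. I x) < ereal a"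
  shows "\<forall>\<^sub>F n in sequentially. exp (- (a * k n)) \<le> P n G"
proof -
  obtain T where T: "open T" "G = S \<inter> T" using G by (auto simp: openin_open)
  obtain x where x: "x \<in> G" "I x < ereal a" using a by (auto simp: INF_less_iff)
  have "\<forall>\<^sub>F n in sequentially. exp (- (a * k n)) \<le> P n T"
    using x T by (intro local_lower[of x]) auto
  moreover have "P n T = P n G" for n
    using X_in T(2) by (intro arg_cong[where f = "measure (M n)"]) auto
  ultimately show ?thesis by simp
qed

theorem obeys_LDP: "obeys_LDP S M X k I"
  unfolding obeys_LDP_def
proof (intro conjI allI impI ballI)
  fix F assume F: "closedin (top_of_set S) F"
  show "limsup (\<lambda>n. ereal (1 / k n) * log_prob (P n F)) \<le> - (INF x\<in>F. I x)"
  proof (rule ccontr)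
    assume "\<not> ?thesis"
    then have "- (INF x\<in>F. I x) < limsup (\<lambda>n. ereal (1 / k n) * log_prob (P n F))" by simp
    then obtain r where r: "- (INF x\<in>F. I x) < ereal r" "ereal r < limsup (\<lambda>n. ereal (1 / k n) * log_prob (P n F))"
      using ereal_dense2 by blast
    have "ereal (- r) < (INF x\<in>F. I x)" using r(1) by (metis ereal_uminus_less_reorder uminus_ereal.simps(1))
    from closed_upper_bound[OF F this] scale_pos[of 0]
    have "\<forall>\<^sub>F n in sequentially. ereal (1 / k n) * log_prob (P n F) \<le> ereal r"
    proof eventually_elim
      case (elim n)
      then show ?case using log_prob_le[of "P n F" "- r" "k n"] by simp
    qed
    then have "limsup (\<lambda>n. ereal (1 / k n) * log_prob (P n F)) \<le> ereal r" by (rule Limsup_bounded)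
    with r(2) show False by simp
  qed
next
  fix G assume G: "openin (top_of_set S) G"
  show "- (INF x\<in>G. I x) \<le> liminf (\<lambda>n. ereal (1 / k n) * log_prob (P n G))"
  proof (rule ccontr)
    assume "\<not> ?thesis"
    then have "liminf (\<lambda>n. ereal (1 / k n) * log_prob (P n G)) < - (INF x\<in>G. I x)" by simp
    then obtain r where r: "liminf (\<lambda>n. ereal (1 / k n) * log_prob (P n G)) < ereal r" "ereal r < - (INF x\<in>G. I x)"
      using ereal_dense2 by blast
    have "(INF x\<in>G. I x) < ereal (- r)" using r(2) by (metis ereal_less_uminus_reorder uminus_ereal.simps(1))
    from open_lower_bound[OF G this] scale_pos[of 0]
    have "\<forall>\<^sub>F n in sequentially. ereal r \<le> ereal (1 / k n) * log_prob (P n G)"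
    proof eventually_elim
      case (elim n)
      then show ?case using log_prob_ge[of "- r" "k n" "P n G"] by simp
    qed
    then have "ereal r \<le> liminf (\<lambda>n. ereal (1 / k n) * log_prob (P n G))" by (rule Liminf_bounded)
    with r(1) show False by simp
  qed
qed (use prob measurable scale rate_nonnegative compact_sublevel in auto)

end

section \<open>Contraction principle and compactness in the sequence space\<close>

text \<open>The last two hypotheses say that I' is the minimum of I over each fibre of g, and that
  it is attained. Hence sublevel sets of I' are images of sublevel sets of I, and infima over
  preimages reduce to infima of I'.\<close>

lemma obeys_LDP_contraction:
  fixes g :: "'a::metric_space \<Rightarrow> 'c::metric_space"
  assumes LDP: "obeys_LDP S M X k I"
    and g: "continuous_on S g" "g \<in> S \<rightarrow> S'"
    and le: "\<And>x. x \<in> S \<Longrightarrow> I' (g x) \<le> I x"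
    and attained: "\<And>y. y \<in> S' \<Longrightarrow> \<exists>x\<in>S. g x = y \<and> I x = I' y"
  shows "obeys_LDP S' M (\<lambda>n \<omega>. g (X n \<omega>)) k I'"
proof -
  have ldp: "\<And>n. prob_space (M n)" "\<And>n. X n \<in> M n \<rightarrow>\<^sub>M restrict_space borel S"
    "filterlim k at_top sequentially" "\<And>x. x \<in> S \<Longrightarrow> 0 \<le> I x"
    "\<And>a. 0 \<le> a \<Longrightarrow> compact {x \<in> S. I x \<le> ereal a}"
    "\<And>F. closedin (top_of_set S) F \<Longrightarrow>
       limsup (\<lambda>n. ereal (1 / k n) * log_prob (measure (M n) {\<omega> \<in> space (M n). X n \<omega> \<in> F})) \<le> - (INF x\<in>F. I x)"
    "\<And>G. openin (top_of_set S) G \<Longrightarrow>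
       - (INF x\<in>G. I x) \<le> liminf (\<lambda>n. ereal (1 / k n) * log_prob (measure (M n) {\<omega> \<in> space (M n). X n \<omega> \<in> G}))"
    using LDP unfolding obeys_LDP_def by auto
  have X_in: "X n \<omega> \<in> S" if "\<omega> \<in> space (M n)" for n \<omega>
    using measurable_space[OF ldp(2) that] by (simp add: space_restrict_space)
  have ev: "{\<omega> \<in> space (M n). g (X n \<omega>) \<in> A} = {\<omega> \<in> space (M n). X n \<omega> \<in> S \<inter> g -` A}" for n A
    using X_in by auto
  show ?thesis
    unfolding obeys_LDP_def ev
  proof (intro conjI allI impI ballI)
    fix n
    have "g \<in> restrict_space borel S \<rightarrow>\<^sub>M restrict_space borel S'"
      using borel_measurable_continuous_on_restrict[OF g(1)] g(2)
      by (intro measurable_restrict_space2) (auto simp: space_restrict_space)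
    then show "(\<lambda>\<omega>. g (X n \<omega>)) \<in> M n \<rightarrow>\<^sub>M restrict_space borel S'"
      by (rule measurable_compose[OF ldp(2)])
  next
    fix y assume "y \<in> S'"
    then show "0 \<le> I' y" using attained ldp(4) by metis
  next
    fix a :: real assume "0 \<le> a"
    have "{y \<in> S'. I' y \<le> ereal a} = g ` {x \<in> S. I x \<le> ereal a}"
    proof (intro equalityI subsetI)
      fix y assume "y \<in> {y \<in> S'. I' y \<le> ereal a}"
      then show "y \<in> g ` {x \<in> S. I x \<le> ereal a}" using attained[of y] by force
    next
      fix y assume "y \<in> g ` {x \<in> S. I x \<le> ereal a}"
      then show "y \<in> {y \<in> S'. I' y \<le> ereal a}" using le g(2) by (auto intro: order.trans)
    qed
    moreover have "compact (g ` {x \<in> S. I x \<le> ereal a})"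
      using ldp(5)[OF \<open>0 \<le> a\<close>] g(1) by (intro compact_continuous_image) (auto intro: continuous_on_subset)
    ultimately show "compact {y \<in> S'. I' y \<le> ereal a}" by simp
  next
    fix F assume F: "closedin (top_of_set S') F"
    have "closedin (top_of_set S) (S \<inter> g -` F)"
      using F g by (intro continuous_closedin_preimage_gen) auto
    from ldp(6)[OF this]
    have "limsup (\<lambda>n. ereal (1 / k n) * log_prob (measure (M n) {\<omega> \<in> space (M n). X n \<omega> \<in> S \<inter> g -` F}))
      \<le> - (INF x\<in>S \<inter> g -` F. I x)" .
    also have "\<dots> \<le> - (INF y\<in>F. I' y)"
      unfolding ereal_minus_le_minus
    proof (rule INF_greatest)
      fix x assume x: "x \<in> S \<inter> g -` F"
      then have "(INF y\<in>F. I' y) \<le> I' (g x)" by (intro INF_lower) auto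
      also have "\<dots> \<le> I x" using x by (intro le) auto
      finally show "(INF y\<in>F. I' y) \<le> I x" .
    qed
    finally show "limsup (\<lambda>n. ereal (1 / k n) * log_prob (measure (M n) {\<omega> \<in> space (M n). X n \<omega> \<in> S \<inter> g -` F}))
      \<le> - (INF y\<in>F. I' y)" .
  next
    fix G assume G: "openin (top_of_set S') G"
    have "- (INF y\<in>G. I' y) \<le> - (INF x\<in>S \<inter> g -` G. I x)"
      unfolding ereal_minus_le_minus
    proof (rule INF_greatest)
      fix y assume y: "y \<in> G"
      then have "y \<in> S'" using openin_subset[OF G] by auto
      then obtain x where "x \<in> S" "g x = y" "I x = I' y" using attained by blast
      with y show "(INF x\<in>S \<inter> g -` G. I x) \<le> I' y" by (intro INF_lower2[of x]) auto
    qed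
    also have "\<dots> \<le> liminf (\<lambda>n. ereal (1 / k n) * log_prob (measure (M n) {\<omega> \<in> space (M n). X n \<omega> \<in> S \<inter> g -` G}))"
      using G g by (intro ldp(7) continuous_openin_preimage) auto
    finally show "- (INF y\<in>G. I' y)
      \<le> liminf (\<lambda>n. ereal (1 / k n) * log_prob (measure (M n) {\<omega> \<in> space (M n). X n \<omega> \<in> S \<inter> g -` G}))" .
  qed (use ldp in auto)
qed

text \<open>A closed part of the product of the intervals {0..M}, which is compact by Tychonoff's
  theorem.\<close>

lemma compact_nonincreasing_bounded: "compact {u \<in> nonincreasing_seqs. u 0 \<le> M}"
proof -
  have "compactin (product_topology (\<lambda>_::nat. euclidean) UNIV) (\<Pi>\<^sub>E i\<in>UNIV. {0..M::real})"
    by (subst compactin_PiE) auto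
  then have "compact (\<Pi>\<^sub>E i\<in>(UNIV::nat set). {0..M::real})"
    by (simp add: euclidean_product_topology)
  moreover have "closed ({u :: nat \<Rightarrow> real. \<forall>i. u (Suc i) \<le> u i} \<inter> {u. \<forall>i. 0 \<le> u i} \<inter> {u. u 0 \<le> M})"
    by (intro closed_Int closed_Collect_all closed_Collect_le continuous_intros continuous_on_product_coordinates)
  ultimately have "compact ((\<Pi>\<^sub>E i\<in>(UNIV::nat set). {0..M::real}) \<inter>
      ({u :: nat \<Rightarrow> real. \<forall>i. u (Suc i) \<le> u i} \<inter> {u. \<forall>i. 0 \<le> u i} \<inter> {u. u 0 \<le> M}))"
    by (rule compact_Int_closed)
  also have "(\<Pi>\<^sub>E i\<in>(UNIV::nat set). {0..M::real}) \<inter>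
      ({u :: nat \<Rightarrow> real. \<forall>i. u (Suc i) \<le> u i} \<inter> {u. \<forall>i. 0 \<le> u i} \<inter> {u. u 0 \<le> M})
      = {u \<in> nonincreasing_seqs. u 0 \<le> M}"
    unfolding nonincreasing_seqs_def decseq_Suc_iff
  proof (intro equalityI subsetI)
    fix u :: "nat \<Rightarrow> real" assume u: "u \<in> {u \<in> {u. (\<forall>n. u (Suc n) \<le> u n) \<and> (\<forall>i. 0 \<le> u i)}. u 0 \<le> M}"
    then have "u i \<le> u 0" for i using decseqD[of u 0 i] by (auto simp: decseq_Suc_iff)
    moreover have "u 0 \<le> M" using u by simp
    ultimately have "u i \<le> M" for i by (rule order.trans)
    with u show "u \<in> (\<Pi>\<^sub>E i\<in>(UNIV::nat set). {0..M::real}) \<inter>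
      ({u :: nat \<Rightarrow> real. \<forall>i. u (Suc i) \<le> u i} \<inter> {u. \<forall>i. 0 \<le> u i} \<inter> {u. u 0 \<le> M})"
      by auto
  qed auto
  finally show ?thesis .
qed

section \<open>Minimising the action for a given largest component\<close>

text \<open>By convexity k entries y and one entry t are extremal. An entry x \<le> t is taken out
  of t; an entry x > t is taken out of one full y, leaving y + t - x. Neither exchange decreases the
  bound.\<close>

lemma sum_cubes_le:
  fixes w :: "nat \<Rightarrow> real"
  assumes w: "\<And>i. 0 \<le> w i" "\<And>i. w i \<le> y" and "0 \<le> t" "(\<Sum>i<n. w i) \<le> real k * y + t"
  shows "(\<Sum>i<n. w i ^ 3) \<le> real k * y ^ 3 + t ^ 3"
  using assms(3,4)
proof (induction n arbitrary: k t)
  case 0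
  have "0 \<le> y" using w[of 0] by linarith
  with 0 show ?case by simp
next
  case (Suc n)
  define x where "x = w n"
  have x: "0 \<le> x" "x \<le> y" using w by (auto simp: x_def)
  have s: "(\<Sum>i<n. w i) + x \<le> real k * y + t" using Suc.prems by (simp add: x_def)
  have s0: "0 \<le> (\<Sum>i<n. w i)" using w by (intro sum_nonneg) auto
  show ?case
  proof (cases "x \<le> t")
    case True
    have "(\<Sum>i<n. w i ^ 3) \<le> real k * y ^ 3 + (t - x) ^ 3"
      using s True by (intro Suc.IH) auto
    moreover have "(t - x) ^ 3 + x ^ 3 \<le> t ^ 3"
    proof -
      have "t ^ 3 - ((t - x) ^ 3 + x ^ 3) = 3 * t * x * (t - x)" by (simp add: power3_eq_cube algebra_simps)
      moreover have "0 \<le> 3 * t * x * (t - x)" using x True Suc.prems by simp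
      ultimately show ?thesis by linarith
    qed
    ultimately show ?thesis by (simp add: x_def)
  next
    case False
    then have "k \<noteq> 0" using s s0 by (intro notI) simp
    then obtain k' where k': "k = Suc k'" by (cases k) auto
    have "(\<Sum>i<n. w i ^ 3) \<le> real k' * y ^ 3 + (y + t - x) ^ 3"
      using s x Suc.prems k' by (intro Suc.IH) (auto simp: algebra_simps)
    moreover have "(y + t - x) ^ 3 + x ^ 3 \<le> y ^ 3 + t ^ 3"
    proof -
      have "y ^ 3 + t ^ 3 - ((y + t - x) ^ 3 + x ^ 3) = 3 * (y + t) * (x - t) * (y - x)"
        by (simp add: power3_eq_cube algebra_simps)
      moreover have "0 \<le> 3 * (y + t) * (x - t) * (y - x)" using x False Suc.prems by simp
      ultimately show ?thesis by linarith
    qed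
    ultimately show ?thesis by (simp add: x_def k' algebra_simps)
  qed
qed

lemma suminf_cubes_le:
  assumes u: "u \<in> nonincreasing_seqs" "summable u" and "0 \<le> t" "suminf u \<le> real k * u 0 + t"
  shows "(\<Sum>i. u i ^ 3) \<le> real k * u 0 ^ 3 + t ^ 3"
proof (rule suminf_le_const[OF summable_cubes[OF u]])
  fix n
  have u': "\<And>i. 0 \<le> u i" "\<And>i. u i \<le> u 0" using u(1) by (auto simp: nonincreasing_seqs_def decseq_def)
  have "(\<Sum>i<n. u i) \<le> suminf u" using u(2) u' by (intro sum_le_suminf) auto
  then show "(\<Sum>i<n. u i ^ 3) \<le> real k * u 0 ^ 3 + t ^ 3"
    using assms u' by (intro sum_cubes_le) auto
qed

text \<open>The cost of a last component of size \<open>t\<close> when the other ones leave the drift \<open>r\<close>.\<close>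

lemma last_component_cost:
  fixes r y t :: real
  assumes "0 \<le> r" "r \<le> t" "t \<le> y"
  shows "- (min (2 * r) y ^ 3) / 24 + (min (2 * r) y - r) ^ 3 / 6 \<le> - (t ^ 3) / 24 + (t - r) ^ 3 / 6"
proof (cases "2 * r \<le> y")
  case True
  have "24 * ((- (t ^ 3) / 24 + (t - r) ^ 3 / 6) - (- ((2 * r) ^ 3) / 24 + (2 * r - r) ^ 3 / 6))
      = 3 * t * (t - 2 * r)\<^sup>2"
    by (simp add: power3_eq_cube power2_eq_square field_simps)
  moreover have "0 \<le> 3 * t * (t - 2 * r)\<^sup>2" using assms by simp
  ultimately show ?thesis using True by simp
next
  case False
  define a where "a = y - r"
  define b where "b = t - r"
  have ab: "0 \<le> b" "b \<le> a" "a \<le> r" using assms False by (auto simp: a_def b_def)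
  have "24 * ((- (t ^ 3) / 24 + (t - r) ^ 3 / 6) - (- (y ^ 3) / 24 + (y - r) ^ 3 / 6))
      = (a - b) * ((a + r)\<^sup>2 - (2 * a)\<^sup>2 + ((a + r) * (b + r) - (2 * a) * (2 * b)) + ((b + r)\<^sup>2 - (2 * b)\<^sup>2))"
    by (simp add: a_def b_def power3_eq_cube power2_eq_square field_simps)
  moreover have "(2 * a)\<^sup>2 \<le> (a + r)\<^sup>2" using ab by (intro power_mono) auto
  moreover have "(2 * b)\<^sup>2 \<le> (b + r)\<^sup>2" using ab by (intro power_mono) auto
  moreover have "(2 * a) * (2 * b) \<le> (a + r) * (b + r)" using ab by (intro mult_mono) auto
  ultimately have "0 \<le> 24 * ((- (t ^ 3) / 24 + (t - r) ^ 3 / 6) - (- (y ^ 3) / 24 + (y - r) ^ 3 / 6))"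
    using ab by (metis add_nonneg_nonneg diff_ge_0_iff_ge mult_nonneg_nonneg)
  with False show ?thesis by simp
qed

text \<open>For a given total s the cubes are bounded by \<open>suminf_cubes_le\<close>, so only s
  remains to be optimised. For y below \<theta>, m components of size y fit into the drift and leave
  r; the cost of the next one is settled by \<open>last_component_cost\<close>.\<close>

lemma I_beta_le_I_U:
  assumes u: "u \<in> nonincreasing_seqs"
  shows "I_beta \<theta> (u 0) \<le> I_U \<theta> u"
proof (cases "summable u")
  case True
  define y where "y = u 0"
  define s where "s = suminf u"
  define C where "C = (\<Sum>i. u i ^ 3)"
  have u0: "\<And>i. 0 \<le> u i" "\<And>i. u i \<le> y" using u by (auto simp: nonincreasing_seqs_def decseq_def y_def)
  have IU: "I_U \<theta> u = ereal (- (1/24) * C + (1/6) * max ((s - \<theta>) ^ 3) 0 + \<theta> ^ 3 / 6)"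
    using True by (simp add: I_U_def C_def s_def)
  have C_le: "C \<le> real k * y ^ 3 + t ^ 3" if "0 \<le> t" "s \<le> real k * y + t" for k t
    using suminf_cubes_le[OF u True that(1), of k] that(2) by (simp add: C_def s_def y_def)
  have ys: "y \<le> s"
    using sum_le_suminf[OF True, of "{0}"] u0 by (simp add: y_def s_def)
  consider "y = 0" | "0 < y" "y < max \<theta> 0" | "0 < y" "max \<theta> 0 \<le> y" using u0(1)[of 0] by (fastforce simp: y_def)
  then show ?thesis
  proof cases
    case 1
    then have "u = (\<lambda>_. 0)" using u0 by (intro ext) (simp add: order_antisym)
    then have "s = 0" "C = 0" by (simp_all add: s_def C_def)
    moreover have "max ((- \<theta>) ^ 3) 0 + \<theta> ^ 3 = max (\<theta> ^ 3) 0" by (simp add: max_def)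
    ultimately show ?thesis unfolding IU y_def[symmetric] 1 I_beta_def by simp
  next
    case 2
    define m where "m = nat \<lfloor>\<theta> / y\<rfloor>"
    define r where "r = \<theta> - real m * y"
    have \<theta>: "y < \<theta>" using 2 by auto
    have fl: "of_int \<lfloor>\<theta> / y\<rfloor> = real m" using 2 \<theta> by (simp add: m_def)
    have r: "0 \<le> r" "r \<le> y"
    proof -
      have "real m \<le> \<theta> / y" "\<theta> / y \<le> real m + 1" unfolding fl[symmetric] by linarith+
      then show "0 \<le> r" "r \<le> y" using 2 by (auto simp: r_def field_simps)
    qed
    define v where "v = min (2 * r) y"
    have Ib: "I_beta \<theta> y = ereal (- real m * (y ^ 3 / 24) - (1/24) * v ^ 3 + (1/6) * (v - r) ^ 3 + \<theta> ^ 3 / 6)"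
      using 2 \<theta> unfolding I_beta_def Let_def fl by (simp add: v_def r_def algebra_simps)
    define y3 where "y3 = real m * y ^ 3"
    have C_le_y3: "C \<le> y3 + t ^ 3" if "0 \<le> t" "s \<le> real m * y + t" for t
      using C_le[OF that] by (simp add: y3_def)
    define Q where "Q = max ((s - \<theta>) ^ 3) 0"
    have Q: "0 \<le> Q" "(s - \<theta>) ^ 3 \<le> Q" by (auto simp: Q_def)
    have "- (v ^ 3) / 24 + (v - r) ^ 3 / 6 \<le> y3 / 24 - C / 24 + Q / 6"
    proof -
      \<comment> \<open>The total does not reach \<theta>; or it is completed by a last component t
        between r and y; or it exceeds m + 1 full components, and superadditivity of the cube shows
        that the excess q does not pay.\<close>
      consider "s \<le> \<theta>" | "\<theta> < s" "s - real m * y \<le> y" | "y < s - real m * y" by linarith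
      then show ?thesis
      proof cases
        case 1
        have "- (v ^ 3) / 24 + (v - r) ^ 3 / 6 \<le> - (r ^ 3) / 24 + (r - r) ^ 3 / 6"
          unfolding v_def using r by (intro last_component_cost) auto
        then have "- (v ^ 3) / 24 + (v - r) ^ 3 / 6 \<le> - (r ^ 3) / 24" by simp
        moreover have "C \<le> y3 + r ^ 3" using r 1 by (intro C_le_y3) (auto simp: r_def)
        ultimately show ?thesis using Q by linarith
      next
        case 2
        define t where "t = s - real m * y"
        have t: "r \<le> t" "t \<le> y" using 2 by (auto simp: t_def r_def)
        have "- (v ^ 3) / 24 + (v - r) ^ 3 / 6 \<le> - (t ^ 3) / 24 + (t - r) ^ 3 / 6"
          unfolding v_def using r t by (intro last_component_cost) auto
        moreover have "C \<le> y3 + t ^ 3" using r t by (intro C_le_y3) (auto simp: t_def)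
        moreover have "(t - r) ^ 3 = (s - \<theta>) ^ 3" by (simp add: t_def r_def)
        ultimately show ?thesis using Q by linarith
      next
        case 3
        define q where "q = s - real (Suc m) * y"
        have q: "0 \<le> q" using 3 by (simp add: q_def algebra_simps)
        have "- (v ^ 3) / 24 + (v - r) ^ 3 / 6 \<le> - (y ^ 3) / 24 + (y - r) ^ 3 / 6"
          unfolding v_def using r by (intro last_component_cost) auto
        moreover have "C \<le> real (Suc m) * y ^ 3 + q ^ 3" using q by (intro C_le) (auto simp: q_def)
        then have "C \<le> y3 + y ^ 3 + q ^ 3" by (simp add: y3_def algebra_simps)
        moreover have "((y - r) + q) ^ 3 = (s - \<theta>) ^ 3"
          by (rule arg_cong[where f = "\<lambda>x. x ^ 3"]) (simp add: q_def r_def algebra_simps)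
        moreover have "(y - r) ^ 3 + q ^ 3 \<le> ((y - r) + q) ^ 3" using r q by (intro cube_superadditive) auto
        moreover have "0 \<le> q ^ 3" using q by simp
        ultimately show ?thesis using Q by linarith
      qed
    qed
    then show ?thesis unfolding IU y_def[symmetric] Ib Q_def y3_def by (simp add: field_simps)
  next
    case 3
    define q where "q = s - y"
    have q: "0 \<le> q" using ys by (simp add: q_def)
    have "C \<le> real 1 * y ^ 3 + q ^ 3" using q by (intro C_le) (auto simp: q_def)
    then have "C \<le> y ^ 3 + q ^ 3" by simp
    moreover have "(y - \<theta>) ^ 3 + q ^ 3 \<le> ((y - \<theta>) + q) ^ 3" using 3 q by (intro cube_superadditive) auto
    moreover have "((y - \<theta>) + q) ^ 3 = (s - \<theta>) ^ 3" by (simp add: q_def)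
    moreover have "(s - \<theta>) ^ 3 \<le> max ((s - \<theta>) ^ 3) 0" by simp
    moreover have "0 \<le> q ^ 3" using q by simp
    ultimately have "- (y ^ 3 / 24) + (y - \<theta>) ^ 3 / 6 \<le> - (1/24) * C + (1/6) * max ((s - \<theta>) ^ 3) 0" by linarith
    then show ?thesis unfolding IU y_def[symmetric] using 3 by (simp add: I_beta_def less_max_iff_disj)
  qed
next
  case False
  then show ?thesis by (simp add: I_U_def)
qed

text \<open>The minimiser repeats y as often as it fits into the drift and adds one component of
  twice the leftover drift, the size of the giant there, capped at y.\<close>

lemma I_beta_attained:
  assumes "0 \<le> y"
  shows "\<exists>u\<in>nonincreasing_seqs. u 0 = y \<and> I_U \<theta> u = I_beta \<theta> y"
proof -
  have IU: "I_U \<theta> u = ereal (- (1/24) * (\<Sum>i\<le>m. u i ^ 3) + (1/6) * max (((\<Sum>i\<le>m. u i) - \<theta>) ^ 3) 0 + \<theta> ^ 3 / 6)"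
    if "\<And>i. m < i \<Longrightarrow> u i = 0" for u m
  proof -
    have "summable u" using that by (intro summable_finite[of "{..m}"]) auto
    moreover have "suminf u = (\<Sum>i\<le>m. u i)" "(\<Sum>i. u i ^ 3) = (\<Sum>i\<le>m. u i ^ 3)"
      using that by (intro suminf_finite; auto simp: not_le)+
    ultimately show ?thesis by (simp add: I_U_def)
  qed
  consider "y = 0" | "0 < y" "y < max \<theta> 0" | "0 < y" "max \<theta> 0 \<le> y" using assms by fastforce
  then show ?thesis
  proof cases
    case 1
    have "max ((- \<theta>) ^ 3) 0 + \<theta> ^ 3 = max (\<theta> ^ 3) 0" by (simp add: max_def)
    then show ?thesis using IU[of 0 "\<lambda>_. 0"] 1
      by (intro bexI[of _ "\<lambda>_. 0"]) (auto simp: nonincreasing_seqs_def decseq_def I_beta_def)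
  next
    case 2
    define m where "m = nat \<lfloor>\<theta> / y\<rfloor>"
    have \<theta>: "y < \<theta>" using 2 by auto
    have fl: "of_int \<lfloor>\<theta> / y\<rfloor> = real m" using 2 \<theta> by (simp add: m_def)
    have m: "real m \<le> \<theta> / y" "\<theta> / y \<le> real m + 1" unfolding fl[symmetric] by linarith+
    then have r: "0 \<le> \<theta> - real m * y" "\<theta> - real m * y \<le> y" using 2 by (auto simp: field_simps)
    have "1 < \<theta> / y" using 2 \<theta> by simp
    with m(2) have m0: "0 < m" by simp
    define v where "v = min (2 * (\<theta> - real m * y)) y"
    have v: "0 \<le> v" "v \<le> y" using r 2 by (auto simp: v_def)
    \<comment> \<open>Since v is at least the leftover drift, the total reaches \<theta> and the
      maximum in \<open>I_U\<close> is the cube itself.\<close>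
    have "w \<le> min (2 * w) y" if "0 \<le> w" "w \<le> y" for w using that by simp
    from this[OF r] have "\<theta> - real m * y \<le> v" unfolding v_def .
    then have v_ge: "\<theta> \<le> real m * y + v" by simp
    define u where "u i = (if i < m then y else if i = m then v else 0)" for i
    have sums: "(\<Sum>i\<le>m. u i) = real m * y + v" "(\<Sum>i\<le>m. u i ^ 3) = real m * y ^ 3 + v ^ 3"
      unfolding lessThan_Suc_atMost[symmetric] by (simp_all add: u_def)
    have "u \<in> nonincreasing_seqs" using v 2 by (auto simp: nonincreasing_seqs_def decseq_def u_def)
    moreover have "u 0 = y" using m0 by (simp add: u_def)
    moreover have "I_U \<theta> u = I_beta \<theta> y"
    proof -
      have "max ((real m * y + v - \<theta>) ^ 3) 0 = (real m * y + v - \<theta>) ^ 3" using v_ge by simp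
      then show ?thesis
        using IU[of m u] 2 \<theta> unfolding sums I_beta_def Let_def fl v_def[symmetric]
        by (simp add: u_def field_simps)
    qed
    ultimately show ?thesis by blast
  next
    case 3
    define u where "u i = (if i = 0 then y else 0)" for i :: nat
    have "u \<in> nonincreasing_seqs" using 3 by (auto simp: nonincreasing_seqs_def decseq_def u_def)
    moreover have "u 0 = y" by (simp add: u_def)
    moreover have "I_U \<theta> u = I_beta \<theta> y"
    proof -
      have "max ((y - \<theta>) ^ 3) 0 = (y - \<theta>) ^ 3" using 3 by simp
      then show ?thesis using IU[of 0 u] 3 by (simp add: u_def I_beta_def less_max_iff_disj)
    qed
    ultimately show ?thesis by blast
  qed
qed

section \<open>The random graph\<close>

lemma component_size_nonincreasing:
  assumes "0 \<le> l"
  shows "(\<lambda>i. real (component_size n E i) / l) \<in> nonincreasing_seqs"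
  using assms nth_size_antimono
  by (auto simp: nonincreasing_seqs_def decseq_def component_size_eq intro!: divide_right_mono)

lemma prob_scaled_sizes:
  assumes "0 \<le> p" "p \<le> 1"
  shows "measure_pmf.prob (random_graph n p) {E. (\<lambda>i. real (component_size n E i) / l) \<in> A}
    = size_law p n (\<lambda>X. of_bool (scaled_sizes l X \<in> A))"
proof -
  have "(\<lambda>i. real (component_size n E i) / l) = scaled_sizes l (sizes (connected_components n E))" for E
    by (simp add: scaled_sizes_def component_size_eq fun_eq_iff)
  then show ?thesis
    using prob_random_graph[OF assms, of n "\<lambda>X. scaled_sizes l X \<in> A"] by simp
qed

text \<open>Here \<epsilon> = (b / sqrt n)^(2/3), so its convergence to 0 is the hypothesis on b /
  sqrt n; n \<epsilon>^3 = b^2 is the scale and n \<epsilon> = (n b)^(2/3) the unit of size. The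
  drift is the last hypothesis rewritten.\<close>

lemma near_critical_scaling:
  fixes b c :: "nat \<Rightarrow> real" and \<theta> :: real
  assumes b: "filterlim b at_top sequentially"
    and b_small: "(\<lambda>n. b n / sqrt (real n)) \<longlonglongrightarrow> 0"
    and drift: "(\<lambda>n. real n powr (1/3) / b n powr (2/3) * (c n - 1)) \<longlonglongrightarrow> \<theta>"
  defines "e \<equiv> \<lambda>n. b n powr (2/3) / real n powr (1/3)"
  shows "near_critical (\<lambda>n. c n / real n) e \<theta>"
    and "\<forall>\<^sub>F n in sequentially. real n * e n ^ 3 = (b n)\<^sup>2 \<and> real n * e n = (real n * b n) powr (2/3)"
proof -
  have pos: "\<forall>\<^sub>F n in sequentially. 0 < b n \<and> 0 < n"
    using filterlim_at_top_dense[THEN iffD1, OF b, rule_format, of 0] eventually_gt_at_top[of 0]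
    by eventually_elim auto
  show eqs: "\<forall>\<^sub>F n in sequentially. real n * e n ^ 3 = (b n)\<^sup>2 \<and> real n * e n = (real n * b n) powr (2/3)"
    using pos
  proof eventually_elim
    case (elim n)
    have "(b n powr (2/3)) ^ 3 = (b n)\<^sup>2" "(real n powr (1/3)) ^ 3 = real n"
      using elim by (simp_all add: powr_power powr_numeral)
    then have "real n * e n ^ 3 = (b n)\<^sup>2" using elim by (simp add: e_def power_divide)
    moreover have "real n / real n powr (1/3) = real n powr (2/3)"
    proof -
      have "real n powr (2/3) * real n powr (1/3) = real n powr 1" by (simp flip: powr_add)
      then show ?thesis using elim by (simp add: field_simps)
    qed
    moreover have "real n * e n = real n / real n powr (1/3) * b n powr (2/3)" by (simp add: e_def)
    ultimately have "real n * e n ^ 3 = (b n)\<^sup>2" "real n * e n = (real n * b n) powr (2/3)"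
      using elim by (simp_all add: powr_mult)
    then show ?case by simp
  qed
  show "near_critical (\<lambda>n. c n / real n) e \<theta>"
  proof
    show "\<forall>\<^sub>F n in sequentially. 0 < e n"
      using pos by eventually_elim (simp add: e_def)
    have "(\<lambda>n. (b n / sqrt (real n)) powr (2/3)) \<longlonglongrightarrow> 0"
    proof (rule tendsto_zero_powrI[OF b_small tendsto_const])
      show "\<forall>\<^sub>F n in sequentially. 0 \<le> b n / sqrt (real n)"
        using pos by eventually_elim simp
    qed simp
    moreover have "\<forall>\<^sub>F n in sequentially. (b n / sqrt (real n)) powr (2/3) = e n"
      using pos
    proof eventually_elim
      case (elim n)
      have "sqrt (real n) powr (2/3) = real n powr (1/3)"
        using elim by (simp add: powr_half_sqrt[symmetric] powr_powr)
      then show ?case using elim by (simp add: e_def powr_divide)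
    qed
    ultimately show "e \<longlonglongrightarrow> 0" by (rule Lim_transform_eventually)
    have "filterlim (\<lambda>n. (b n)\<^sup>2) at_top sequentially"
      by (rule filterlim_pow_at_top[OF _ b]) simp
    moreover have "\<forall>\<^sub>F n in sequentially. (b n)\<^sup>2 = real n * e n ^ 3"
      using eqs by eventually_elim simp
    ultimately show "filterlim (\<lambda>n. real n * e n ^ 3) at_top sequentially"
      by (rule filterlim_mono_eventually[OF _ order.refl order.refl])
    have "\<forall>\<^sub>F n in sequentially. real n powr (1/3) / b n powr (2/3) * (c n - 1)
        = (real n * (c n / real n) - 1) / e n"
      using pos by eventually_elim (simp add: e_def)
    with drift show "(\<lambda>n. (real n * (c n / real n) - 1) / e n) \<longlonglongrightarrow> \<theta>"
      by (rule Lim_transform_eventually)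
  qed
qed

theorem corollary2p5:
  fixes b c :: "nat \<Rightarrow> real" and \<theta> :: real
  assumes "filterlim b at_top sequentially"
    and "(\<lambda>n. b n / sqrt (real n)) \<longlonglongrightarrow> 0"
    and "\<forall>\<^sub>F n in sequentially. c n / real n \<in> {0..1}"
    and "(\<lambda>n. real n powr (1/3) / b n powr (2/3) * (c n - 1)) \<longlonglongrightarrow> \<theta>"
  shows
    "obeys_LDP nonincreasing_seqs
       (\<lambda>n. measure_pmf (random_graph n (c n / real n)))
       (\<lambda>n E i. real (component_size n E i) / (real n * b n) powr (2/3))
       (\<lambda>n. (b n)\<^sup>2) (I_U \<theta>)
     \<and>
     obeys_LDP {0..}
       (\<lambda>n. measure_pmf (random_graph n (c n / real n)))
       (\<lambda>n E. real (component_size n E 0) / (real n * b n) powr (2/3))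
       (\<lambda>n. (b n)\<^sup>2) (I_beta \<theta>)"
proof -
  define e where "e = (\<lambda>n. b n powr (2/3) / real n powr (1/3))"
  interpret nc: near_critical "\<lambda>n. c n / real n" e \<theta>
    unfolding e_def by (rule near_critical_scaling(1)[OF assms(1,2,4)])
  let ?M = "\<lambda>n. measure_pmf (random_graph n (c n / real n))"
  let ?X = "\<lambda>n E i. real (component_size n E i) / (real n * b n) powr (2/3)"
  \<comment> \<open>The identities hold for large n only, once c n / n is a probability and b n is
    positive; the bounds to be checked are all asymptotic.\<close>
  have event: "\<forall>\<^sub>F n in sequentially. \<forall>A. measure (?M n) {E \<in> space (?M n). ?X n E \<in> A}
      = size_law (c n / real n) n (\<lambda>X. of_bool (scaled_sizes (nc.L n) X \<in> A)) \<and> nc.\<beta> n = (b n)\<^sup>2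
      \<and> 0 \<le> c n / real n \<and> c n / real n \<le> 1"
    using assms(3) near_critical_scaling(2)[OF assms(1,2,4)]
  proof eventually_elim
    case (elim n)
    have "nc.L n = (real n * b n) powr (2/3)" "nc.\<beta> n = (b n)\<^sup>2"
    proof -
      have "real n * e n ^ 3 = (b n)\<^sup>2" "real n * e n = (real n * b n) powr (2/3)"
        using elim(2) by (simp_all add: e_def)
      then show "nc.L n = (real n * b n) powr (2/3)" "nc.\<beta> n = (b n)\<^sup>2"
        by (simp_all add: nc.L_def nc.\<beta>_def)
    qed
    then show ?case using elim(1) by (simp add: prob_scaled_sizes)
  qed
  have X_in: "?X n E \<in> nonincreasing_seqs" for n E
    by (rule component_size_nonincreasing) simp
  interpret large_deviation_bounds nonincreasing_seqs ?M ?X "\<lambda>n. (b n)\<^sup>2" "I_U \<theta>"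
  proof (rule large_deviation_bounds.intro)
    show "prob_space (?M n)" for n by (rule measure_pmf.prob_space_axioms)
    show "?X n \<in> ?M n \<rightarrow>\<^sub>M restrict_space borel nonincreasing_seqs" for n
      using X_in by (auto simp: space_restrict_space)
    show "filterlim (\<lambda>n. (b n)\<^sup>2) at_top sequentially"
      by (rule filterlim_pow_at_top[OF _ assms(1)]) simp
  next
    fix a
    obtain K where K: "\<forall>\<^sub>F n in sequentially. size_law (c n / real n) n
        (\<lambda>X. of_bool (K \<le> scaled_sizes (nc.L n) X 0)) \<le> exp (- (a * nc.\<beta> n))"
      using nc.scaled_sizes_tight by blast
    let ?K = "{u \<in> nonincreasing_seqs. u 0 \<le> K}"
    have "\<forall>\<^sub>F n in sequentially. measure (?M n) {E \<in> space (?M n). ?X n E \<in> - ?K} \<le> exp (- (a * (b n)\<^sup>2))"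
      using K event
    proof eventually_elim
      case (elim n)
      have "measure (?M n) {E \<in> space (?M n). ?X n E \<in> - ?K} \<le> measure (?M n) {E \<in> space (?M n). ?X n E \<in> {u. K \<le> u 0}}"
        using X_in by (intro measure_pmf.finite_measure_mono) auto
      also have "\<dots> = size_law (c n / real n) n (\<lambda>X. of_bool (scaled_sizes (nc.L n) X \<in> {u. K \<le> u 0}))"
        using elim(2) by blast
      also have "\<dots> \<le> exp (- (a * (b n)\<^sup>2))" using elim by simp
      finally show ?case .
    qed
    then show "\<exists>K. compact K \<and> K \<subseteq> nonincreasing_seqs \<and>
        (\<forall>\<^sub>F n in sequentially. measure (?M n) {E \<in> space (?M n). ?X n E \<in> - K} \<le> exp (- (a * (b n)\<^sup>2)))"
      by (intro exI[of _ ?K] conjI compact_nonincreasing_bounded) auto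
  next
    fix u a assume u: "u \<in> nonincreasing_seqs" "ereal a < I_U \<theta> u"
    have "\<exists>V. open V \<and> u \<in> V \<and> (\<forall>\<^sub>F n in sequentially.
        size_law (c n / real n) n (\<lambda>X. of_bool (scaled_sizes (nc.L n) X \<in> V)) \<le> exp (- (a * nc.\<beta> n)))"
      using nc.local_upper_summable[OF u(1) _ u(2)] nc.local_upper_not_summable[OF u(1)] by blast
    then obtain V where V: "open V" "u \<in> V" "\<forall>\<^sub>F n in sequentially.
        size_law (c n / real n) n (\<lambda>X. of_bool (scaled_sizes (nc.L n) X \<in> V)) \<le> exp (- (a * nc.\<beta> n))"
      by blast
    have "\<forall>\<^sub>F n in sequentially. measure (?M n) {E \<in> space (?M n). ?X n E \<in> V} \<le> exp (- (a * (b n)\<^sup>2))"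
      using V(3) event by eventually_elim simp
    with V show "\<exists>V. open V \<and> u \<in> V \<and>
        (\<forall>\<^sub>F n in sequentially. measure (?M n) {E \<in> space (?M n). ?X n E \<in> V} \<le> exp (- (a * (b n)\<^sup>2)))"
      by blast
  next
    fix u a V assume u: "u \<in> nonincreasing_seqs" "I_U \<theta> u < ereal a" "open V" "u \<in> V"
    show "\<forall>\<^sub>F n in sequentially. exp (- (a * (b n)\<^sup>2)) \<le> measure (?M n) {E \<in> space (?M n). ?X n E \<in> V}"
      using nc.local_lower[OF u] event by eventually_elim simp
  qed
  have "obeys_LDP {0..} ?M (\<lambda>n E. ?X n E 0) (\<lambda>n. (b n)\<^sup>2) (I_beta \<theta>)"
  proof (rule obeys_LDP_contraction[OF obeys_LDP, where g = "\<lambda>u. u 0"])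
    show "continuous_on nonincreasing_seqs (\<lambda>u :: nat \<Rightarrow> real. u 0)"
      by (rule continuous_on_subset[OF continuous_on_product_coordinates]) simp
    show "(\<lambda>u. u 0) \<in> nonincreasing_seqs \<rightarrow> {0..}" by (auto simp: nonincreasing_seqs_def)
    show "I_beta \<theta> (u 0) \<le> I_U \<theta> u" if "u \<in> nonincreasing_seqs" for u
      using that by (rule I_beta_le_I_U)
    show "\<exists>u\<in>nonincreasing_seqs. u 0 = y \<and> I_U \<theta> u = I_beta \<theta> y" if "y \<in> {0..}" for y
      using I_beta_attained that by simp
  qed
  with obeys_LDP show ?thesis by blast
qed

end
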